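(* For all $t>1$ and integers $\kappa\ge0$ there exists a constant $C_{t,\kappa}>1$ such that the following holds. Let $1<p\le2$, $p'=p/(p-1)$, let $J$ be any interval, $f\in L^\infty_0(\mathbb R)$ and $\mathbb P\subset\mathbb S$ a finite collection of tiles. Then $$\big\|W[f]\mathbf 1_{\mathbb P}\big\|_{X^{tp',\infty}_2(J,\kappa,\mathsf{size}_{2,\star})}\le C_{t,\kappa}\,[f]_{p,\mathbb P},$$ provided the order $M$ of the wave packet transform satisfies $M\ge10\lceil2^8t'\rceil$, $t'=t/(t-1)$.
   Context: $L^\infty_0(\mathbb R)$: bounded compactly supported functions. $\ell_I,c_I$: length and center of $I$; $\langle x\rangle=\sqrt{1+x^2}$; $\widehat f(\xi)=(2\pi)^{-1/2}\int f(x)e^{-ix\xi}dx$. Tiles. A dyadic grid $\mathcal D$ is a collection of intervals with (a) lengths in $\{\rho2^k:k\in\mathbb Z\}$ for some $\rho=\rho_{\mathcal D}\in(\frac12,2)$; (b) for each $k$ the intervals of length $\rho2^k$ cover $\mathbb R$ up to a null set; (c) $I\cap I'\in\{\varnothing,I,I'\}$ for $I,I'\in\mathcal D$. $\mathcal D,\mathcal D'$ are dual if $\rho_{\mathcal D}\rho_{\mathcal D'}=1$. Fix dual grids $\mathcal D,\mathcal D'$. A tile is $P=I_P\times\omega_P\in\mathcal D\times\mathcal D'$ with $\ell_{I_P}\ell_{\omega_P}=1$; $\mathbb S$ is the set of all tiles. For a dyadic $\omega$, $\omega^{\mathsf p(\kappa)}$ is the interval of the same grid containing $\omega$ with length $2^\kappa\ell_\omega$.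 Wave packet transform. $\Theta^M=\{\vartheta\in\mathcal C^M(\mathbb R):\sup_{0\le\alpha\le M}\sup_x\langle x\rangle^M|D^\alpha\vartheta(x)|\le1\}$. $\Phi^M(P)$ is the set of $\varphi(x)=e^{ic_{\omega_P}x}\ell_{I_P}^{-1}\phi\big(\frac{x-c_{I_P}}{\ell_{I_P}}\big)$ with $\phi\in\Theta^M$ and $\mathrm{supp}\,\widehat\varphi\subset\omega_P$. $W[f](P)=\sup_{\varphi\in\Phi^M(P)}|\langle f,\varphi\rangle|$. Local norms. $[f]_{p,\mathbb P}=\sup_{P\in\mathbb P}\inf_{I_P}\mathrm M_pf$, $\mathrm M_pf=\sup_I\mathbf 1_I|I|^{-1/p}\|f\mathbf 1_I\|_p$ over intervals $I$. Outer spaces. A $\kappa$-tree is $T\subset\mathbb S$ together with top data $I_T\in\mathcal D$, $\xi_T\in\mathbb R$ such that $I_P\subset I_T$, $\xi_T\in\omega_P^{\mathsf p(\kappa)}$ for all $P\in T$. It is lacunary if any two distinct intervals in $\{\omega_P:P\in T\}$ are disjoint. $\mathbb S^J=\{P\in\mathbb S:I_P\subset J\}$; $\mathcal T^{J,\kappa}$ is the set of $\kappa$-trees contained in $\mathbb S^J$. For $A\subset\mathbb S^J$, $\mu^{J,\kappa}(A)=\inf\frac1{|J|}\sum_{T\in\mathcal T}|I_T|$ over all $\mathcal T\subset\mathcal T^{J,\kappa}$ with $A\subset\bigcup_{T\in\mathcal T}T$. For $F:\mathbb S^J\to\mathbb C$ and $T\in\mathcal T^{J,\kappa}$: $\mathsf{size}_2(F,T)=\big(\frac1{|I_T|}\sum_{P\in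 T}|I_P||F(P)|^2\big)^{1/2}$ and $\mathsf{size}_{2,\star}(F,T)=\sup\{\mathsf{size}_2(F,U):U\in\mathcal T^{J,\kappa}\text{ lacunary},U\subset T\}$. For a size $\mathsf s$: $\|F\|_{L^\infty(J,\kappa,\mathsf s)}=\sup_{T\in\mathcal T^{J,\kappa}}\mathsf s(F,T)$; $\mu_{\mathsf s}[F](\tau)=\inf\{\mu^{J,\kappa}(A):\|F\mathbf 1_{\mathbb S^J\setminus A}\|_{L^\infty(J,\kappa,\mathsf s)}\le\tau\}$; $F^{*,\mathsf s}(u)=\inf\{\tau\ge0:\mu_{\mathsf s}[F](\tau)\le u\}$; $\|F\|_{L^{a,q}(J,\kappa,\mathsf s)}=\|u^{1/a}F^{*,\mathsf s}(u)\|_{L^q((0,\infty),du/u)}$. For $1\le a\le r<\infty$, $$\|F\|_{X^{r,q}_a(J,\kappa,\mathsf s)}=\sup_{A}\frac{\|F\mathbf 1_A\|_{L^{a,q}(J,\kappa,\mathsf s)}}{\mu^{J,\kappa}(A)^{\frac1a-\frac1r}},$$ supremum over nonempty $A\subset\mathbb S^J$ with $\mu^{J,\kappa}(A)<\infty$. *)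

theory Defs
  imports "HOL-Probability.Essential_Supremum" "HOL-Library.Disjoint_Sets"
begin

text \<open>Powers of extended nonnegative reals; only positive exponents are intended.\<close>

definition epowr :: "ennreal \<Rightarrow> real \<Rightarrow> ennreal" where
  "epowr x s = (if x = \<infinity> then \<infinity> else ennreal (enn2real x powr s))"


section \<open>Intervals, dyadic grids and tiles\<close>

text \<open>
  Intervals are bounded and nondegenerate; the endpoints may or may not belong to them. In
  particular the intervals of a dyadic grid may be open or half-open.
\<close>

definition ivl_length :: "real set \<Rightarrow> real" where
  "ivl_length I = Sup I - Inf I"

definition ivl_center :: "real set \<Rightarrow> real" where
  "ivl_center I = (Inf I + Sup I) / 2"

definition proper_interval :: "real set \<Rightarrow> bool" where
  "proper_interval I \<longleftrightarrow> is_interval I \<and> bounded I \<and> I \<noteq> {} \<and> 0 < ivl_length I"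

definition dyadic_grid :: "real \<Rightarrow> real set set \<Rightarrow> bool" where
  "dyadic_grid \<rho> D \<longleftrightarrow>
     1/2 < \<rho> \<and> \<rho> < 2 \<and>
     (\<forall>I\<in>D. proper_interval I \<and> (\<exists>k::int. ivl_length I = \<rho> * 2 powi k)) \<and>
     (\<forall>k::int. negligible (UNIV - \<Union>{I\<in>D. ivl_length I = \<rho> * 2 powi k})) \<and>
     (\<forall>I\<in>D. \<forall>I'\<in>D. I \<inter> I' \<in> {{}, I, I'})"

definition dual_grids :: "real set set \<Rightarrow> real set set \<Rightarrow> bool" where
  "dual_grids D D' \<longleftrightarrow> (\<exists>\<rho> \<rho>'. dyadic_grid \<rho> D \<and> dyadic_grid \<rho>' D' \<and> \<rho> * \<rho>' = 1)"

text \<open>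
  The axioms of a grid determine the ancestor only up to endpoints (a grid may contain both
  \<open>{0<..<1}\<close> and \<open>{0..<1}\<close>), hence \<open>SOME\<close> instead of \<open>THE\<close>.
\<close>

definition dyadic_ancestor :: "real set set \<Rightarrow> nat \<Rightarrow> real set \<Rightarrow> real set" where
  "dyadic_ancestor D \<kappa> \<omega> =
     (SOME \<omega>'. \<omega>' \<in> D \<and> \<omega> \<subseteq> \<omega>' \<and> ivl_length \<omega>' = 2 ^ \<kappa> * ivl_length \<omega>)"

text \<open>A tile \<open>P\<close> is the pair of its spatial interval \<open>fst P\<close> and its frequency interval \<open>snd P\<close>.\<close>

type_synonym tile = "real set \<times> real set"

definition all_tiles :: "real set set \<Rightarrow> real set set \<Rightarrow> tile set" where
  "all_tiles D D' = {(I, \<omega>). I \<in> D \<and> \<omega> \<in> D' \<and> ivl_length I * ivl_length \<omega> = 1}"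

definition tiles_in :: "real set set \<Rightarrow> real set set \<Rightarrow> real set \<Rightarrow> tile set" where
  "tiles_in D D' J = {P \<in> all_tiles D D'. fst P \<subseteq> J}"


section \<open>The wave packet transform\<close>

definition bounded_compactly_supported :: "(real \<Rightarrow> complex) \<Rightarrow> bool" where
  "bounded_compactly_supported f \<longleftrightarrow>
     f \<in> borel_measurable lebesgue \<and> bounded (range f) \<and> compact (closure {x. f x \<noteq> 0})"

definition japanese :: "real \<Rightarrow> real" where
  "japanese x = sqrt (1 + x\<^sup>2)"

definition fourier :: "(real \<Rightarrow> complex) \<Rightarrow> real \<Rightarrow> complex" where
  "fourier f \<xi> = complex_of_real ((2 * pi) powr (-1/2)) * (LINT x|lebesgue. f x * cis (- (x * \<xi>)))"

definition deriv_n :: "nat \<Rightarrow> (real \<Rightarrow> complex) \<Rightarrow> real \<Rightarrow> complex" where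
  "deriv_n n = ((\<lambda>g x. vector_derivative g (at x)) ^^ n)"

definition C_n :: "nat \<Rightarrow> (real \<Rightarrow> complex) \<Rightarrow> bool" where
  "C_n n f \<longleftrightarrow>
     (\<forall>k<n. \<forall>x. deriv_n k f differentiable (at x)) \<and> continuous_on UNIV (deriv_n n f)"

definition Theta :: "nat \<Rightarrow> (real \<Rightarrow> complex) set" where
  "Theta M = {\<theta>. C_n M \<theta> \<and> (\<forall>\<alpha>\<le>M. \<forall>x. japanese x ^ M * cmod (deriv_n \<alpha> \<theta> x) \<le> 1)}"

definition Phi :: "nat \<Rightarrow> tile \<Rightarrow> (real \<Rightarrow> complex) set" where
  "Phi M P = {\<phi>. \<exists>\<theta>\<in>Theta M.
      \<phi> = (\<lambda>x. cis (ivl_center (snd P) * x) * complex_of_real (1 / ivl_length (fst P)) *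
                \<theta> ((x - ivl_center (fst P)) / ivl_length (fst P))) \<and>
      closure {\<xi>. fourier \<phi> \<xi> \<noteq> 0} \<subseteq> snd P}"

definition inner_L2 :: "(real \<Rightarrow> complex) \<Rightarrow> (real \<Rightarrow> complex) \<Rightarrow> complex" where
  "inner_L2 f g = (LINT x|lebesgue. f x * cnj (g x))"

definition wave_packet_transform :: "nat \<Rightarrow> (real \<Rightarrow> complex) \<Rightarrow> tile \<Rightarrow> real" where
  "wave_packet_transform M f P = (SUP \<phi>\<in>Phi M P. cmod (inner_L2 f \<phi>))"


section \<open>Local norms\<close>

definition maximal_fun :: "real \<Rightarrow> (real \<Rightarrow> complex) \<Rightarrow> real \<Rightarrow> ennreal" where
  "maximal_fun p f x =
     (SUP I\<in>{I. proper_interval I \<and> x \<in> I}.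
        ennreal (ivl_length I powr (-1/p)) *
        epowr (\<integral>\<^sup>+y\<in>I. ennreal (cmod (f y) powr p) \<partial>lebesgue) (1/p))"

definition local_norm :: "real \<Rightarrow> tile set \<Rightarrow> (real \<Rightarrow> complex) \<Rightarrow> ennreal" where
  "local_norm p PP f = (SUP P\<in>PP. INF x\<in>fst P. maximal_fun p f x)"


section \<open>Trees and outer spaces\<close>

record tree =
  tiles :: "tile set"
  top_ivl :: "real set"
  top_freq :: real

definition is_tree :: "real set set \<Rightarrow> real set set \<Rightarrow> nat \<Rightarrow> tree \<Rightarrow> bool" where
  "is_tree D D' \<kappa> T \<longleftrightarrow>
     tiles T \<subseteq> all_tiles D D' \<and> top_ivl T \<in> D \<and>
     (\<forall>P\<in>tiles T. fst P \<subseteq> top_ivl T \<and> top_freq T \<in> dyadic_ancestor D' \<kappa> (snd P))"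

definition lacunary :: "tree \<Rightarrow> bool" where
  "lacunary T \<longleftrightarrow> disjoint (snd ` tiles T)"

text \<open>The top interval of a tree in \<open>trees_in D D' J \<kappa>\<close> need not be contained in \<open>J\<close>.\<close>

definition trees_in :: "real set set \<Rightarrow> real set set \<Rightarrow> real set \<Rightarrow> nat \<Rightarrow> tree set" where
  "trees_in D D' J \<kappa> = {T. is_tree D D' \<kappa> T \<and> tiles T \<subseteq> tiles_in D D' J}"

definition outer_measure_tiles ::
    "real set set \<Rightarrow> real set set \<Rightarrow> real set \<Rightarrow> nat \<Rightarrow> tile set \<Rightarrow> ennreal" where
  "outer_measure_tiles D D' J \<kappa> A =
     (INF \<T>\<in>{\<T>. \<T> \<subseteq> trees_in D D' J \<kappa> \<and> A \<subseteq> (\<Union>T\<in>\<T>. tiles T)}.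
        (\<Sum>\<^sub>\<infinity>T\<in>\<T>. ennreal (ivl_length (top_ivl T))) / ennreal (ivl_length J))"

type_synonym size = "(tile \<Rightarrow> complex) \<Rightarrow> tree \<Rightarrow> ennreal"

definition size2 :: size where
  "size2 F T =
     epowr ((\<Sum>\<^sub>\<infinity>P\<in>tiles T. ennreal (ivl_length (fst P) * (cmod (F P))\<^sup>2)) /
            ennreal (ivl_length (top_ivl T))) (1/2)"

text \<open>The subtrees \<open>U\<close> carry their own top data, unrelated to those of \<open>T\<close>.\<close>

definition size2_star :: "real set set \<Rightarrow> real set set \<Rightarrow> real set \<Rightarrow> nat \<Rightarrow> size" where
  "size2_star D D' J \<kappa> F T =
     (SUP U\<in>{U \<in> trees_in D D' J \<kappa>. lacunary U \<and> tiles U \<subseteq> tiles T}. size2 F U)"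

definition restrict_to :: "tile set \<Rightarrow> (tile \<Rightarrow> complex) \<Rightarrow> tile \<Rightarrow> complex" where
  "restrict_to A F P = (if P \<in> A then F P else 0)"

text \<open>
  Functions on \<open>tiles_in D D' J\<close> are represented by functions on all tiles; the values outside
  do not enter the norms below.
\<close>

definition outer_Linf ::
    "real set set \<Rightarrow> real set set \<Rightarrow> real set \<Rightarrow> nat \<Rightarrow> size \<Rightarrow> (tile \<Rightarrow> complex) \<Rightarrow> ennreal" where
  "outer_Linf D D' J \<kappa> s F = (SUP T\<in>trees_in D D' J \<kappa>. s F T)"

definition super_level ::
    "real set set \<Rightarrow> real set set \<Rightarrow> real set \<Rightarrow> nat \<Rightarrow> size \<Rightarrow> (tile \<Rightarrow> complex) \<Rightarrow> ennreal \<Rightarrow> ennreal"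
  where
  "super_level D D' J \<kappa> s F \<tau> =
     (INF A\<in>{A. A \<subseteq> tiles_in D D' J \<and>
                outer_Linf D D' J \<kappa> s (restrict_to (tiles_in D D' J - A) F) \<le> \<tau>}.
        outer_measure_tiles D D' J \<kappa> A)"

definition rearrangement ::
    "real set set \<Rightarrow> real set set \<Rightarrow> real set \<Rightarrow> nat \<Rightarrow> size \<Rightarrow> (tile \<Rightarrow> complex) \<Rightarrow> real \<Rightarrow> ennreal"
  where
  "rearrangement D D' J \<kappa> s F u = Inf {\<tau>. super_level D D' J \<kappa> s F \<tau> \<le> ennreal u}"

definition Lq_norm :: "'a measure \<Rightarrow> ennreal \<Rightarrow> ('a \<Rightarrow> ennreal) \<Rightarrow> ennreal" where
  "Lq_norm N q g =
     (if q = \<infinity> then esssup N g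
      else epowr (\<integral>\<^sup>+u. epowr (g u) (enn2real q) \<partial>N) (1 / enn2real q))"

text \<open>The measure \<open>du/u\<close> on the positive half-line.\<close>

definition haar_pos :: "real measure" where
  "haar_pos = density (restrict_space lborel {0<..}) (\<lambda>u. ennreal (1 / u))"

definition outer_Lorentz ::
    "real set set \<Rightarrow> real set set \<Rightarrow> real set \<Rightarrow> nat \<Rightarrow> size \<Rightarrow> real \<Rightarrow> ennreal \<Rightarrow>
     (tile \<Rightarrow> complex) \<Rightarrow> ennreal" where
  "outer_Lorentz D D' J \<kappa> s a q F =
     Lq_norm haar_pos q (\<lambda>u. ennreal (u powr (1/a)) * rearrangement D D' J \<kappa> s F u)"

definition X_norm ::
    "real set set \<Rightarrow> real set set \<Rightarrow> real set \<Rightarrow> nat \<Rightarrow> size \<Rightarrow> real \<Rightarrow> real \<Rightarrow> ennreal \<Rightarrow>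
     (tile \<Rightarrow> complex) \<Rightarrow> ennreal" where
  "X_norm D D' J \<kappa> s a r q F =
     (SUP A\<in>{A. A \<noteq> {} \<and> A \<subseteq> tiles_in D D' J \<and> outer_measure_tiles D D' J \<kappa> A < \<infinity>}.
        outer_Lorentz D D' J \<kappa> s a q (restrict_to A F) /
        epowr (outer_measure_tiles D D' J \<kappa> A) (1/a - 1/r))"

end

theory Submission
  imports Defs "HOL-Probability.Characteristic_Functions" "HOL-Real_Asymp.Real_Asymp"
begin

text \<open>
  The estimate follows from two endpoint estimates by real interpolation. Let \<open>A\<close> have outer measure
  \<open>m \<ge> 1\<close>, let \<open>K\<close> exceed the local norm of \<open>f\<close>, and split \<open>f = g + h\<close> by truncation at the height
  \<open>K m\<^bsup>1/p\<^esup>\<close>. Then \<open>h\<close> has local \<open>L\<^sup>1\<close> averages at most \<open>K m\<^bsup>1/p-1\<^esup>\<close>, and every lacunary tree has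
  size at most a multiple of the local \<open>L\<^sup>1\<close> averages. On the other hand \<open>|g|\<^sup>2\<close> has local averages at most
  \<open>K\<^sup>2 m\<^bsup>2/p-1\<^esup>\<close>, and the transform maps local \<open>L\<^sup>2\<close> to weak outer \<open>L\<^sup>2\<close>: greedily selected
  trees on which the size is at least \<open>\<tau>\<close> are separated enough for Bessel's inequality, so that their top
  intervals have total length at most a multiple of \<open>K\<^sup>2 m\<^bsup>2/p-1\<^esup> |J| / \<tau>\<^sup>2\<close>. For \<open>m < 1\<close> the
  \<open>L\<^sup>1\<close> estimate alone suffices.
\<close>

section \<open>Weights\<close>

text \<open>One splitting serves every \<open>u\<close> below \<open>m\<close>, because its height
  depends on \<open>m\<close> alone. No sum over heights occurs, which keeps the constant
  independent of \<open>p\<close>. The part \<open>g\<close> contributes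
  \<open>K^2 m^(2/p-1) / u\<close> to the square of the level, up to constants, and \<open>h\<close>
  contributes \<open>K^2 m^(2/p-2)\<close>, which is no larger since \<open>u <= m\<close>. For
  \<open>m >= 1\<close> the condition \<open>1/r <= 1 - 1/p\<close> turns both into
  \<open>K^2 m^(1-2/r) / u\<close>; for \<open>m < 1\<close> this comparison of exponents reverses.

  Of \<open>h\<close> only the averages of its modulus are controlled, so Bessel's inequality says
  nothing quantitative about it. Its square sum is written as the pairing of \<open>h\<close> with
  the synthesis of its own coefficients and is partly absorbed into itself.

  Packets from different selected trees at different scales need not be orthogonal. Their
  interaction comes from tails outside the top intervals, and bounding it by total top length
  requires a uniform bound on the coefficients. Tiles with coefficients above \<tau> are therefore
  removed beforehand as one-tile trees.

  Grids may contain intervals that differ only in their end points; this causes the multiplicities 4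
  and 16.\<close>

definition wt :: "real \<Rightarrow> real \<Rightarrow> real \<Rightarrow> real" where
  "wt c l x = 1 + \<bar>x - c\<bar> / l"

lemma wt_ge_1: "0 < l \<Longrightarrow> 1 \<le> wt c l x"
  by (simp add: wt_def)

lemma wt_pos: "0 < l \<Longrightarrow> 0 < wt c l x"
  using wt_ge_1[of l c x] by linarith

lemma wt_measurable [measurable]: "wt c l \<in> borel_measurable borel"
  unfolding wt_def[abs_def] by measurable

text \<open>A Peetre-type inequality: the triangle inequality together with \<open>l' <= l\<close>.
  It turns the decay of two packets about their own centers into decay in the distance between the
  centers, measured at the coarser scale.\<close>

lemma wt_submult:
  assumes "0 < l'" "l' \<le> l"
  shows "wt c l c' \<le> wt c l x * wt c' l' x"
proof -
  have "\<bar>c' - c\<bar> / l \<le> (\<bar>x - c\<bar> + \<bar>x - c'\<bar>) / l"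
    using assms by (intro divide_right_mono) auto
  also have "\<dots> = \<bar>x - c\<bar> / l + \<bar>x - c'\<bar> / l" by (simp add: add_divide_distrib)
  also have "\<bar>x - c'\<bar> / l \<le> \<bar>x - c'\<bar> / l'" using assms by (intro divide_left_mono) auto
  finally have "wt c l c' \<le> 1 + \<bar>x - c\<bar> / l + \<bar>x - c'\<bar> / l'" by (simp add: wt_def)
  also have "\<dots> \<le> wt c l x * wt c' l' x"
    using assms by (simp add: wt_def algebra_simps)
  finally show ?thesis .
qed

lemma wt_close:
  assumes "0 < l" "\<bar>c' - x\<bar> \<le> l / 2"
  shows "wt c l x \<le> 3/2 * wt c l c'"
proof -
  have "\<bar>x - c\<bar> \<le> \<bar>c' - c\<bar> + l/2" using assms by linarith
  then have "\<bar>x - c\<bar> / l \<le> (\<bar>c' - c\<bar> + l/2) / l" using assms by (intro divide_right_mono) auto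
  also have "\<dots> = \<bar>c' - c\<bar> / l + 1/2" using assms by (simp add: field_simps)
  finally have "\<bar>x - c\<bar> / l \<le> \<bar>c' - c\<bar> / l + 1/2" .
  moreover have "0 \<le> \<bar>c' - c\<bar> / l" using assms by simp
  moreover have "1 + u \<le> 3/2 * (1 + v)" if "u \<le> v + 1/2" "0 \<le> v" for u v :: real
    using that by (simp add: field_simps)
  ultimately show ?thesis unfolding wt_def by blast
qed

text \<open>Allows the decay about a tile to be replaced by decay about any larger interval that
  contains it. The square of 3/2 is the factor 9/4 of later estimates.\<close>

lemma wt_sub_interval:
  assumes "0 < l" "l \<le> L" "\<bar>c - c0\<bar> \<le> L / 2"
  shows "wt c0 L x \<le> 3/2 * wt c l x"
proof -
  have "\<bar>x - c0\<bar> \<le> \<bar>x - c\<bar> + L/2" using assms by linarith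
  then have "\<bar>x - c0\<bar> / L \<le> (\<bar>x - c\<bar> + L/2) / L" using assms by (intro divide_right_mono) auto
  also have "\<dots> = \<bar>x - c\<bar> / L + 1/2" using assms by (simp add: field_simps)
  also have "\<bar>x - c\<bar> / L \<le> \<bar>x - c\<bar> / l" using assms by (intro divide_left_mono) auto
  finally have "\<bar>x - c0\<bar> / L \<le> \<bar>x - c\<bar> / l + 1/2" by simp
  moreover have "0 \<le> \<bar>x - c\<bar> / l" using assms by simp
  moreover have "1 + u \<le> 3/2 * (1 + v)" if "u \<le> v + 1/2" "0 \<le> v" for u v :: real
    using that by (simp add: field_simps)
  ultimately show ?thesis unfolding wt_def by blast
qed

lemma nn_integral_wt_right:
  assumes "0 < l"
  shows "(\<integral>\<^sup>+x. ennreal (1 / (1 + (x - b) / l)\<^sup>2) * indicator {b..} x \<partial>lborel) = ennreal l"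
proof -
  have "(\<integral>\<^sup>+x. ennreal (1 / (1 + (x - b) / l)\<^sup>2) * indicator {b..} x \<partial>lborel) = ennreal (0 - (- l / (1 + (b - b) / l)))"
  proof (rule nn_integral_FTC_atLeast[where F = "\<lambda>x. - l / (1 + (x - b) / l)"])
    fix x assume "b \<le> x"
    then have pos: "1 + (x - b) / l > 0" using assms by (simp add: add_pos_nonneg)
    show "((\<lambda>x. - l / (1 + (x - b) / l)) has_real_derivative 1 / (1 + (x - b) / l)\<^sup>2) (at x)"
      using pos assms by (auto intro!: derivative_eq_intros simp: power2_eq_square)
    show "0 \<le> 1 / (1 + (x - b) / l)\<^sup>2" by simp
  next
    have "((\<lambda>x::real. - l / (1 + (x - b) / l)) \<longlongrightarrow> 0) at_top"
    proof (rule tendsto_divide_0[OF tendsto_const])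
      have "filterlim (\<lambda>x. 1 + (x - b) / l) at_top at_top"
        using assms by real_asymp
      then show "filterlim (\<lambda>x. 1 + (x - b) / l) at_infinity at_top"
        by (intro filterlim_at_top_imp_at_infinity) simp
    qed
    then show "((\<lambda>x. - l / (1 + (x - b) / l)) \<longlongrightarrow> 0) at_top" .
  qed measurable
  then show ?thesis by simp
qed

lemma nn_integral_wt_left:
  assumes "0 < l"
  shows "(\<integral>\<^sup>+x. ennreal (1 / (1 + (a - x) / l)\<^sup>2) * indicator {..a} x \<partial>lborel) = ennreal l"
proof -
  have "(\<integral>\<^sup>+x. ennreal (1 / (1 + (a - x) / l)\<^sup>2) * indicator {..a} x \<partial>lborel)
     = (\<integral>\<^sup>+x. ennreal (1 / (1 + (x - (-a)) / l)\<^sup>2) * indicator {-a..} x \<partial>lborel)"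
    by (subst nn_integral_real_affine[where c = "-1" and t = 0])
       (auto intro!: nn_integral_cong simp: indicator_def add.commute)
  then show ?thesis using nn_integral_wt_right[OF assms, of "-a"] by simp
qed

text \<open>Each half-line contributes \<open>l\<close>. The choice \<open>a = b\<close> removes
  nothing and gives the integral over the whole line; with the end points of a top interval the same
  bound controls the tails of a tree.\<close>

lemma nn_integral_wt_outside:
  assumes "0 < l" "a \<le> b"
    and v: "\<And>x. x \<ge> b \<Longrightarrow> v x \<le> 1 / (1 + (x - b) / l)\<^sup>2"
    and v': "\<And>x. x \<le> a \<Longrightarrow> v x \<le> 1 / (1 + (a - x) / l)\<^sup>2"
  shows "(\<integral>\<^sup>+x. ennreal (v x) * indicator (- {a<..<b}) x \<partial>lborel) \<le> ennreal (2 * l)"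
proof -
  have "(\<integral>\<^sup>+x. ennreal (v x) * indicator (- {a<..<b}) x \<partial>lborel) \<le>
    (\<integral>\<^sup>+x. (ennreal (1 / (1 + (x - b) / l)\<^sup>2) * indicator {b..} x +
            ennreal (1 / (1 + (a - x) / l)\<^sup>2) * indicator {..a} x) \<partial>lborel)"
  proof (rule nn_integral_mono)
    fix x
    show "ennreal (v x) * indicator (- {a<..<b}) x \<le> ennreal (1 / (1 + (x - b) / l)\<^sup>2) * indicator {b..} x +
            ennreal (1 / (1 + (a - x) / l)\<^sup>2) * indicator {..a} x"
      using v[of x] v'[of x]
      by (cases "x \<ge> b"; cases "x \<le> a")
         (auto simp: indicator_def not_le intro!: ennreal_leI add_increasing2)
  qed
  also have "\<dots> = ennreal l + ennreal l"
    using nn_integral_wt_right[OF assms(1)] nn_integral_wt_left[OF assms(1)]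
    by (subst nn_integral_add) auto
  finally show ?thesis using assms by (simp add: ennreal_plus[symmetric])
qed

lemma nn_integral_wt:
  assumes "0 < l"
  shows "(\<integral>\<^sup>+x. ennreal (1 / wt c l x ^ 2) \<partial>lborel) \<le> ennreal (2 * l)"
proof -
  have "(\<integral>\<^sup>+x. ennreal (1 / wt c l x ^ 2) \<partial>lborel) = (\<integral>\<^sup>+x. ennreal (1 / wt c l x ^ 2) * indicator (- {c<..<c}) x \<partial>lborel)"
    by simp
  also have "\<dots> \<le> ennreal (2 * l)"
    using assms by (intro nn_integral_wt_outside) (auto simp: wt_def)
  finally show ?thesis .
qed

lemma integrable_wt:
  assumes "0 < l" shows "integrable lborel (\<lambda>x. 1 / wt c l x ^ 2)"
  using nn_integral_wt[OF assms, of c] by (intro integrableI_nonneg) (auto intro: le_less_trans)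

lemma integral_wt_le:
  assumes "0 < l" shows "(\<integral>x. 1 / wt c l x ^ 2 \<partial>lborel) \<le> 2 * l"
proof -
  have "ennreal (\<integral>x. 1 / wt c l x ^ 2 \<partial>lborel) = (\<integral>\<^sup>+x. ennreal (1 / wt c l x ^ 2) \<partial>lborel)"
    using integrable_wt[OF assms] by (intro nn_integral_eq_integral[symmetric]) auto
  also have "\<dots> \<le> ennreal (2 * l)" by (rule nn_integral_wt[OF assms])
  finally show ?thesis using assms by (simp add: ennreal_le_iff)
qed

text \<open>Dyadic dilates of the interval around \<open>c\<close> grow like \<open>2^k\<close>
  while the weight decays like \<open>4^-k\<close>, so the series converges. Only intervals of
  radius at least \<open>l\<close> enter, and those are the ones on which a local norm over tiles
  gives information.\<close>

lemma nn_integral_wt_le_average: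
  fixes h :: "real \<Rightarrow> ennreal"
  assumes l: "0 < l" and [measurable]: "h \<in> borel_measurable borel" and K: "0 \<le> K"
    and H: "\<And>R. l \<le> R \<Longrightarrow> (\<integral>\<^sup>+x. h x * indicator {c - R..c + R} x \<partial>lborel) \<le> ennreal (K * (2 * R))"
  shows "(\<integral>\<^sup>+x. h x * ennreal (1 / wt c l x ^ 2) \<partial>lborel) \<le> ennreal (16 * K * l)"
proof -
  define t where "t k x = ennreal (4 * (1/4)^k) * (h x * indicator {c - 2^k*l..c + 2^k*l} x)" for k :: nat and x
  have "(\<integral>\<^sup>+x. h x * ennreal (1 / wt c l x ^ 2) \<partial>lborel) \<le> (\<integral>\<^sup>+x. (\<Sum>k. t k x) \<partial>lborel)"
  proof (rule nn_integral_mono)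
    fix x
    obtain n where "\<bar>x - c\<bar> / l < 2 ^ n" using real_arch_pow[of 2 "\<bar>x - c\<bar> / l"] by auto
    then have ex: "\<exists>n. \<bar>x - c\<bar> \<le> 2 ^ n * l" using l by (auto simp: field_simps intro!: exI[of _ n])
    \<comment> \<open>By minimality the radius \<open>2^(k-1) l\<close> is too small when
      \<open>k > 0\<close>, whence \<open>2^k <= 2 wt\<close>. For \<open>k = 0\<close> this is just
      \<open>1 <= 2 wt\<close>. Squaring explains the coefficient \<open>4 * (1/4)^k\<close> in
      \<open>t\<close>.\<close>
    define k where "k = (LEAST n. \<bar>x - c\<bar> \<le> 2 ^ n * l)"
    have k: "\<bar>x - c\<bar> \<le> 2 ^ k * l" unfolding k_def using ex by (rule LeastI_ex)
    have low: "2 ^ k \<le> 2 * wt c l x"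
    proof (cases k)
      case 0 then show ?thesis using wt_ge_1[OF l, of c x] by simp
    next
      case (Suc j)
      then have "\<not> \<bar>x - c\<bar> \<le> 2 ^ j * l" using not_less_Least[of j "\<lambda>n. \<bar>x - c\<bar> \<le> 2 ^ n * l"] k_def by simp
      then have "2 ^ j < \<bar>x - c\<bar> / l" using l by (simp add: field_simps)
      then show ?thesis using Suc by (simp add: wt_def)
    qed
    have "(2^k)\<^sup>2 \<le> (2 * wt c l x)\<^sup>2" using low by (intro power_mono) auto
    then have "1 / wt c l x ^ 2 \<le> 4 * (1/4)^k"
      using wt_pos[OF l, of c x]
      by (simp add: field_simps power_mult_distrib power_one_over) (simp add: power_mult[symmetric] mult.commute[of k 2] power_mult)
    moreover have "x \<in> {c - 2^k*l..c + 2^k*l}" using k by auto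
    ultimately have "h x * ennreal (1 / wt c l x ^ 2) \<le> t k x"
      unfolding t_def by (auto simp: mult.commute intro!: mult_left_mono ennreal_leI)
    also have "\<dots> \<le> (\<Sum>k. t k x)"
      using sum_le_suminf[of "\<lambda>k. t k x" "{k}"] by auto
    finally show "h x * ennreal (1 / wt c l x ^ 2) \<le> (\<Sum>k. t k x)" .
  qed
  also have "\<dots> = (\<Sum>k. \<integral>\<^sup>+x. t k x \<partial>lborel)"
    unfolding t_def by (rule nn_integral_suminf) measurable
  also have "\<dots> \<le> (\<Sum>k. ennreal (8 * K * l * (1/2)^k))"
  proof (rule suminf_le)
    fix k
    have "(\<integral>\<^sup>+x. t k x \<partial>lborel) = ennreal (4 * (1/4)^k) * (\<integral>\<^sup>+x. h x * indicator {c - 2^k*l..c + 2^k*l} x \<partial>lborel)"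
      unfolding t_def by (rule nn_integral_cmult) measurable
    also have "\<dots> \<le> ennreal (4 * (1/4)^k) * ennreal (K * (2 * (2^k*l)))"
      using l by (intro mult_left_mono H) auto
    also have "\<dots> = ennreal (4 * (1/4)^k * (K * (2 * (2^k*l))))" using l K by (intro ennreal_mult[symmetric]) auto
    also have "4 * (1/4)^k * (K * (2 * (2^k*l))) = 8 * K * l * (1/2)^k"
    proof -
      have "(1/4::real)^k * 2^k = (1/2)^k" by (simp flip: power_mult_distrib)
      then show ?thesis by (simp add: algebra_simps)
    qed
    finally show "(\<integral>\<^sup>+x. t k x \<partial>lborel) \<le> ennreal (8 * K * l * (1/2)^k)" .
  qed auto
  also have "\<dots> = ennreal (\<Sum>k. 8 * K * l * (1/2)^k)"
    using l K by (intro suminf_ennreal2) (auto intro!: summable_mult summable_geometric)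
  also have "(\<Sum>k. 8 * K * l * (1/2::real)^k) = 16 * K * l"
    by (subst suminf_mult) (auto simp: suminf_geometric)
  finally show ?thesis .
qed

section \<open>Orthogonality of functions with disjoint Fourier supports\<close>

text \<open>The Fourier transform without its normalizing factor and with respect to
  \<open>lborel\<close>: only its zero set matters.\<close>

definition ft :: "(real \<Rightarrow> complex) \<Rightarrow> real \<Rightarrow> complex" where
  "ft \<phi> \<xi> = (\<integral>x. \<phi> x * cis (- (x * \<xi>)) \<partial>lborel)"

lemma cis_measurable [measurable (raw)]:
  "f \<in> borel_measurable M \<Longrightarrow> (\<lambda>x. cis (f x)) \<in> borel_measurable M"
  unfolding cis_conv_exp by measurable

lemma cnj_measurable [measurable (raw)]:
  "f \<in> borel_measurable M \<Longrightarrow> (\<lambda>x. cnj (f x)) \<in> borel_measurable M"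
  by (rule borel_measurable_continuous_on[OF continuous_on_cnj[OF continuous_on_id]])

lemma norm_integral_le_dominated:
  fixes f :: "'a \<Rightarrow> complex"
  assumes "f \<in> borel_measurable M" "integrable M g" "\<And>x. cmod (f x) \<le> g x"
  shows "cmod (integral\<^sup>L M f) \<le> integral\<^sup>L M g"
proof -
  have "integrable M f"
    using assms by (intro Bochner_Integration.integrable_bound[OF assms(2)]) (auto intro!: AE_I2 order_trans[OF assms(3) abs_ge_self])
  then have "(\<integral>x. cmod (f x) \<partial>M) \<le> integral\<^sup>L M g"
    using assms by (intro integral_mono integrable_norm) auto
  then show ?thesis using integral_norm_bound[of M f] by linarith
qed

lemma integrable_lborel_pair_bound:
  fixes f :: "real \<Rightarrow> real \<Rightarrow> complex" and p q :: "real \<Rightarrow> real"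
  assumes "integrable lborel p" "integrable lborel q"
    and "case_prod f \<in> borel_measurable (lborel \<Otimes>\<^sub>M lborel)"
    and bd: "\<And>x y. norm (f x y) \<le> p x * q y"
  shows "integrable (lborel \<Otimes>\<^sub>M lborel) (case_prod f)"
proof (rule Bochner_Integration.integrable_bound)
  have [measurable]: "p \<in> borel_measurable borel" "q \<in> borel_measurable borel"
    using assms(1,2) by auto
  show "integrable (lborel \<Otimes>\<^sub>M lborel) (\<lambda>(x, y). p x * q y)"
  proof (rule lborel_pair.Fubini_integrable)
    show "(\<lambda>(x, y). p x * q y) \<in> borel_measurable (lborel \<Otimes>\<^sub>M lborel)"
      by measurable
    have "(\<lambda>x. \<integral>y. norm (case (x, y) of (x, y) \<Rightarrow> p x * q y) \<partial>lborel) = (\<lambda>x. \<bar>p x\<bar> * (\<integral>y. \<bar>q y\<bar> \<partial>lborel))"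
      by (simp add: abs_mult)
    then show "integrable lborel (\<lambda>x. \<integral>y. norm (case (x, y) of (x, y) \<Rightarrow> p x * q y) \<partial>lborel)"
      using assms by simp
    show "AE x in lborel. integrable lborel (\<lambda>y. case (x, y) of (x, y) \<Rightarrow> p x * q y)"
      using assms by simp
  qed
  show "case_prod f \<in> borel_measurable (lborel \<Otimes>\<^sub>M lborel)" by fact
  show "AE x in lborel \<Otimes>\<^sub>M lborel. norm (case_prod f x) \<le> norm (case x of (x, y) \<Rightarrow> p x * q y)"
    using bd by (intro AE_I2) (auto simp del: norm_mult simp: split_beta intro: order_trans[OF bd abs_ge_self])
qed

text \<open>The characteristic function of the normal law, read as Fourier inversion for a Gaussian.
  This single instance of inversion replaces Plancherel's theorem in the orthogonality
  argument.\<close>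

lemma std_normal_fourier:
  "complex_of_real (exp (- s\<^sup>2 / 2)) = (\<integral>\<xi>. cis (s * \<xi>) * complex_of_real (std_normal_density \<xi>) \<partial>lborel)"
proof -
  have "complex_of_real (exp (- s\<^sup>2 / 2)) = char std_normal_distribution s"
    by (simp add: char_std_normal_distribution)
  also have "\<dots> = (\<integral>\<xi>. std_normal_density \<xi> *\<^sub>R iexp (s * \<xi>) \<partial>lborel)"
    unfolding char_def by (subst integral_density) auto
  finally show ?thesis by (simp add: cis_conv_exp scaleR_conv_of_real mult.commute)
qed

lemma integrable_cis_mult:
  fixes \<phi> :: "real \<Rightarrow> complex"
  assumes "integrable lborel \<phi>" "g \<in> borel_measurable borel"
  shows "integrable lborel (\<lambda>x. \<phi> x * cis (g x))"
proof (rule Bochner_Integration.integrable_bound[OF assms(1)])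
  have [measurable]: "\<phi> \<in> borel_measurable borel" using assms by auto
  note assms(2)[measurable]
  show "(\<lambda>x. \<phi> x * cis (g x)) \<in> borel_measurable lborel" by measurable
qed (simp add: norm_mult)

lemma ft_bound:
  assumes "integrable lborel \<phi>" shows "cmod (ft \<phi> \<xi>) \<le> (\<integral>x. cmod (\<phi> x) \<partial>lborel)"
proof -
  have "cmod (ft \<phi> \<xi>) \<le> (\<integral>x. cmod (\<phi> x * cis (- (x * \<xi>))) \<partial>lborel)"
    unfolding ft_def by (rule integral_norm_bound)
  then show ?thesis by (simp add: norm_mult)
qed

lemma ft_measurable:
  assumes "integrable lborel \<phi>" shows "ft \<phi> \<in> borel_measurable borel"
proof -
  have [measurable]: "\<phi> \<in> borel_measurable borel" using assms by auto
  show ?thesis unfolding ft_def[abs_def] by measurable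
qed

text \<open>Convolving \<open>cnj \<psi>\<close> with a narrow Gaussian makes it an absolutely
  convergent superposition of characters with amplitudes taken from \<open>ft \<psi>\<close>.
  Pairing it with \<phi> gives an integral of \<open>ft \<phi>\<close> times the conjugate of
  \<open>ft \<psi>\<close>, which vanishes pointwise. Continuity and boundedness of \<psi> then let
  the width of the Gaussian tend to zero.\<close>

theorem ft_disjoint_orthogonal:
  assumes \<phi>: "integrable lborel \<phi>" and \<psi>: "integrable lborel \<psi>"
    and cont: "continuous_on UNIV \<psi>" and bd: "\<And>x. cmod (\<psi> x) \<le> B"
    and disj: "\<And>\<xi>. ft \<phi> \<xi> = 0 \<or> ft \<psi> \<xi> = 0"
  shows "(\<integral>x. \<phi> x * cnj (\<psi> x) \<partial>lborel) = 0"
proof -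
  let ?g = "std_normal_density"
  have [measurable]: "\<phi> \<in> borel_measurable borel" "\<psi> \<in> borel_measurable borel" using \<phi> \<psi> by auto
  have [measurable]: "ft \<psi> \<in> borel_measurable borel" by (rule ft_measurable[OF \<psi>])
  have B0: "0 \<le> B" using bd[of 0] norm_ge_zero[of "\<psi> 0"] by linarith
  have ig: "integrable lborel ?g" by (rule integrable_normal_density) simp
  \<comment> \<open>The convolution with a Gaussian of width \<open>1 / (n + 1)\<close>, rescaled so
    that the density itself does not depend on \<open>n\<close>; dominated convergence then has an
    obvious majorant.\<close>
  define H where "H n x = (\<integral>s. cnj (\<psi> (x - s / real (Suc n))) * complex_of_real (?g s) \<partial>lborel)" for n x
  have Hb: "cmod (H n x) \<le> B" for n x
  proof -
    have "cmod (H n x) \<le> (\<integral>s. B * ?g s \<partial>lborel)"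
      unfolding H_def
      by (rule norm_integral_le_dominated) (auto simp: norm_mult intro!: mult_right_mono bd ig)
    also have "\<dots> = B" by simp
    finally show ?thesis .
  qed
  have Hm [measurable]: "H n \<in> borel_measurable borel" for n
    unfolding H_def[abs_def] by measurable
  have "(\<lambda>n. H n x) \<longlonglongrightarrow> cnj (\<psi> x)" for x
  proof -
    have "(\<lambda>n. H n x) \<longlonglongrightarrow> (\<integral>s. cnj (\<psi> x) * complex_of_real (?g s) \<partial>lborel)"
      unfolding H_def
    proof (rule integral_dominated_convergence[where w = "\<lambda>s. B * ?g s"])
      show "AE s in lborel. (\<lambda>n. cnj (\<psi> (x - s / real (Suc n))) * complex_of_real (?g s)) \<longlonglongrightarrow> cnj (\<psi> x) * complex_of_real (?g s)"
      proof (rule AE_I2)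
        fix s :: real
        have "(\<lambda>n. x - s / real (Suc n)) \<longlonglongrightarrow> x - 0"
          by (intro tendsto_diff tendsto_const LIMSEQ_Suc[OF lim_const_over_n])
        then have "(\<lambda>n. \<psi> (x - s / real (Suc n))) \<longlonglongrightarrow> \<psi> x"
          using cont by (intro isCont_tendsto_compose[of _ \<psi>]) (auto simp: continuous_on_eq_continuous_at)
        then show "(\<lambda>n. cnj (\<psi> (x - s / real (Suc n))) * complex_of_real (?g s)) \<longlonglongrightarrow> cnj (\<psi> x) * complex_of_real (?g s)"
          by (intro tendsto_intros)
      qed
    qed (auto simp: norm_mult intro!: mult_right_mono bd ig)
    also have "(\<integral>s. cnj (\<psi> x) * complex_of_real (?g s) \<partial>lborel) = cnj (\<psi> x)" by simp
    finally show ?thesis .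
  qed
  then have "(\<lambda>n. \<integral>x. \<phi> x * H n x \<partial>lborel) \<longlonglongrightarrow> (\<integral>x. \<phi> x * cnj (\<psi> x) \<partial>lborel)"
    using \<phi> B0
    by (intro integral_dominated_convergence[where w = "\<lambda>x. cmod (\<phi> x) * B"] AE_I2 tendsto_mult tendsto_const)
       (auto simp: norm_mult intro!: mult_left_mono Hb)
  moreover have "(\<integral>x. \<phi> x * H n x \<partial>lborel) = 0" for n
  proof -
    define N where "N = real (Suc n)"
    have N: "0 < N" by (simp add: N_def)
    define c where "c = complex_of_real (1 / sqrt (2 * pi))"
    have ich: "integrable lborel (\<lambda>s. \<psi> (x - s / N))" for x
      using lborel_integrable_real_affine[OF \<psi>, of "-1/N" x] N by simp
    have H: "H n x = c * (\<integral>\<xi>. complex_of_real (?g \<xi>) * (complex_of_real N * cis (N * x * \<xi>) * cnj (ft \<psi> (- (N * \<xi>)))) \<partial>lborel)" for x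
    proof -
      have "H n x = (\<integral>s. c * (\<integral>\<xi>. cnj (\<psi> (x - s / N)) * (cis (s * \<xi>) * complex_of_real (?g \<xi>)) \<partial>lborel) \<partial>lborel)"
        unfolding H_def N_def[symmetric]
      proof (intro Bochner_Integration.integral_cong refl)
        fix s
        have gs: "complex_of_real (?g s) = c * complex_of_real (exp (- s\<^sup>2 / 2))"
          by (simp add: std_normal_density_def c_def)
        show "cnj (\<psi> (x - s / N)) * complex_of_real (?g s) = c * (\<integral>\<xi>. cnj (\<psi> (x - s / N)) * (cis (s * \<xi>) * complex_of_real (?g \<xi>)) \<partial>lborel)"
          by (subst gs, subst std_normal_fourier) (simp only: integral_mult_right_zero, simp only: mult.left_commute)
      qed
      also have "\<dots> = c * (\<integral>s. (\<integral>\<xi>. cnj (\<psi> (x - s / N)) * (cis (s * \<xi>) * complex_of_real (?g \<xi>)) \<partial>lborel) \<partial>lborel)"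
        by (rule integral_mult_right_zero)
      also have "(\<integral>s. (\<integral>\<xi>. cnj (\<psi> (x - s / N)) * (cis (s * \<xi>) * complex_of_real (?g \<xi>)) \<partial>lborel) \<partial>lborel)
        = (\<integral>\<xi>. (\<integral>s. cnj (\<psi> (x - s / N)) * (cis (s * \<xi>) * complex_of_real (?g \<xi>)) \<partial>lborel) \<partial>lborel)"
        by (rule lborel_pair.Fubini_integral[symmetric],
            rule integrable_lborel_pair_bound[where p = "\<lambda>s. cmod (\<psi> (x - s / N))" and q = ?g])
           (auto simp: norm_mult ig integrable_norm[OF ich])
      also have "\<dots> = (\<integral>\<xi>. complex_of_real (?g \<xi>) * (complex_of_real N * cis (N * x * \<xi>) * cnj (ft \<psi> (- (N * \<xi>)))) \<partial>lborel)"
      proof (rule Bochner_Integration.integral_cong[OF refl])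
        fix \<xi>
        have "(\<integral>s. cnj (\<psi> (x - s / N)) * (cis (s * \<xi>) * complex_of_real (?g \<xi>)) \<partial>lborel)
          = complex_of_real (?g \<xi>) * (\<integral>s. cnj (\<psi> (x - s / N)) * cis (s * \<xi>) \<partial>lborel)"
          by (subst integral_mult_right_zero[symmetric]) (simp add: mult_ac)
        \<comment> \<open>The substitution \<open>s = N x - N z\<close> makes \<psi> independent of
          \<open>x\<close>, so that \<open>x\<close> survives only in a character.\<close>
        also have "(\<integral>s. cnj (\<psi> (x - s / N)) * cis (s * \<xi>) \<partial>lborel)
           = N *\<^sub>R (\<integral>z. cnj (\<psi> z) * cis ((N * x - N * z) * \<xi>) \<partial>lborel)"
          using N by (subst lborel_integral_real_affine[where c = "-N" and t = "N * x"]) (auto simp: field_simps)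
        also have "(\<integral>z. cnj (\<psi> z) * cis ((N * x - N * z) * \<xi>) \<partial>lborel)
          = (\<integral>z. cis (N * x * \<xi>) * cnj (\<psi> z * cis (- (z * (- (N * \<xi>))))) \<partial>lborel)"
          by (intro Bochner_Integration.integral_cong refl) (simp add: cis_cnj cis_mult algebra_simps)
        also have "\<dots> = cis (N * x * \<xi>) * cnj (ft \<psi> (- (N * \<xi>)))"
          unfolding ft_def integral_mult_right_zero
          by (rule arg_cong[OF Bochner_Integration.integral_cnj[of lborel "\<lambda>z. \<psi> z * cis (- (z * (- (N * \<xi>))))"]])
        finally show "(\<integral>s. cnj (\<psi> (x - s / N)) * (cis (s * \<xi>) * complex_of_real (?g \<xi>)) \<partial>lborel)
          = complex_of_real (?g \<xi>) * (complex_of_real N * cis (N * x * \<xi>) * cnj (ft \<psi> (- (N * \<xi>))))"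
          by (simp add: scaleR_conv_of_real mult_ac)
      qed
      finally show ?thesis .
    qed
    define q where "q = (\<integral>x. cmod (\<psi> x) \<partial>lborel)"
    have q0: "0 \<le> q" by (simp add: q_def)
    have "(\<integral>x. \<phi> x * H n x \<partial>lborel) = (\<integral>x. c * (\<integral>\<xi>. \<phi> x * (complex_of_real (?g \<xi>) * (complex_of_real N * cis (N * x * \<xi>) * cnj (ft \<psi> (- (N * \<xi>))))) \<partial>lborel) \<partial>lborel)"
      unfolding H by (simp add: mult_ac)
    also have "\<dots> = c * (\<integral>x. (\<integral>\<xi>. \<phi> x * (complex_of_real (?g \<xi>) * (complex_of_real N * cis (N * x * \<xi>) * cnj (ft \<psi> (- (N * \<xi>))))) \<partial>lborel) \<partial>lborel)"
      by (rule integral_mult_right_zero)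
    also have "(\<integral>x. (\<integral>\<xi>. \<phi> x * (complex_of_real (?g \<xi>) * (complex_of_real N * cis (N * x * \<xi>) * cnj (ft \<psi> (- (N * \<xi>))))) \<partial>lborel) \<partial>lborel)
      = (\<integral>\<xi>. (\<integral>x. \<phi> x * (complex_of_real (?g \<xi>) * (complex_of_real N * cis (N * x * \<xi>) * cnj (ft \<psi> (- (N * \<xi>))))) \<partial>lborel) \<partial>lborel)"
      using ig \<phi> N
      by (intro lborel_pair.Fubini_integral[symmetric]
            integrable_lborel_pair_bound[where p = "\<lambda>x. cmod (\<phi> x)" and q = "\<lambda>\<xi>. ?g \<xi> * (N * q)"])
         (auto simp: norm_mult q_def intro!: mult_left_mono ft_bound \<psi>)
    also have "\<dots> = 0"
    proof -
      have "(\<integral>x. \<phi> x * (complex_of_real (?g \<xi>) * (complex_of_real N * cis (N * x * \<xi>) * cnj (ft \<psi> (- (N * \<xi>))))) \<partial>lborel)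
        = (complex_of_real (?g \<xi>) * complex_of_real N * cnj (ft \<psi> (- (N * \<xi>)))) * ft \<phi> (- (N * \<xi>))" for \<xi>
        unfolding ft_def[of \<phi>] by (subst integral_mult_right_zero[symmetric]) (simp add: mult_ac)
      then have "(\<integral>x. \<phi> x * (complex_of_real (?g \<xi>) * (complex_of_real N * cis (N * x * \<xi>) * cnj (ft \<psi> (- (N * \<xi>))))) \<partial>lborel) = 0" for \<xi>
        using disj[of "- (N * \<xi>)"] by auto
      then show ?thesis by simp
    qed
    finally show ?thesis by simp
  qed
  ultimately show ?thesis by (simp add: LIMSEQ_const_iff)
qed

text \<open>Up to a factor, multiplication by \<open>x\<close> differentiates the transform. The
  difference quotient at \<xi> with step \<open>1 / (n + 1)\<close> vanishes for large
  \<open>n\<close>, because the complement of \<open>Z\<close> is open and contains both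
  frequencies.\<close>

lemma ft_mult_x_vanishes:
  assumes \<phi>: "integrable lborel \<phi>" and x\<phi>: "integrable lborel (\<lambda>x. complex_of_real x * \<phi> x)"
    and Z: "closed Z" and van: "\<And>\<xi>. \<xi> \<notin> Z \<Longrightarrow> ft \<phi> \<xi> = 0" and \<xi>: "\<xi> \<notin> Z"
  shows "ft (\<lambda>x. complex_of_real x * \<phi> x) \<xi> = 0"
proof -
  have [measurable]: "\<phi> \<in> borel_measurable borel" using \<phi> by auto
  \<comment> \<open>The difference quotient in the frequency variable with
    \<open>cis (- (x * \<xi>))\<close> factored out. It is bounded by \<open>\<bar>x\<bar>\<close>
    uniformly in \<open>n\<close>, hence the integrable majorant \<open>x * \<phi> x\<close>, and it
    tends to \<open>- \<i> * x\<close>.\<close>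
  define e where "e n x = (cis (- (x / real (Suc n))) - 1) * of_real (real (Suc n))" for n x
  have eb: "cmod (e n x) \<le> \<bar>x\<bar>" for n x
  proof -
    have "cmod (cis (- (x / real (Suc n))) - 1) \<le> \<bar>x / real (Suc n)\<bar>"
      using iexp_approx1[of "- (x / real (Suc n))" 0] by (simp add: cis_conv_exp)
    moreover have "cmod (e n x) = cmod (cis (- (x / real (Suc n))) - 1) * real (Suc n)"
      unfolding e_def norm_mult norm_of_real by simp
    moreover have "\<bar>x / real (Suc n)\<bar> * real (Suc n) = \<bar>x\<bar>" by (simp add: abs_divide)
    ultimately show ?thesis by (metis mult_right_mono of_nat_0_le_iff)
  qed
  have elim: "(\<lambda>n. e n x) \<longlonglongrightarrow> - \<i> * of_real x" for x
  proof -
    have "(\<lambda>n. e n x - (- \<i> * of_real x)) \<longlonglongrightarrow> 0"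
    proof (rule Lim_null_comparison)
      show "\<forall>\<^sub>F n in sequentially. cmod (e n x - (- \<i> * of_real x)) \<le> x\<^sup>2 / 2 / real (Suc n)"
      proof (rule always_eventually, rule allI)
        fix n
        define N where "N = real (Suc n)"
        have N: "0 < N" by (simp add: N_def)
        have "e n x - (- \<i> * of_real x) = of_real N * (cis (- (x / N)) - (1 + \<i> * of_real (- (x / N))))"
          using N unfolding e_def N_def[symmetric] by (simp add: field_simps)
        then have "cmod (e n x - (- \<i> * of_real x)) = N * cmod (cis (- (x / N)) - (1 + \<i> * of_real (- (x / N))))"
          using N by (simp add: norm_mult)
        also have "\<dots> \<le> N * ((x / N)\<^sup>2 / 2)"
          using iexp_approx1[of "- (x / N)" 1] N
          by (intro mult_left_mono) (auto simp: cis_conv_exp power2_eq_square)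
        also have "\<dots> = x\<^sup>2 / 2 / N" using N by (simp add: power2_eq_square)
        finally show "cmod (e n x - (- \<i> * of_real x)) \<le> x\<^sup>2 / 2 / real (Suc n)" by (simp add: N_def)
      qed
      show "(\<lambda>n. x\<^sup>2 / 2 / real (Suc n)) \<longlonglongrightarrow> 0"
        by (rule LIMSEQ_Suc[OF lim_const_over_n])
    qed
    then show ?thesis by (rule LIM_zero_cancel)
  qed
  have L1: "(\<lambda>n. \<integral>x. \<phi> x * cis (- (x * \<xi>)) * e n x \<partial>lborel) \<longlonglongrightarrow> (\<integral>x. \<phi> x * cis (- (x * \<xi>)) * (- \<i> * of_real x) \<partial>lborel)"
  proof (rule integral_dominated_convergence[where w = "\<lambda>x. cmod (complex_of_real x * \<phi> x)"])
    show "integrable lborel (\<lambda>x. cmod (complex_of_real x * \<phi> x))" using x\<phi> by (rule integrable_norm)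
    show "AE x in lborel. (\<lambda>n. \<phi> x * cis (- (x * \<xi>)) * e n x) \<longlonglongrightarrow> \<phi> x * cis (- (x * \<xi>)) * (- \<i> * of_real x)"
      by (intro AE_I2 tendsto_mult tendsto_const elim)
    show "AE x in lborel. cmod (\<phi> x * cis (- (x * \<xi>)) * e n x) \<le> cmod (complex_of_real x * \<phi> x)" for n
      using eb by (intro AE_I2) (auto simp: norm_mult mult.commute[of "cmod (\<phi> _)"] intro!: mult_right_mono)
  qed (auto simp: e_def)
  have L2: "\<forall>\<^sub>F n in sequentially. (\<integral>x. \<phi> x * cis (- (x * \<xi>)) * e n x \<partial>lborel) = 0"
  proof -
    have "open (- Z)" using Z by auto
    moreover have "(\<lambda>n. \<xi> + 1 / real (Suc n)) \<longlonglongrightarrow> \<xi> + 0"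
      by (intro tendsto_add tendsto_const LIMSEQ_Suc[OF lim_const_over_n])
    ultimately have "\<forall>\<^sub>F n in sequentially. \<xi> + 1 / real (Suc n) \<in> - Z"
      using \<xi> by (intro topological_tendstoD) auto
    then show ?thesis
    proof eventually_elim
      case (elim n)
      have "(\<integral>x. \<phi> x * cis (- (x * \<xi>)) * e n x \<partial>lborel) =
        (\<integral>x. of_real (real (Suc n)) * (\<phi> x * cis (- (x * (\<xi> + 1 / real (Suc n)))) - \<phi> x * cis (- (x * \<xi>))) \<partial>lborel)"
        by (intro Bochner_Integration.integral_cong refl)
           (simp add: e_def algebra_simps cis_mult[symmetric] del: of_nat_Suc, simp add: cis_mult algebra_simps)
      also have "\<dots> = of_real (real (Suc n)) * (ft \<phi> (\<xi> + 1 / real (Suc n)) - ft \<phi> \<xi>)"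
        unfolding ft_def integral_mult_right_zero
        by (subst Bochner_Integration.integral_diff) (auto intro!: integrable_cis_mult \<phi>)
      also have "\<dots> = 0" using van[OF \<xi>] van[of "\<xi> + 1 / real (Suc n)"] elim by auto
      finally show ?case .
    qed
  qed
  have "(\<integral>x. \<phi> x * cis (- (x * \<xi>)) * (- \<i> * of_real x) \<partial>lborel) = 0"
    by (rule LIMSEQ_unique[OF L1 tendsto_eventually[OF L2]])
  moreover have "(\<integral>x. \<phi> x * cis (- (x * \<xi>)) * (- \<i> * of_real x) \<partial>lborel) = - \<i> * ft (\<lambda>x. complex_of_real x * \<phi> x) \<xi>"
    unfolding ft_def by (subst integral_mult_right_zero[symmetric]) (simp add: mult_ac)
  ultimately show ?thesis by simp
qed

section \<open>Intervals\<close>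

lemma proper_interval_Inf_less_Sup: "proper_interval I \<Longrightarrow> Inf I < Sup I"
  by (simp add: proper_interval_def ivl_length_def)

lemma proper_interval_length_pos: "proper_interval I \<Longrightarrow> 0 < ivl_length I"
  by (simp add: proper_interval_def)

lemma proper_interval_bdd:
  assumes "proper_interval I"
  shows "bdd_below I" "bdd_above I" "I \<noteq> {}"
  using assms by (auto simp: proper_interval_def bounded_imp_bdd_below bounded_imp_bdd_above)

lemma proper_interval_bounds:
  assumes "proper_interval I" "x \<in> I"
  shows "Inf I \<le> x" "x \<le> Sup I"
  using proper_interval_bdd[OF assms(1)] assms(2) by (auto intro: cInf_lower cSup_upper)

lemma proper_interval_interior:
  assumes I: "proper_interval I" and x: "Inf I < x" "x < Sup I"
  shows "x \<in> I"
proof -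
  note b = proper_interval_bdd[OF I]
  obtain y where y: "y \<in> I" "y < x" using x(1) b cInf_less_iff by metis
  obtain z where z: "z \<in> I" "x < z" using x(2) b less_cSup_iff by metis
  have "is_interval I" using I by (simp add: proper_interval_def)
  then show ?thesis using y z unfolding is_interval_1 by (meson less_imp_le)
qed

lemma ivl_center_length:
  "Inf I = ivl_center I - ivl_length I / 2" "Sup I = ivl_center I + ivl_length I / 2"
  by (auto simp: ivl_center_def ivl_length_def field_simps)

lemma proper_interval_dist_center:
  assumes "proper_interval I" "x \<in> I" shows "\<bar>x - ivl_center I\<bar> \<le> ivl_length I / 2"
  using proper_interval_bounds[OF assms] ivl_center_length[of I] by linarith

lemma proper_interval_near_center:
  assumes "proper_interval I" "\<bar>x - ivl_center I\<bar> < ivl_length I / 2" shows "x \<in> I"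
proof (rule proper_interval_interior[OF assms(1)])
  show "Inf I < x" "x < Sup I" unfolding ivl_center_length using assms(2) by linarith+
qed

lemma ivl_center_mem: "proper_interval I \<Longrightarrow> ivl_center I \<in> I"
  by (rule proper_interval_near_center) (auto simp: proper_interval_length_pos)

lemma proper_interval_subset:
  assumes "proper_interval I" "proper_interval J" "I \<subseteq> J"
  shows "Inf J \<le> Inf I" "Sup I \<le> Sup J" "ivl_length I \<le> ivl_length J"
    "\<bar>ivl_center I - ivl_center J\<bar> \<le> ivl_length J / 2"
proof -
  show *: "Inf J \<le> Inf I" "Sup I \<le> Sup J"
    using assms proper_interval_bdd[OF assms(1)] proper_interval_bdd[OF assms(2)]
    by (auto intro: cInf_superset_mono cSup_subset_mono)
  then show "ivl_length I \<le> ivl_length J" by (simp add: ivl_length_def)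
  show "\<bar>ivl_center I - ivl_center J\<bar> \<le> ivl_length J / 2"
    using assms ivl_center_mem by (intro proper_interval_dist_center) auto
qed

lemma proper_interval_subset_cball:
  assumes "proper_interval I" "\<bar>ivl_center I - c\<bar> + ivl_length I / 2 \<le> R"
  shows "I \<subseteq> {c - R..c + R}"
proof
  fix x assume "x \<in> I"
  then have "\<bar>x - ivl_center I\<bar> \<le> ivl_length I / 2" by (rule proper_interval_dist_center[OF assms(1)])
  then have "c - R \<le> x" "x \<le> c + R" using assms(2) by linarith+
  then show "x \<in> {c - R..c + R}" by simp
qed

lemma proper_interval_cball: "0 < R \<Longrightarrow> proper_interval {c - R..c + R}" for c R :: real
  by (auto simp: proper_interval_def ivl_length_def is_interval_1)

lemma ivl_length_cball: "0 < R \<Longrightarrow> ivl_length {c - R..c + R} = 2 * R" for c R :: real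
  by (simp add: ivl_length_def)

text \<open>The end points determine an interval up to the choice of which of them belong to it.
  Every factor 4 in the counting of tiles comes from here.\<close>

lemma proper_interval_four_shapes:
  assumes "proper_interval I" "Inf I = a" "Sup I = b"
  shows "I \<in> {{a<..<b}, {a..<b}, {a<..b}, {a..b}}"
proof -
  have sub: "{a<..<b} \<subseteq> I" "I \<subseteq> {a..b}"
    using proper_interval_interior[OF assms(1)] proper_interval_bounds[OF assms(1)] assms(2,3) by auto
  have "a < b" using proper_interval_Inf_less_Sup[OF assms(1)] assms by simp
  have "I = {a<..<b} \<union> (I \<inter> {a,b})" using sub \<open>a < b\<close> by (force simp: less_le)
  moreover have "{a..<b} = {a<..<b} \<union> {a}" "{a<..b} = {a<..<b} \<union> {b}" "{a..b} = {a<..<b} \<union> {a,b}"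
    using \<open>a < b\<close> by auto
  moreover have "I \<inter> {a,b} \<in> {{}, {a}, {b}, {a,b}}" by auto
  ultimately show ?thesis by (metis Un_empty_right insertE insertI1 insertI2 singletonD)
qed

lemma proper_interval_borel [measurable]: "proper_interval I \<Longrightarrow> I \<in> sets borel"
  by (simp add: proper_interval_def real_interval_borel_measurable)

lemma emeasure_proper_interval:
  assumes "proper_interval I" shows "emeasure lborel I = ennreal (ivl_length I)"
proof -
  obtain a b where ab: "Inf I = a" "Sup I = b" by auto
  have "a < b" using proper_interval_Inf_less_Sup[OF assms] ab by simp
  have "emeasure lborel I = ennreal (b - a)"
    using proper_interval_four_shapes[OF assms ab] \<open>a < b\<close> by auto
  then show ?thesis using ab by (simp add: ivl_length_def)
qed

lemma nn_integral_bounded_overlap: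
  fixes I :: "'i \<Rightarrow> real set" and v :: "real \<Rightarrow> ennreal"
  assumes "finite F" and I: "\<And>i. i \<in> F \<Longrightarrow> I i \<in> sets borel" "\<And>i. i \<in> F \<Longrightarrow> I i \<subseteq> E"
    and [measurable]: "v \<in> borel_measurable borel" "E \<in> sets borel"
    and card: "\<And>x. card {i \<in> F. x \<in> I i} \<le> m"
  shows "(\<Sum>i\<in>F. \<integral>\<^sup>+x. v x * indicator (I i) x \<partial>lborel) \<le> of_nat m * (\<integral>\<^sup>+x. v x * indicator E x \<partial>lborel)"
proof -
  have "(\<Sum>i\<in>F. \<integral>\<^sup>+x. v x * indicator (I i) x \<partial>lborel) = (\<integral>\<^sup>+x. (\<Sum>i\<in>F. v x * indicator (I i) x) \<partial>lborel)"
    using I by (intro nn_integral_sum[symmetric] borel_measurable_times_ennreal borel_measurable_indicator) auto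
  also have "\<dots> \<le> (\<integral>\<^sup>+x. of_nat m * (v x * indicator E x) \<partial>lborel)"
  proof (rule nn_integral_mono)
    fix x
    have "(\<Sum>i\<in>F. v x * indicator (I i) x) = v x * of_nat (card {i \<in> F. x \<in> I i})"
      using \<open>finite F\<close> by (simp add: sum_distrib_left[symmetric] indicator_def sum.If_cases Int_def)
    also have "\<dots> \<le> of_nat m * (v x * indicator E x)"
    proof (cases "x \<in> E")
      case True
      then show ?thesis using card[of x] by (simp add: mult.commute[of "v x"] mult_right_mono)
    next
      case False
      then have "{i \<in> F. x \<in> I i} = {}" using I by auto
      then show ?thesis by (simp only: card.empty) simp
    qed
    finally show "(\<Sum>i\<in>F. v x * indicator (I i) x) \<le> of_nat m * (v x * indicator E x)" .
  qed
  also have "\<dots> = of_nat m * (\<integral>\<^sup>+x. v x * indicator E x \<partial>lborel)"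
    by (rule nn_integral_cmult) measurable
  finally show ?thesis .
qed

lemma sum_length_le_overlap:
  fixes I :: "'i \<Rightarrow> real set"
  assumes "finite F" and I: "\<And>i. i \<in> F \<Longrightarrow> proper_interval (I i)" "\<And>i. i \<in> F \<Longrightarrow> I i \<subseteq> E"
    and E: "proper_interval E" and card: "\<And>x. card {i \<in> F. x \<in> I i} \<le> m"
  shows "(\<Sum>i\<in>F. ivl_length (I i)) \<le> real m * ivl_length E"
proof -
  have "ennreal (\<Sum>i\<in>F. ivl_length (I i)) = (\<Sum>i\<in>F. ennreal (ivl_length (I i)))"
    using I by (intro sum_ennreal[symmetric]) (auto simp: proper_interval_length_pos less_imp_le)
  also have "\<dots> = (\<Sum>i\<in>F. \<integral>\<^sup>+x. 1 * indicator (I i) x \<partial>lborel)"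
    using I by (intro sum.cong refl) (simp add: emeasure_proper_interval[symmetric] proper_interval_borel)
  also have "\<dots> \<le> of_nat m * (\<integral>\<^sup>+x. 1 * indicator E x \<partial>lborel)"
    using assms by (intro nn_integral_bounded_overlap) (auto simp: proper_interval_borel)
  also have "\<dots> = ennreal (real m * ivl_length E)"
    using E by (simp add: emeasure_proper_interval proper_interval_borel ennreal_mult proper_interval_length_pos less_imp_le ennreal_of_nat_eq_real_of_nat)
  finally show ?thesis using E by (simp add: ennreal_le_iff proper_interval_length_pos less_imp_le)
qed

text \<open>Over an interval not longer than \<open>l\<close> the weight changes by at most 3/2 from
  its value at the center, so each term is dominated by an integral over its own interval. Bounded
  overlap then allows the integrals to be added up.\<close>

lemma sum_wt_le_nn_integral:
  fixes I :: "'i \<Rightarrow> real set"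
  assumes "finite F" and I: "\<And>i. i \<in> F \<Longrightarrow> proper_interval (I i)"
    and len: "\<And>i. i \<in> F \<Longrightarrow> ivl_length (I i) \<le> l" and l: "0 < l"
    and E: "\<And>i. i \<in> F \<Longrightarrow> I i \<subseteq> E" "E \<in> sets borel"
    and card: "\<And>x. card {i \<in> F. x \<in> I i} \<le> m"
  shows "ennreal (\<Sum>i\<in>F. ivl_length (I i) / wt c l (ivl_center (I i)) ^ n) \<le>
    ennreal ((3/2)^n * real m) * (\<integral>\<^sup>+x. ennreal (1 / wt c l x ^ n) * indicator E x \<partial>lborel)"
proof -
  have "ennreal (\<Sum>i\<in>F. ivl_length (I i) / wt c l (ivl_center (I i)) ^ n)
    = (\<Sum>i\<in>F. ennreal (ivl_length (I i) / wt c l (ivl_center (I i)) ^ n))"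
    using I l by (intro sum_ennreal[symmetric]) (auto simp: proper_interval_length_pos less_imp_le wt_pos)
  also have "\<dots> \<le> (\<Sum>i\<in>F. \<integral>\<^sup>+x. ennreal ((3/2)^n / wt c l x ^ n) * indicator (I i) x \<partial>lborel)"
  proof (rule sum_mono)
    fix i assume i: "i \<in> F"
    have "ennreal (ivl_length (I i) / wt c l (ivl_center (I i)) ^ n)
      = (\<integral>\<^sup>+x. ennreal (1 / wt c l (ivl_center (I i)) ^ n) * indicator (I i) x \<partial>lborel)"
      using I[OF i] wt_pos[OF l]
      by (subst nn_integral_cmult_indicator)
         (auto simp: emeasure_proper_interval proper_interval_borel less_imp_le ennreal_mult[symmetric] proper_interval_length_pos)
    also have "\<dots> \<le> (\<integral>\<^sup>+x. ennreal ((3/2)^n / wt c l x ^ n) * indicator (I i) x \<partial>lborel)"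
    proof (rule nn_integral_mono)
      fix x
      show "ennreal (1 / wt c l (ivl_center (I i)) ^ n) * indicator (I i) x \<le> ennreal ((3/2)^n / wt c l x ^ n) * indicator (I i) x"
      proof (cases "x \<in> I i")
        case True
        then have "wt c l x \<le> 3/2 * wt c l (ivl_center (I i))"
          using proper_interval_dist_center[OF I[OF i] True] len[OF i] l
          by (intro wt_close) (auto simp: abs_minus_commute)
        then have "wt c l x ^ n \<le> (3/2)^n * wt c l (ivl_center (I i)) ^ n"
          unfolding power_mult_distrib[symmetric] using wt_pos[OF l, of c x] by (intro power_mono) auto
        then show ?thesis using True wt_pos[OF l, of c]
          by (auto intro!: ennreal_leI simp: field_simps)
      qed auto
    qed
    finally show "ennreal (ivl_length (I i) / wt c l (ivl_center (I i)) ^ n) \<le> (\<integral>\<^sup>+x. ennreal ((3/2)^n / wt c l x ^ n) * indicator (I i) x \<partial>lborel)" .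
  qed
  also have "\<dots> \<le> of_nat m * (\<integral>\<^sup>+x. ennreal ((3/2)^n / wt c l x ^ n) * indicator E x \<partial>lborel)"
    using assms by (intro nn_integral_bounded_overlap) (auto simp: proper_interval_borel)
  also have "(\<integral>\<^sup>+x. ennreal ((3/2)^n / wt c l x ^ n) * indicator E x \<partial>lborel)
     = (\<integral>\<^sup>+x. ennreal ((3/2)^n) * (ennreal (1 / wt c l x ^ n) * indicator E x) \<partial>lborel)"
    using wt_pos[OF l, of c]
    by (intro nn_integral_cong) (simp add: ennreal_mult[symmetric] mult.assoc[symmetric] less_imp_le)
  also have "\<dots> = ennreal ((3/2)^n) * (\<integral>\<^sup>+x. ennreal (1 / wt c l x ^ n) * indicator E x \<partial>lborel)"
    using E(2) by (intro nn_integral_cmult borel_measurable_times_ennreal borel_measurable_indicator) auto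
  finally show ?thesis
    by (simp add: ennreal_mult mult_ac ennreal_of_nat_eq_real_of_nat)
qed

text \<open>The weight is symmetric in center and point, so the sum over centers compares with an
  integral of total mass \<open>2 l\<close>. The constant is
  \<open>9/2 = (3/2)^2 * 2\<close>.\<close>

lemma sum_wt_same_length:
  fixes I :: "'i \<Rightarrow> real set"
  assumes "finite F" and I: "\<And>i. i \<in> F \<Longrightarrow> proper_interval (I i)"
    and len: "\<And>i. i \<in> F \<Longrightarrow> ivl_length (I i) = l" and l: "0 < l"
    and card: "\<And>x. card {i \<in> F. x \<in> I i} \<le> m"
  shows "(\<Sum>i\<in>F. 1 / wt (ivl_center (I i)) l x ^ 2) \<le> 9/2 * real m"
proof -
  have sym: "wt (ivl_center (I i)) l x = wt x l (ivl_center (I i))" for i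
    by (simp add: wt_def abs_minus_commute)
  have "ennreal (l * (\<Sum>i\<in>F. 1 / wt (ivl_center (I i)) l x ^ 2)) = ennreal (\<Sum>i\<in>F. ivl_length (I i) / wt x l (ivl_center (I i)) ^ 2)"
    by (simp add: sum_distrib_left sym len)
  also have "\<dots> \<le> ennreal ((3/2)^2 * real m) * (\<integral>\<^sup>+y. ennreal (1 / wt x l y ^ 2) * indicator UNIV y \<partial>lborel)"
    using assms by (intro sum_wt_le_nn_integral) auto
  also have "\<dots> \<le> ennreal ((3/2)^2 * real m) * ennreal (2 * l)"
    using nn_integral_wt[OF l, of x] by (intro mult_left_mono) auto
  also have "\<dots> = ennreal ((3/2)^2 * real m * (2 * l))" using l by (intro ennreal_mult[symmetric]) auto
  finally have "l * (\<Sum>i\<in>F. 1 / wt (ivl_center (I i)) l x ^ 2) \<le> (3/2)^2 * real m * (2 * l)"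
    using l by (subst (asm) ennreal_le_iff) auto
  then show ?thesis using l by (simp add: field_simps power2_eq_square)
qed

section \<open>Dyadic grids\<close>

lemma grid_proper: "dyadic_grid \<rho> D \<Longrightarrow> I \<in> D \<Longrightarrow> proper_interval I"
  by (auto simp: dyadic_grid_def)

lemma grid_length: "dyadic_grid \<rho> D \<Longrightarrow> I \<in> D \<Longrightarrow> \<exists>k::int. ivl_length I = \<rho> * 2 powi k"
  by (auto simp: dyadic_grid_def)

lemma grid_nested: "dyadic_grid \<rho> D \<Longrightarrow> I \<in> D \<Longrightarrow> I' \<in> D \<Longrightarrow> x \<in> I \<Longrightarrow> x \<in> I' \<Longrightarrow> I \<subseteq> I' \<or> I' \<subseteq> I"
  unfolding dyadic_grid_def by blast

lemma grid_subset:
  assumes g: "dyadic_grid \<rho> D" and I: "I \<in> D" "I' \<in> D" "x \<in> I" "x \<in> I'" and len: "ivl_length I < ivl_length I'"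
  shows "I \<subseteq> I'"
proof (rule ccontr)
  assume "\<not> I \<subseteq> I'"
  then have "I' \<subseteq> I" using grid_nested[OF g I] by blast
  then show False using proper_interval_subset(3)[OF grid_proper[OF g I(2)] grid_proper[OF g I(1)]] len by simp
qed

lemma grid_same_length:
  assumes g: "dyadic_grid \<rho> D" and I: "I \<in> D" "I' \<in> D" "x \<in> I" "x \<in> I'" and len: "ivl_length I = ivl_length I'"
  shows "Inf I = Inf I'" "Sup I = Sup I'"
proof -
  have "Inf I = Inf I' \<and> Sup I = Sup I'" if "I \<subseteq> I'" "I \<in> D" "I' \<in> D" "ivl_length I = ivl_length I'" for I I'
    using proper_interval_subset(1,2)[OF grid_proper[OF g that(2)] grid_proper[OF g that(3)] that(1)] that(4)
    unfolding ivl_length_def by linarith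
  then show "Inf I = Inf I'" "Sup I = Sup I'" using grid_nested[OF g I] I len by metis+
qed

lemma grid_length_ratio:
  assumes g: "dyadic_grid \<rho> D" and I: "I \<in> D" "I' \<in> D" and len: "ivl_length I < ivl_length I'"
  shows "2 * ivl_length I \<le> ivl_length I'"
proof -
  obtain k k' :: int where k: "ivl_length I = \<rho> * 2 powi k" "ivl_length I' = \<rho> * 2 powi k'"
    using grid_length[OF g] I by meson
  have \<rho>: "0 < \<rho>" using g by (auto simp: dyadic_grid_def)
  have "k < k'"
  proof (rule ccontr)
    assume "\<not> k < k'"
    then have "(2::real) powi k' \<le> 2 powi k" by (intro power_int_increasing) auto
    then show False using len k \<rho> by (simp add: not_le[symmetric])
  qed
  then have "(2::real) powi (k + 1) \<le> 2 powi k'" by (intro power_int_increasing) auto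
  then show ?thesis using k \<rho> by (simp add: power_int_add)
qed

text \<open>Intervals of a grid of equal length with a common point may still differ in their endpoints.\<close>

lemma grid_card_through_point:
  assumes g: "dyadic_grid \<rho> D"
  shows "finite {I \<in> D. x \<in> I \<and> ivl_length I = l}" "card {I \<in> D. x \<in> I \<and> ivl_length I = l} \<le> 4"
proof -
  let ?S = "{I \<in> D. x \<in> I \<and> ivl_length I = l}"
  have "finite ?S \<and> card ?S \<le> 4"
  proof (cases "?S = {}")
    case False
    then obtain I0 where I0: "I0 \<in> ?S" by auto
    define a b where "a = Inf I0" and "b = Sup I0"
    have "?S \<subseteq> {{a<..<b}, {a..<b}, {a<..b}, {a..b}}"
    proof
      fix I assume I: "I \<in> ?S"
      then have "Inf I = a" "Sup I = b"
        using grid_same_length[OF g, of I I0 x] I0 by (auto simp: a_def b_def)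
      then show "I \<in> {{a<..<b}, {a..<b}, {a<..b}, {a..b}}"
        using I grid_proper[OF g] by (intro proper_interval_four_shapes) auto
    qed
    moreover have "card {{a<..<b}, {a..<b}, {a<..b}, {a..b}} \<le> 4"
      by (intro card_insert_le_m1) auto
    ultimately show ?thesis
      by (meson card_mono finite.emptyI finite_insert finite_subset le_trans)
  qed (simp only:, simp)
  then show "finite ?S" "card ?S \<le> 4" by auto
qed

text \<open>The candidates of the right length miss only a null set and \<omega> has positive
  length, so one of them meets \<omega>. Being strictly longer, it contains \<omega> by
  nestedness.\<close>

lemma grid_ancestor:
  assumes g: "dyadic_grid \<rho> D" and \<omega>: "\<omega> \<in> D"
  shows "dyadic_ancestor D \<kappa> \<omega> \<in> D" "\<omega> \<subseteq> dyadic_ancestor D \<kappa> \<omega>"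
    "ivl_length (dyadic_ancestor D \<kappa> \<omega>) = 2 ^ \<kappa> * ivl_length \<omega>"
proof -
  have p: "proper_interval \<omega>" by (rule grid_proper[OF g \<omega>])
  obtain k :: int where k: "ivl_length \<omega> = \<rho> * 2 powi k" using grid_length[OF g \<omega>] by blast
  \<comment> \<open>For \<open>\<kappa> = 0\<close> the interval itself is the witness: another
    interval of equal length that meets it might lack one of its end points.\<close>
  have "\<exists>\<omega>'. \<omega>' \<in> D \<and> \<omega> \<subseteq> \<omega>' \<and> ivl_length \<omega>' = 2 ^ \<kappa> * ivl_length \<omega>"
  proof (cases "\<kappa> = 0")
    case False
    have "negligible (UNIV - \<Union>{I\<in>D. ivl_length I = \<rho> * 2 powi (k + int \<kappa>)})"
      using g by (simp add: dyadic_grid_def)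
    moreover have "\<not> negligible \<omega>"
    proof -
      have "\<not> negligible {Inf \<omega><..<Sup \<omega>}"
        using proper_interval_Inf_less_Sup[OF p] open_not_negligible[of "{Inf \<omega><..<Sup \<omega>}"] by auto
      moreover have "{Inf \<omega><..<Sup \<omega>} \<subseteq> \<omega>" using proper_interval_interior[OF p] by auto
      ultimately show ?thesis using negligible_subset by blast
    qed
    ultimately obtain x \<omega>' where x: "x \<in> \<omega>" "x \<in> \<omega>'" "\<omega>' \<in> D" "ivl_length \<omega>' = \<rho> * 2 powi (k + int \<kappa>)"
      using negligible_subset[of "UNIV - \<Union>{I\<in>D. ivl_length I = \<rho> * 2 powi (k + int \<kappa>)}" \<omega>] by blast
    have len: "ivl_length \<omega>' = 2 ^ \<kappa> * ivl_length \<omega>"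
      using x(4) k by (simp add: power_int_add)
    have "(1::real) < 2 ^ \<kappa>" using False by simp
    then have "ivl_length \<omega> < ivl_length \<omega>'" using len proper_interval_length_pos[OF p] by simp
    then show ?thesis using grid_subset[OF g \<omega> x(3) x(1,2)] x(3) len by blast
  qed (use \<omega> in auto)
  then have "dyadic_ancestor D \<kappa> \<omega> \<in> D \<and> \<omega> \<subseteq> dyadic_ancestor D \<kappa> \<omega> \<and>
    ivl_length (dyadic_ancestor D \<kappa> \<omega>) = 2 ^ \<kappa> * ivl_length \<omega>"
    unfolding dyadic_ancestor_def by (rule someI_ex)
  then show "dyadic_ancestor D \<kappa> \<omega> \<in> D" "\<omega> \<subseteq> dyadic_ancestor D \<kappa> \<omega>"
    "ivl_length (dyadic_ancestor D \<kappa> \<omega>) = 2 ^ \<kappa> * ivl_length \<omega>" by auto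
qed

section \<open>Wave packets\<close>

abbreviation ltile :: "tile \<Rightarrow> real" where "ltile P \<equiv> ivl_length (fst P)"

abbreviation ctile :: "tile \<Rightarrow> real" where "ctile P \<equiv> ivl_center (fst P)"

abbreviation wtile :: "tile \<Rightarrow> real \<Rightarrow> real" where "wtile P \<equiv> wt (ctile P) (ltile P)"

abbreviation ltop :: "tree \<Rightarrow> real" where "ltop T \<equiv> ivl_length (top_ivl T)"

abbreviation ip :: "(real \<Rightarrow> complex) \<Rightarrow> (real \<Rightarrow> complex) \<Rightarrow> complex" where
  "ip f g \<equiv> \<integral>x. f x * cnj (g x) \<partial>lborel"

abbreviation sqnorm :: "(real \<Rightarrow> complex) \<Rightarrow> real" where
  "sqnorm f \<equiv> \<integral>x. (cmod (f x))\<^sup>2 \<partial>lborel"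

text \<open>Packets modulo everything but size and Fourier support. Unlike \<open>Phi\<close>, this
  class survives multiplication by a quadratic weight at the price of a larger \<open>B\<close> and
  a smaller \<open>n\<close>. The closed set \<open>Z\<close> is recorded because differentiating
  the transform needs a margin around the frequencies where it vanishes.\<close>

definition packet :: "real \<Rightarrow> nat \<Rightarrow> tile \<Rightarrow> (real \<Rightarrow> complex) \<Rightarrow> bool" where
  "packet B n P \<phi> \<longleftrightarrow> continuous_on UNIV \<phi> \<and>
     (\<forall>x. cmod (\<phi> x) \<le> B / (ltile P * wtile P x ^ n)) \<and>
     (\<exists>Z. closed Z \<and> Z \<subseteq> snd P \<and> (\<forall>\<xi>. \<xi> \<notin> Z \<longrightarrow> ft \<phi> \<xi> = 0))"

lemma packet_continuous: "packet B n P \<phi> \<Longrightarrow> continuous_on UNIV \<phi>"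
  by (simp add: packet_def)

lemma packet_measurable: "packet B n P \<phi> \<Longrightarrow> \<phi> \<in> borel_measurable borel"
  by (simp add: packet_continuous borel_measurable_continuous_onI)

lemma packet_bound:
  "packet B n P \<phi> \<Longrightarrow> cmod (\<phi> x) \<le> B / (ltile P * wtile P x ^ n)"
  by (simp add: packet_def)

lemma packet_nonneg:
  assumes "packet B n P \<phi>" "proper_interval (fst P)" shows "0 \<le> B"
proof -
  have "0 \<le> B / (ltile P * wtile P 0 ^ n)"
    using packet_bound[OF assms(1), of 0] norm_ge_zero order_trans by blast
  moreover have "0 < ltile P * wtile P 0 ^ n"
    using proper_interval_length_pos[OF assms(2)] by (simp add: wt_pos)
  ultimately show ?thesis by (simp add: zero_le_divide_iff)
qed

lemma packet_le_const:
  assumes "packet B n P \<phi>" "proper_interval (fst P)"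
  shows "cmod (\<phi> x) \<le> B / ltile P"
proof -
  have l: "0 < ltile P" by (rule proper_interval_length_pos[OF assms(2)])
  have "B / (ltile P * wtile P x ^ n) \<le> B / (ltile P * 1)"
    using l wt_ge_1[OF l] packet_nonneg[OF assms]
    by (intro divide_left_mono mult_left_mono one_le_power mult_pos_pos zero_less_power wt_pos) auto
  then show ?thesis using packet_bound[OF assms(1), of x] by simp
qed

lemma packet_le_wt2:
  assumes "packet B n P \<phi>" "proper_interval (fst P)" "2 \<le> n"
  shows "cmod (\<phi> x) \<le> B / ltile P * (1 / wtile P x ^ 2)"
proof -
  have l: "0 < ltile P" by (rule proper_interval_length_pos[OF assms(2)])
  have "B / (ltile P * wtile P x ^ n) \<le>
     B / (ltile P * wtile P x ^ 2)"
    using l wt_ge_1[OF l] packet_nonneg[OF assms(1,2)] assms(3)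
    by (intro divide_left_mono mult_left_mono power_increasing mult_pos_pos zero_less_power wt_pos) auto
  then show ?thesis using packet_bound[OF assms(1), of x] by simp
qed

lemma packet_integrable:
  assumes "packet B n P \<phi>" "proper_interval (fst P)" "2 \<le> n"
  shows "integrable lborel \<phi>"
proof (rule Bochner_Integration.integrable_bound)
  have l: "0 < ltile P" by (rule proper_interval_length_pos[OF assms(2)])
  show "integrable lborel (\<lambda>x. B / ltile P * (1 / wtile P x ^ 2))"
    by (intro integrable_mult_right integrable_wt l)
  show "\<phi> \<in> borel_measurable lborel" using packet_measurable[OF assms(1)] by simp
  show "AE x in lborel. cmod (\<phi> x) \<le> norm (B / ltile P * (1 / wtile P x ^ 2))"
    unfolding real_norm_def by (intro AE_I2 order_trans[OF packet_le_wt2[OF assms] abs_ge_self])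
qed

lemma integrable_mult_bounded:
  fixes f g :: "real \<Rightarrow> complex"
  assumes "integrable lborel f" "g \<in> borel_measurable borel" "\<And>x. cmod (g x) \<le> B"
  shows "integrable lborel (\<lambda>x. f x * g x)"
proof (rule Bochner_Integration.integrable_bound)
  show "integrable lborel (\<lambda>x. cmod (f x) * B)" using assms by (intro integrable_mult_left integrable_norm)
  have [measurable]: "f \<in> borel_measurable borel" using assms(1) by auto
  note assms(2)[measurable]
  show "(\<lambda>x. f x * g x) \<in> borel_measurable lborel" by measurable
  show "AE x in lborel. cmod (f x * g x) \<le> norm (cmod (f x) * B)"
    using assms(3) by (intro AE_I2) (auto simp: norm_mult abs_mult intro!: mult_left_mono order_trans[OF assms(3) abs_ge_self])
qed

lemma packet_mult_integrable:
  assumes "packet B n P \<phi>" "proper_interval (fst P)" "2 \<le> n"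
    and "packet B' n' P' \<phi>'" "proper_interval (fst P')"
  shows "integrable lborel (\<lambda>x. \<phi> x * cnj (\<phi>' x))"
  using packet_integrable[OF assms(1-3)] packet_measurable[OF assms(4)] packet_le_const[OF assms(4,5)]
  by (intro integrable_mult_bounded) auto

lemma packet_orthogonal:
  assumes "packet B n P \<phi>" "proper_interval (fst P)" "2 \<le> n"
    and "packet B' n' P' \<phi>'" "proper_interval (fst P')" "2 \<le> n'"
    and "snd P \<inter> snd P' = {}"
  shows "(ip \<phi> \<phi>') = 0"
proof (rule ft_disjoint_orthogonal)
  show "integrable lborel \<phi>" "integrable lborel \<phi>'" using assms packet_integrable by blast+
  show "continuous_on UNIV \<phi>'" using assms packet_continuous by blast
  show "cmod (\<phi>' x) \<le> B' / ltile P'" for x using packet_le_const assms by blast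
  show "ft \<phi> \<xi> = 0 \<or> ft \<phi>' \<xi> = 0" for \<xi>
    using assms unfolding packet_def by blast
qed

text \<open>By \<open>wt_submult\<close>, \<open>m\<close> orders of decay of both packets turn into
  decay in the distance of the centers. The two remaining orders of the shorter packet make it
  integrable with mass \<open>2 l'\<close>, which cancels its normalization.\<close>

lemma packet_inner_bound:
  assumes p: "packet B (m + 2) P \<phi>" "proper_interval (fst P)"
    and p': "packet B (m + 2) P' \<phi>'" "proper_interval (fst P')"
    and le: "ltile P' \<le> ltile P"
  shows "cmod (ip \<phi> \<phi>') \<le>
    2 * B\<^sup>2 / (ltile P * wtile P (ctile P') ^ m)"
proof -
  define l l' c c' where "l = ltile P" "l' = ltile P'" "c = ctile P" "c' = ctile P'"
  note d = this
  have l: "0 < l" "0 < l'" "l' \<le> l" using p p' le proper_interval_length_pos by (auto simp: d)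
  have B: "0 \<le> B" using packet_nonneg p by blast
  have "cmod (ip \<phi> \<phi>') \<le> (\<integral>x. B\<^sup>2 / (l * wt c l c' ^ m) / l' * (1 / wt c' l' x ^ 2) \<partial>lborel)"
  proof (rule norm_integral_le_dominated)
    have [measurable]: "\<phi> \<in> borel_measurable borel" "\<phi>' \<in> borel_measurable borel"
      using packet_measurable p p' by blast+
    show "(\<lambda>x. \<phi> x * cnj (\<phi>' x)) \<in> borel_measurable lborel" by measurable
    show "integrable lborel (\<lambda>x. B\<^sup>2 / (l * wt c l c' ^ m) / l' * (1 / wt c' l' x ^ 2))"
      using l by (intro integrable_mult_right integrable_wt)
    fix x
    have w: "0 < wt c l x" "0 < wt c' l' x" "1 \<le> wt c l x" "1 \<le> wt c' l' x" "0 < wt c l c'"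
      using l by (auto simp: wt_pos wt_ge_1)
    have "wt c l c' ^ m \<le> (wt c l x * wt c' l' x) ^ m"
      using wt_submult[of l' l c c' x] l w by (intro power_mono) auto
    then have "wt c l c' ^ m * (1 * wt c' l' x ^ 2) \<le> (wt c l x * wt c' l' x) ^ m * (wt c l x ^ 2 * wt c' l' x ^ 2)"
      using w by (intro mult_mono) (auto intro!: mult_right_mono)
    then have main: "wt c l c' ^ m * wt c' l' x ^ 2 \<le> wt c l x ^ (m+2) * wt c' l' x ^ (m+2)"
      by (simp add: power_mult_distrib power_add power2_eq_square mult_ac)
    have "cmod (\<phi> x * cnj (\<phi>' x)) \<le> B / (l * wt c l x ^ (m+2)) * (B / (l' * wt c' l' x ^ (m+2)))"
      unfolding norm_mult complex_mod_cnj d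
      using packet_bound[OF p(1)] packet_bound[OF p'(1)] B l w by (intro mult_mono) (auto simp: d)
    also have "\<dots> = B\<^sup>2 / (l * l' * (wt c l x ^ (m+2) * wt c' l' x ^ (m+2)))"
      by (simp add: power2_eq_square mult_ac)
    also have "\<dots> \<le> B\<^sup>2 / (l * l' * (wt c l c' ^ m * wt c' l' x ^ 2))"
      using main l w by (intro divide_left_mono mult_left_mono) auto
    finally show "cmod (\<phi> x * cnj (\<phi>' x)) \<le> B\<^sup>2 / (l * wt c l c' ^ m) / l' * (1 / wt c' l' x ^ 2)"
      by (simp add: mult_ac)
  qed
  also have "\<dots> = B\<^sup>2 / (l * wt c l c' ^ m) / l' * (\<integral>x. (1 / wt c' l' x ^ 2) \<partial>lborel)"
    by (rule integral_mult_right_zero)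
  also have "\<dots> \<le> B\<^sup>2 / (l * wt c l c' ^ m) / l' * (2 * l')"
    using l by (intro mult_left_mono integral_wt_le divide_nonneg_nonneg) (auto intro!: mult_nonneg_nonneg simp: wt_pos less_imp_le)
  also have "\<dots> = 2 * B\<^sup>2 / (l * wt c l c' ^ m)" using l by simp
  finally show ?thesis unfolding d .
qed

lemma ft_linear:
  assumes "integrable lborel f" "integrable lborel g"
  shows "ft (\<lambda>x. a * f x + b * g x) \<xi> = a * ft f \<xi> + b * ft g \<xi>"
proof -
  have "ft (\<lambda>x. a * f x + b * g x) \<xi> = (\<integral>x. a * (f x * cis (- (x * \<xi>))) + b * (g x * cis (- (x * \<xi>))) \<partial>lborel)"
    unfolding ft_def by (simp add: algebra_simps)
  also have "\<dots> = a * ft f \<xi> + b * ft g \<xi>"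
    unfolding ft_def
    by (subst Bochner_Integration.integral_add) (auto intro!: integrable_mult_right integrable_cis_mult assms)
  finally show ?thesis .
qed

text \<open>Multiplication by a polynomial does not enlarge the Fourier support. Hence this weight localizes
  \<open>L\<^sup>2\<close> estimates to \<open>J\<close> without destroying the orthogonality of the packets.\<close>

definition quad_weight :: "real set \<Rightarrow> real \<Rightarrow> real" where
  "quad_weight J x = 1 + ((x - ivl_center J) / ivl_length J)\<^sup>2"

lemma quad_weight_bounds:
  assumes "proper_interval J"
  shows "1 \<le> quad_weight J x"
    and "quad_weight J x \<le> wt (ivl_center J) (ivl_length J) x ^ 2"
    and "wt (ivl_center J) (ivl_length J) x ^ 2 \<le> 2 * quad_weight J x"
proof -
  define t where "t = \<bar>x - ivl_center J\<bar> / ivl_length J"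
  have t: "0 \<le> t" using proper_interval_length_pos[OF assms] by (simp add: t_def)
  have q: "quad_weight J x = 1 + t\<^sup>2" by (simp add: quad_weight_def t_def power_divide)
  have w: "wt (ivl_center J) (ivl_length J) x = 1 + t" by (simp add: wt_def t_def)
  show "1 \<le> quad_weight J x" by (simp add: q)
  show "quad_weight J x \<le> wt (ivl_center J) (ivl_length J) x ^ 2"
    using t by (simp add: q w power2_eq_square algebra_simps)
  have "0 \<le> (1 - t)\<^sup>2" by simp
  then show "wt (ivl_center J) (ivl_length J) x ^ 2 \<le> 2 * quad_weight J x"
    by (simp add: q w power2_eq_square algebra_simps)
qed

text \<open>The weight has degree two and therefore costs two orders of decay; 9/4 is the price for
  measuring distances at the scale of the tile instead of that of \<open>J\<close>. The Fourier
  support is kept by applying \<open>ft_mult_x_vanishes\<close> twice with the same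
  \<open>Z\<close>.\<close>

lemma packet_quad_weight:
  assumes p: "packet B (m + 2) P \<phi>" and I: "proper_interval (fst P)" and J: "proper_interval J"
    and sub: "fst P \<subseteq> J" and m: "2 \<le> m"
  shows "packet (9/4 * B) m P (\<lambda>x. complex_of_real (quad_weight J x) * \<phi> x)"
proof -
  define l c L C where "l = ltile P" "c = ctile P" "L = ivl_length J" "C = ivl_center J"
  note d = this
  have l: "0 < l" "0 < L" using I J proper_interval_length_pos by (auto simp: d)
  have B: "0 \<le> B" using packet_nonneg p I by blast
  have lL: "l \<le> L" "\<bar>c - C\<bar> \<le> L / 2" using proper_interval_subset[OF I J sub] by (auto simp: d)
  note [measurable] = packet_measurable[OF p]
  have b: "cmod (\<phi> x) \<le> B / (l * wt c l x ^ (m+2))" for x using packet_bound[OF p] by (simp add: d)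
  have w: "0 < wt c l x" "1 \<le> wt c l x" for x using l by (auto simp: wt_pos wt_ge_1)
  have int: "integrable lborel (\<lambda>x. q x * \<phi> x)"
    if q: "q \<in> borel_measurable borel" "\<And>x. cmod (q x) \<le> K * wt c l x ^ 2" and K: "0 \<le> K" for q :: "real \<Rightarrow> complex" and K
  proof (rule Bochner_Integration.integrable_bound)
    show "integrable lborel (\<lambda>x. K * B / l * (1 / wt c l x ^ 2))"
      using l by (intro integrable_mult_right integrable_wt)
    show "(\<lambda>x. q x * \<phi> x) \<in> borel_measurable lborel" using q(1) by measurable
    show "AE x in lborel. cmod (q x * \<phi> x) \<le> norm (K * B / l * (1 / wt c l x ^ 2))"
    proof (rule AE_I2)
      fix x
      have "wt c l x ^ 2 * wt c l x ^ 2 \<le> wt c l x ^ (m + 2)"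
        using w m unfolding power_add[symmetric] by (intro power_increasing) auto
      then have "B / (l * wt c l x ^ (m+2)) \<le> B / (l * (wt c l x ^ 2 * wt c l x ^ 2))"
        using w[of x] l B by (intro divide_left_mono mult_left_mono) auto
      then have "cmod (q x * \<phi> x) \<le> (K * wt c l x ^ 2) * (B / (l * (wt c l x ^ 2 * wt c l x ^ 2)))"
        unfolding norm_mult using q(2)[of x] b[of x] K w[of x] by (intro mult_mono) auto
      also have "\<dots> = K * B / l * (1 / wt c l x ^ 2)" using w(1)[of x] l by (simp add: field_simps del: power2_eq_square)
      finally show "cmod (q x * \<phi> x) \<le> norm (K * B / l * (1 / wt c l x ^ 2))"
        unfolding real_norm_def by (rule order_trans[OF _ abs_ge_self])
    qed
  qed
  have i0: "integrable lborel \<phi>" using packet_integrable[OF p I] by simp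
  have absx: "\<bar>x\<bar> \<le> (\<bar>c\<bar> + l) * wt c l x" for x
  proof -
    have "\<bar>x - c\<bar> = l * (wt c l x - 1)" using l by (simp add: wt_def)
    moreover have "\<bar>c\<bar> * 1 \<le> \<bar>c\<bar> * wt c l x" using w by (intro mult_left_mono) auto
    ultimately show ?thesis using l by (simp add: algebra_simps)
  qed
  have i1: "integrable lborel (\<lambda>x. complex_of_real x * \<phi> x)"
  proof (rule int[where K = "\<bar>c\<bar> + l"])
    fix x
    have "wt c l x * 1 \<le> wt c l x * wt c l x" using w by (intro mult_left_mono) (auto simp: less_imp_le)
    then have "(\<bar>c\<bar> + l) * wt c l x \<le> (\<bar>c\<bar> + l) * wt c l x ^ 2"
      using l by (intro mult_left_mono) (auto simp: power2_eq_square)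
    then show "cmod (complex_of_real x) \<le> (\<bar>c\<bar> + l) * wt c l x ^ 2" using absx[of x] by simp
  qed (use l in auto)
  have i2: "integrable lborel (\<lambda>x. complex_of_real x * (complex_of_real x * \<phi> x))"
  proof -
    have "integrable lborel (\<lambda>x. complex_of_real (x\<^sup>2) * \<phi> x)"
    proof (rule int[where K = "(\<bar>c\<bar> + l)\<^sup>2"])
      fix x
      have "\<bar>x\<bar>\<^sup>2 \<le> ((\<bar>c\<bar> + l) * wt c l x)\<^sup>2" using absx[of x] by (intro power_mono) auto
      then show "cmod (complex_of_real (x\<^sup>2)) \<le> (\<bar>c\<bar> + l)\<^sup>2 * wt c l x ^ 2"
        by (simp add: power_mult_distrib norm_power)
    qed auto
    then show ?thesis by (simp add: power2_eq_square mult.assoc)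
  qed
  obtain Z where Z: "closed Z" "Z \<subseteq> snd P" "\<And>\<xi>. \<xi> \<notin> Z \<Longrightarrow> ft \<phi> \<xi> = 0" using p by (auto simp: packet_def)
  have v1: "ft (\<lambda>x. complex_of_real x * \<phi> x) \<xi> = 0" if "\<xi> \<notin> Z" for \<xi>
    using ft_mult_x_vanishes[OF i0 i1 Z(1)] Z(3) that by blast
  have v2: "ft (\<lambda>x. complex_of_real x * (complex_of_real x * \<phi> x)) \<xi> = 0" if "\<xi> \<notin> Z" for \<xi>
    using ft_mult_x_vanishes[OF i1 i2 Z(1)] v1 that by blast
  show ?thesis
    unfolding packet_def
  proof (intro conjI allI exI[of _ Z])
    show "continuous_on UNIV (\<lambda>x. complex_of_real (quad_weight J x) * \<phi> x)"
      unfolding quad_weight_def divide_inverse by (intro continuous_intros packet_continuous[OF p])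
    fix x
    have "quad_weight J x \<le> wt C L x ^ 2" using quad_weight_bounds(2)[OF J] by (simp add: d)
    also have "\<dots> \<le> (3/2 * wt c l x)\<^sup>2"
      using wt_sub_interval[OF l(1) lL] wt_pos[OF l(2), of C x] by (intro power_mono) auto
    finally have q: "quad_weight J x \<le> 9/4 * wt c l x ^ 2" by (simp add: power_mult_distrib power2_eq_square)
    have "cmod (complex_of_real (quad_weight J x) * \<phi> x) = quad_weight J x * cmod (\<phi> x)"
      using quad_weight_bounds(1)[OF J, of x] by (simp add: norm_mult)
    also have "\<dots> \<le> (9/4 * wt c l x ^ 2) * (B / (l * wt c l x ^ (m+2)))"
      using q b[of x] quad_weight_bounds(1)[OF J, of x] by (intro mult_mono) auto
    also have "\<dots> = (9/4 * B) / (l * wt c l x ^ m)"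
      using w[of x] l by (simp add: power_add field_simps power2_eq_square)
    finally show "cmod (complex_of_real (quad_weight J x) * \<phi> x) \<le> 9 / 4 * B / (ltile P * wtile P x ^ m)"
      unfolding d .
  next
    fix \<xi>
    show "\<xi> \<notin> Z \<longrightarrow> ft (\<lambda>x. complex_of_real (quad_weight J x) * \<phi> x) \<xi> = 0"
    proof
      assume \<xi>: "\<xi> \<notin> Z"
      \<comment> \<open>The coefficients of the weight as a polynomial in \<open>x\<close>.
        Linearity then reduces the claim to \<phi>, \<open>x * \<phi>\<close> and
        \<open>x * (x * \<phi>)\<close>.\<close>
      define a0 a1 a2 where "a0 = complex_of_real (1 + (C / L)\<^sup>2)" "a1 = complex_of_real (- 2 * C / L\<^sup>2)" "a2 = complex_of_real (1 / L\<^sup>2)"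
      have "complex_of_real (quad_weight J x) * \<phi> x =
         a0 * \<phi> x + 1 * (a1 * (complex_of_real x * \<phi> x) + a2 * (complex_of_real x * (complex_of_real x * \<phi> x)))" for x
      proof -
        have "quad_weight J x = (1 + (C / L)\<^sup>2) + ((- 2 * C / L\<^sup>2) * x + (1 / L\<^sup>2) * x\<^sup>2)"
          using l by (simp add: quad_weight_def d(3,4)[symmetric] field_simps power2_eq_square)
        then have "complex_of_real (quad_weight J x) = a0 + (a1 * complex_of_real x + a2 * (complex_of_real x)\<^sup>2)"
          unfolding a0_a1_a2_def of_real_add[symmetric] of_real_mult[symmetric] of_real_power[symmetric] by simp
        then show ?thesis by (simp add: algebra_simps power2_eq_square)
      qed
      then show "ft (\<lambda>x. complex_of_real (quad_weight J x) * \<phi> x) \<xi> = 0"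
        using \<xi> v1 v2 Z(3) i0 i1 i2 by (simp only: ft_linear integrable_mult_right Bochner_Integration.integrable_add) simp
    qed
  qed (use Z in auto)
qed

section \<open>Almost orthogonality: Schur's test and Bessel's inequality\<close>

text \<open>Schur's test: after \<open>a i * a j <= (a i)^2 / 2 + (a j)^2 / 2\<close> the symmetry
  of the kernel makes both halves equal, and each is controlled by a row sum. The weights
  \<open>w\<close> will be the tile lengths.\<close>

lemma Schur_sum_bound:
  fixes a w :: "'i \<Rightarrow> real" and k :: "'i \<Rightarrow> 'i \<Rightarrow> real"
  assumes "finite F" and w: "\<And>i. i \<in> F \<Longrightarrow> 0 \<le> w i" and k: "\<And>i j. i \<in> F \<Longrightarrow> j \<in> F \<Longrightarrow> 0 \<le> k i j"
    and sym: "\<And>i j. i \<in> F \<Longrightarrow> j \<in> F \<Longrightarrow> k i j = k j i"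
    and row: "\<And>i. i \<in> F \<Longrightarrow> (\<Sum>j\<in>F. w j * k i j) \<le> C"
  shows "(\<Sum>i\<in>F. \<Sum>j\<in>F. w i * w j * a i * a j * k i j) \<le> C * (\<Sum>i\<in>F. w i * (a i)\<^sup>2)"
proof -
  have half: "(\<Sum>i\<in>F. \<Sum>j\<in>F. w i * w j * k i j * ((a i)\<^sup>2 / 2)) \<le> C * (\<Sum>i\<in>F. w i * (a i)\<^sup>2) / 2"
  proof -
    have "(\<Sum>i\<in>F. \<Sum>j\<in>F. w i * w j * k i j * ((a i)\<^sup>2 / 2)) = (\<Sum>i\<in>F. w i * ((a i)\<^sup>2 / 2) * (\<Sum>j\<in>F. w j * k i j))"
      unfolding sum_distrib_left by (intro sum.cong refl) simp
    also have "\<dots> \<le> (\<Sum>i\<in>F. w i * ((a i)\<^sup>2 / 2) * C)"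
      using w row by (intro sum_mono mult_left_mono) auto
    also have "\<dots> = C * (\<Sum>i\<in>F. w i * (a i)\<^sup>2) / 2"
      unfolding sum_distrib_left sum_divide_distrib by (intro sum.cong refl) simp
    finally show ?thesis .
  qed
  have "(\<Sum>i\<in>F. \<Sum>j\<in>F. w i * w j * a i * a j * k i j) \<le>
    (\<Sum>i\<in>F. \<Sum>j\<in>F. w i * w j * k i j * ((a i)\<^sup>2 / 2) + w i * w j * k i j * ((a j)\<^sup>2 / 2))"
  proof (intro sum_mono)
    fix i j assume ij: "i \<in> F" "j \<in> F"
    have "a i * a j \<le> (a i)\<^sup>2 / 2 + (a j)\<^sup>2 / 2"
      using sum_squares_bound[of "a i" "a j"] by simp
    then have "w i * w j * k i j * (a i * a j) \<le> w i * w j * k i j * ((a i)\<^sup>2 / 2 + (a j)\<^sup>2 / 2)"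
      using w k ij by (intro mult_left_mono) auto
    then show "w i * w j * a i * a j * k i j \<le> w i * w j * k i j * ((a i)\<^sup>2 / 2) + w i * w j * k i j * ((a j)\<^sup>2 / 2)"
      by (simp add: algebra_simps)
  qed
  also have "\<dots> = (\<Sum>i\<in>F. \<Sum>j\<in>F. w i * w j * k i j * ((a i)\<^sup>2 / 2)) + (\<Sum>i\<in>F. \<Sum>j\<in>F. w i * w j * k i j * ((a j)\<^sup>2 / 2))"
    by (simp add: sum.distrib)
  also have "(\<Sum>i\<in>F. \<Sum>j\<in>F. w i * w j * k i j * ((a j)\<^sup>2 / 2)) = (\<Sum>i\<in>F. \<Sum>j\<in>F. w i * w j * k i j * ((a i)\<^sup>2 / 2))"
    by (subst sum.swap) (auto intro!: sum.cong simp: sym mult_ac)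
  finally show ?thesis using half by simp
qed

text \<open>The last claim, Bessel's inequality, follows by expanding \<open>\<integral>|g - \<Phi>/C|\<^sup>2 \<ge> 0\<close>.\<close>

lemma synthesis_bounds:
  fixes \<phi> :: "'i \<Rightarrow> real \<Rightarrow> complex" and w :: "'i \<Rightarrow> real" and g :: "real \<Rightarrow> complex"
  assumes F: "finite F" and w: "\<And>i. i \<in> F \<Longrightarrow> 0 \<le> w i"
    and int: "\<And>i j. i \<in> F \<Longrightarrow> j \<in> F \<Longrightarrow> integrable lborel (\<lambda>x. \<phi> i x * cnj (\<phi> j x))"
    and gint: "\<And>i. i \<in> F \<Longrightarrow> integrable lborel (\<lambda>x. g x * cnj (\<phi> i x))"
    and \<alpha>: "\<And>i. i \<in> F \<Longrightarrow> \<alpha> i = (ip g (\<phi> i))"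
    and gram: "(\<Sum>i\<in>F. \<Sum>j\<in>F. w i * w j * cmod (\<alpha> i) * cmod (\<alpha> j) * cmod (ip (\<phi> i) (\<phi> j)))
        \<le> C * (\<Sum>i\<in>F. w i * (cmod (\<alpha> i))\<^sup>2)"
  defines "\<Phi> \<equiv> \<lambda>x. \<Sum>i\<in>F. complex_of_real (w i) * \<alpha> i * \<phi> i x"
  shows "integrable lborel (\<lambda>x. (cmod (\<Phi> x))\<^sup>2)"
    and "(sqnorm \<Phi>) \<le> C * (\<Sum>i\<in>F. w i * (cmod (\<alpha> i))\<^sup>2)"
    and "integrable lborel (\<lambda>x. g x * cnj (\<Phi> x))"
    and "(ip g \<Phi>) = complex_of_real (\<Sum>i\<in>F. w i * (cmod (\<alpha> i))\<^sup>2)"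
    and "0 < C \<Longrightarrow> integrable lborel (\<lambda>x. (cmod (g x))\<^sup>2) \<Longrightarrow>
      (\<Sum>i\<in>F. w i * (cmod (\<alpha> i))\<^sup>2) \<le> C * (sqnorm g)"
proof -
  define S where "S = (\<Sum>i\<in>F. w i * (cmod (\<alpha> i))\<^sup>2)"
  define coef where "coef i j = complex_of_real (w i * w j) * \<alpha> i * cnj (\<alpha> j)" for i j
  have expand: "complex_of_real ((cmod (\<Phi> x))\<^sup>2) = (\<Sum>i\<in>F. \<Sum>j\<in>F. coef i j * (\<phi> i x * cnj (\<phi> j x)))" for x
    unfolding complex_norm_square \<Phi>_def cnj_sum sum_product coef_def by (simp add: mult_ac)
  have i1: "integrable lborel (\<lambda>x. complex_of_real ((cmod (\<Phi> x))\<^sup>2))"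
    unfolding expand using int by (intro Bochner_Integration.integrable_sum integrable_mult_right) auto
  then show i: "integrable lborel (\<lambda>x. (cmod (\<Phi> x))\<^sup>2)"
    by (simp only: complex_of_real_integrable_eq)
  have "complex_of_real (sqnorm \<Phi>) = (\<integral>x. complex_of_real ((cmod (\<Phi> x))\<^sup>2) \<partial>lborel)"
    by (rule integral_complex_of_real[symmetric])
  also have "\<dots> = (\<Sum>i\<in>F. \<Sum>j\<in>F. coef i j * (ip (\<phi> i) (\<phi> j)))"
    unfolding expand using int by (simp add: Bochner_Integration.integral_sum)
  finally have e: "complex_of_real (sqnorm \<Phi>) = \<dots>" .
  have "\<bar>\<integral>x. (cmod (\<Phi> x))\<^sup>2 \<partial>lborel\<bar> = cmod (complex_of_real (sqnorm \<Phi>))" by (simp only: norm_of_real)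
  also have "\<dots> \<le> (\<Sum>i\<in>F. \<Sum>j\<in>F. cmod (coef i j * (ip (\<phi> i) (\<phi> j))))"
    unfolding e by (intro order_trans[OF norm_sum] sum_mono order_refl)
  also have "\<dots> = (\<Sum>i\<in>F. \<Sum>j\<in>F. w i * w j * cmod (\<alpha> i) * cmod (\<alpha> j) * cmod (ip (\<phi> i) (\<phi> j)))"
    unfolding coef_def norm_mult norm_of_real complex_mod_cnj using w by (intro sum.cong refl) (simp add: abs_mult)
  also have "\<dots> \<le> C * S" using gram by (simp add: S_def)
  finally show \<Phi>2: "(sqnorm \<Phi>) \<le> C * (\<Sum>i\<in>F. w i * (cmod (\<alpha> i))\<^sup>2)" by (simp add: S_def)
  have gexp: "g x * cnj (\<Phi> x) = (\<Sum>i\<in>F. complex_of_real (w i) * cnj (\<alpha> i) * (g x * cnj (\<phi> i x)))" for x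
    unfolding \<Phi>_def by (simp add: cnj_sum sum_distrib_left mult_ac)
  show gi: "integrable lborel (\<lambda>x. g x * cnj (\<Phi> x))"
    unfolding gexp using gint by (intro Bochner_Integration.integrable_sum integrable_mult_right) auto
  have "(ip g \<Phi>) = (\<Sum>i\<in>F. complex_of_real (w i) * cnj (\<alpha> i) * \<alpha> i)"
    unfolding gexp using gint by (simp add: Bochner_Integration.integral_sum \<alpha>)
  also have "\<dots> = complex_of_real S"
    unfolding S_def of_real_sum by (intro sum.cong refl) (simp only: of_real_mult complex_norm_square mult_ac)
  finally show gS: "(ip g \<Phi>) = complex_of_real (\<Sum>i\<in>F. w i * (cmod (\<alpha> i))\<^sup>2)" unfolding S_def .
  assume C: "0 < C" and g2: "integrable lborel (\<lambda>x. (cmod (g x))\<^sup>2)"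
  have pt: "0 \<le> (cmod (g x))\<^sup>2 - 2 / C * Re (g x * cnj (\<Phi> x)) + 1 / C\<^sup>2 * (cmod (\<Phi> x))\<^sup>2" for x
  proof -
    have "0 \<le> (cmod (g x - complex_of_real (1 / C) * \<Phi> x))\<^sup>2" by simp
    also have "\<dots> = (cmod (g x))\<^sup>2 - 2 / C * Re (g x * cnj (\<Phi> x)) + 1 / C\<^sup>2 * (cmod (\<Phi> x))\<^sup>2"
      unfolding cmod_power2 by (simp add: power2_eq_square algebra_simps add_divide_distrib)
    finally show ?thesis .
  qed
  have "0 \<le> (\<integral>x. (cmod (g x))\<^sup>2 - 2 / C * Re (g x * cnj (\<Phi> x)) + 1 / C\<^sup>2 * (cmod (\<Phi> x))\<^sup>2 \<partial>lborel)"
    using pt by (intro Bochner_Integration.integral_nonneg) auto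
  also have "\<dots> = (sqnorm g) - 2 / C * (\<integral>x. Re (g x * cnj (\<Phi> x)) \<partial>lborel) + 1 / C\<^sup>2 * (sqnorm \<Phi>)"
  proof -
    have R: "integrable lborel (\<lambda>x. 2 / C * Re (g x * cnj (\<Phi> x)))"
      by (intro integrable_mult_right integrable_Re gi)
    have P: "integrable lborel (\<lambda>x. 1 / C\<^sup>2 * (cmod (\<Phi> x))\<^sup>2)" by (intro integrable_mult_right i)
    show ?thesis
      by (simp only: Bochner_Integration.integral_add[OF Bochner_Integration.integrable_diff[OF g2 R] P]
          Bochner_Integration.integral_diff[OF g2 R] integral_mult_right_zero)
  qed
  also have "(\<integral>x. Re (g x * cnj (\<Phi> x)) \<partial>lborel) = S"
    using gS integral_Re[OF gi] by (simp add: S_def)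
  also have "(sqnorm g) - 2 / C * S + 1 / C\<^sup>2 * (sqnorm \<Phi>)
    \<le> (sqnorm g) - 2 / C * S + 1 / C\<^sup>2 * (C * S)"
    using \<Phi>2 by (intro add_left_mono mult_left_mono) (auto simp: S_def)
  also have "\<dots> = (sqnorm g) - S / C"
    using C by (simp add: power2_eq_square field_simps)
  finally show "(\<Sum>i\<in>F. w i * (cmod (\<alpha> i))\<^sup>2) \<le> C * (sqnorm g)"
    using C by (simp add: field_simps S_def)
qed

lemma packet_mono:
  assumes "packet B n P \<phi>" "m \<le> n" "proper_interval (fst P)"
  shows "packet B m P \<phi>"
  unfolding packet_def
proof (intro conjI allI)
  have l: "0 < ltile P" by (rule proper_interval_length_pos[OF assms(3)])
  show "continuous_on UNIV \<phi>" by (rule packet_continuous[OF assms(1)])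
  show "\<exists>Z. closed Z \<and> Z \<subseteq> snd P \<and> (\<forall>\<xi>. \<xi> \<notin> Z \<longrightarrow> ft \<phi> \<xi> = 0)" using assms(1) by (simp add: packet_def)
  fix x
  have "B / (ltile P * wtile P x ^ n) \<le>
     B / (ltile P * wtile P x ^ m)"
    using l wt_ge_1[OF l] packet_nonneg[OF assms(1,3)] assms(2)
    by (intro divide_left_mono mult_left_mono power_increasing mult_pos_pos zero_less_power wt_pos) auto
  then show "cmod (\<phi> x) \<le> B / (ltile P * wtile P x ^ m)"
    using packet_bound[OF assms(1), of x] by simp
qed

section \<open>Decay and demodulated smoothness of the wave packets\<close>

lemma one_plus_abs_le_japanese: "(1 + \<bar>x\<bar>) ^ 8 \<le> 16 * japanese x ^ 8"
proof -
  have "0 \<le> (1 - \<bar>x\<bar>)\<^sup>2" by simp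
  then have "(1 + \<bar>x\<bar>)\<^sup>2 \<le> 2 * (1 + x\<^sup>2)" by (simp add: power2_eq_square algebra_simps)
  then have "((1 + \<bar>x\<bar>)\<^sup>2) ^ 4 \<le> (2 * (1 + x\<^sup>2)) ^ 4" by (intro power_mono) auto
  then have "(1 + \<bar>x\<bar>) ^ 8 \<le> 16 * (1 + x\<^sup>2) ^ 4" by (subst (asm) power_mult_distrib) (simp add: power_mult[symmetric])
  moreover have "japanese x ^ 8 = ((japanese x)\<^sup>2) ^ 4" by (simp add: power_mult[symmetric])
  moreover have "(japanese x)\<^sup>2 = 1 + x\<^sup>2" unfolding japanese_def by (intro real_sqrt_pow2) (simp add: add_nonneg_nonneg)
  ultimately show ?thesis by (simp add: power_mult_distrib power_mult[symmetric])
qed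

text \<open>The order 8 is spent in pairs in the Bessel estimate: two orders on the quadratic
  weight, two on integrating an inner product, two on summing the tiles of one scale, two on
  integrating a tail outside a top interval.\<close>

lemma Theta_decay:
  assumes \<theta>: "\<theta> \<in> Theta M" and M: "8 \<le> M" and \<alpha>: "\<alpha> \<le> M"
  shows "cmod (deriv_n \<alpha> \<theta> x) \<le> 16 / (1 + \<bar>x\<bar>) ^ 8"
proof -
  have j: "1 \<le> japanese x" by (simp add: japanese_def)
  have "japanese x ^ 8 * cmod (deriv_n \<alpha> \<theta> x) \<le> japanese x ^ M * cmod (deriv_n \<alpha> \<theta> x)"
    using j M by (intro mult_right_mono power_increasing) auto
  also have "\<dots> \<le> 1" using \<theta> \<alpha> by (auto simp: Theta_def)
  finally have "16 * (japanese x ^ 8 * cmod (deriv_n \<alpha> \<theta> x)) \<le> 16" by simp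
  moreover have "(1 + \<bar>x\<bar>) ^ 8 * cmod (deriv_n \<alpha> \<theta> x) \<le> 16 * japanese x ^ 8 * cmod (deriv_n \<alpha> \<theta> x)"
    by (intro mult_right_mono one_plus_abs_le_japanese) auto
  ultimately have "(1 + \<bar>x\<bar>) ^ 8 * cmod (deriv_n \<alpha> \<theta> x) \<le> 16" by (simp add: mult.assoc)
  moreover have "0 < (1 + \<bar>x\<bar>) ^ 8" by (intro zero_less_power) (simp add: add_pos_nonneg)
  ultimately show ?thesis by (simp add: pos_le_divide_eq mult.commute)
qed

lemma Theta_has_vector_derivative:
  assumes "\<theta> \<in> Theta M" "8 \<le> M"
  shows "(\<theta> has_vector_derivative deriv_n 1 \<theta> x) (at x)"
proof -
  have "deriv_n 0 \<theta> differentiable (at x)" using assms by (auto simp: Theta_def C_n_def)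
  then show ?thesis by (simp add: deriv_n_def vector_derivative_works)
qed

lemma Phi_packet:
  assumes \<phi>: "\<phi> \<in> Phi M P" and M: "8 \<le> M" and P: "proper_interval (fst P)"
  shows "packet 16 8 P \<phi>"
proof -
  define l c where "l = ltile P" "c = ctile P"
  note d = this
  have l: "0 < l" using proper_interval_length_pos[OF P] by (simp add: d)
  obtain \<theta> where \<theta>: "\<theta> \<in> Theta M" and \<phi>_eq: "\<phi> = (\<lambda>x. cis (ivl_center (snd P) * x) * complex_of_real (1 / l) * \<theta> ((x - c) / l))"
    and supp: "closure {\<xi>. fourier \<phi> \<xi> \<noteq> 0} \<subseteq> snd P"
    using \<phi> by (auto simp: Phi_def d)
  have cont\<theta>: "continuous_on UNIV \<theta>"
    using has_vector_derivative_continuous[OF Theta_has_vector_derivative[OF \<theta> M]]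
    by (simp add: continuous_on_eq_continuous_at)
  have cont: "continuous_on UNIV \<phi>"
    unfolding \<phi>_eq using l by (intro continuous_intros continuous_on_compose2[OF cont\<theta>]) auto
  have [measurable]: "\<phi> \<in> borel_measurable borel" using cont by (rule borel_measurable_continuous_onI)
  show ?thesis
    unfolding packet_def
  proof (intro conjI allI exI[of _ "closure {\<xi>. fourier \<phi> \<xi> \<noteq> 0}"] impI)
    fix x
    have "cmod (\<phi> x) = 1 / l * cmod (\<theta> ((x - c) / l))" using l by (simp add: \<phi>_eq norm_mult norm_divide)
    also have "\<dots> \<le> 1 / l * (16 / (1 + \<bar>(x - c) / l\<bar>) ^ 8)"
      using Theta_decay[OF \<theta> M, of 0 "(x - c) / l"] l by (intro mult_left_mono) (auto simp: deriv_n_def)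
    also have "\<dots> = 16 / (l * wt c l x ^ 8)" using l by (simp add: wt_def)
    finally show "cmod (\<phi> x) \<le> 16 / (ltile P * wtile P x ^ 8)"
      unfolding d .
  next
    fix \<xi> assume "\<xi> \<notin> closure {\<xi>. fourier \<phi> \<xi> \<noteq> 0}"
    then have "fourier \<phi> \<xi> = 0"
      using subsetD[OF closure_subset[of "{\<xi>. fourier \<phi> \<xi> \<noteq> 0}"], of \<xi>] by fastforce
    moreover have "(LINT x|lebesgue. \<phi> x * cis (- (x * \<xi>))) = ft \<phi> \<xi>"
      unfolding ft_def by (rule integral_completion) measurable
    ultimately show "ft \<phi> \<xi> = 0" by (simp add: fourier_def)
  qed (use cont supp in auto)
qed

text \<open>A packet oscillates at its own frequency, which may be far from zero. Removing a
  frequency \<xi> within \<open>A / l\<close> of its center leaves an oscillation at scale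
  \<open>l\<close>, so that a derivative costs only \<open>(A + 1) / l\<close>. The restriction on
  \<open>x\<close> keeps the weight on the segment above half of its value at \<open>y\<close>; thus
  \<open>4096 = 16 * 2^8\<close>.\<close>

lemma Phi_modulated_Lipschitz:
  assumes \<phi>: "\<phi> \<in> Phi M P" and M: "8 \<le> M" and P: "proper_interval (fst P)"
  defines "l \<equiv> ltile P" and "c \<equiv> ctile P"
  assumes A: "\<bar>ivl_center (snd P) - \<xi>\<bar> \<le> A / l" and xy: "\<bar>x - y\<bar> \<le> l * wt c l y / 2"
  shows "cmod (cis (- (\<xi> * x)) * \<phi> x - cis (- (\<xi> * y)) * \<phi> y) \<le> 4096 * (A + 1) / (l\<^sup>2 * wt c l y ^ 8) * \<bar>x - y\<bar>"
proof -
  have l: "0 < l" using proper_interval_length_pos[OF P] by (simp add: l_def)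
  define \<eta> where "\<eta> = ivl_center (snd P) - \<xi>"
  have A0: "0 \<le> A" using A l by (meson abs_ge_zero divide_less_0_iff less_le_trans not_less order_trans)
  obtain \<theta> where \<theta>: "\<theta> \<in> Theta M" and \<phi>_eq: "\<phi> = (\<lambda>x. cis (ivl_center (snd P) * x) * complex_of_real (1 / l) * \<theta> ((x - c) / l))"
    using \<phi> by (auto simp: Phi_def l_def c_def)
  \<comment> \<open>The demodulated packet, with \<eta> the residual frequency, and its derivative
    by the product rule; the mean value inequality is applied on the segment from \<open>y\<close>
    to \<open>x\<close>.\<close>
  define E where "E z = (1 / l) *\<^sub>R (cis (\<eta> * z) * \<theta> ((z - c) / l))" for z
  define E' where "E' z = (1 / l) *\<^sub>R (cis (\<eta> * z) * ((1 / l) *\<^sub>R deriv_n 1 \<theta> ((z - c) / l)) + (\<eta> *\<^sub>R (\<i> * cis (\<eta> * z))) * \<theta> ((z - c) / l))" for z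
  have E: "cis (- (\<xi> * z)) * \<phi> z = E z" for z
    unfolding \<phi>_eq E_def \<eta>_def
    by (simp add: scaleR_conv_of_real cis_mult mult.assoc[symmetric] left_diff_distrib)
  have dE: "(E has_vector_derivative E' z) (at z)" for z
  proof -
    have "((\<lambda>z. (z - c) / l) has_vector_derivative 1 / l) (at z)"
      using l by (auto intro!: derivative_eq_intros simp flip: has_real_derivative_iff_has_vector_derivative)
    from vector_diff_chain_at[OF this Theta_has_vector_derivative[OF \<theta> M]]
    have 1: "((\<lambda>z. \<theta> ((z - c) / l)) has_vector_derivative (1 / l) *\<^sub>R deriv_n 1 \<theta> ((z - c) / l)) (at z)"
      by (simp add: o_def)
    have "(cis has_vector_derivative \<i> * cis (\<eta> * z)) (at (\<eta> * z))"
    proof -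
      have "(cis has_derivative (\<lambda>b. b *\<^sub>R (\<i> * cis (\<eta> * z)))) (at (\<eta> * z))"
        by (auto intro!: derivative_eq_intros has_derivative_cis[OF has_derivative_ident, THEN has_derivative_eq_rhs])
      then show ?thesis by (simp add: has_vector_derivative_def)
    qed
    moreover have "((\<lambda>z. \<eta> * z) has_vector_derivative \<eta>) (at z)"
      by (auto intro!: derivative_eq_intros simp flip: has_real_derivative_iff_has_vector_derivative)
    ultimately have 2: "((\<lambda>z. cis (\<eta> * z)) has_vector_derivative \<eta> *\<^sub>R (\<i> * cis (\<eta> * z))) (at z)"
      using vector_diff_chain_at[of "\<lambda>z. \<eta> * z" \<eta> z cis "\<i> * cis (\<eta> * z)"] by (simp add: o_def)
    show ?thesis
      unfolding E_def[abs_def] E'_def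
      by (rule bounded_linear.has_vector_derivative[OF bounded_linear_scaleR_right has_vector_derivative_mult[OF 2 1]])
  qed
  define S where "S = closed_segment x y"
  define K where "K = 4096 * (A + 1) / (l\<^sup>2 * wt c l y ^ 8)"
  have wy: "0 < wt c l y" using l by (rule wt_pos)
  have K0: "0 \<le> K" using A0 l wy by (simp add: K_def)
  have bE': "cmod (E' z) \<le> K" if "z \<in> S" for z
  proof -
    have "\<bar>z - y\<bar> \<le> \<bar>x - y\<bar>" using that unfolding S_def
      by (metis dist_commute dist_in_closed_segment dist_real_def)
    then have "\<bar>y - c\<bar> \<le> \<bar>z - c\<bar> + l * wt c l y / 2" using xy by linarith
    then have "\<bar>y - c\<bar> / l \<le> (\<bar>z - c\<bar> + l * wt c l y / 2) / l" using l by (intro divide_right_mono) auto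
    also have "\<dots> = \<bar>z - c\<bar> / l + wt c l y / 2" using l by (simp add: field_simps)
    finally have "\<bar>y - c\<bar> / l \<le> \<bar>z - c\<bar> / l + wt c l y / 2" .
    moreover have "\<bar>z - c\<bar> / l = wt c l z - 1" "\<bar>y - c\<bar> / l = wt c l y - 1" by (simp_all add: wt_def)
    ultimately have "wt c l y \<le> 2 * wt c l z" by linarith
    then have "wt c l y ^ 8 \<le> (2 * wt c l z) ^ 8" using wy by (intro power_mono) auto
    then have wz: "wt c l y ^ 8 \<le> 256 * wt c l z ^ 8" by (simp add: power_mult_distrib)
    have wz0: "0 < wt c l z" using l by (rule wt_pos)
    define q where "q = 16 / wt c l z ^ 8"
    have abs: "1 + \<bar>(z - c) / l\<bar> = wt c l z" using l by (simp add: wt_def)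
    have q: "cmod (\<theta> ((z - c) / l)) \<le> q" "cmod (deriv_n 1 \<theta> ((z - c) / l)) \<le> q"
      using Theta_decay[OF \<theta> M, of 0 "(z - c) / l"] Theta_decay[OF \<theta> M, of 1 "(z - c) / l"] M
      unfolding abs q_def by (auto simp: deriv_n_def)
    have q0: "0 \<le> q" using wz0 by (simp add: q_def)
    have "cmod (E' z) \<le> 1 / l * (1 / l * cmod (deriv_n 1 \<theta> ((z - c) / l)) + \<bar>\<eta>\<bar> * cmod (\<theta> ((z - c) / l)))"
      unfolding E'_def norm_scaleR using l
      by (intro mult_mono order_trans[OF norm_triangle_ineq] add_mono) (auto simp: norm_mult)
    also have "\<dots> \<le> 1 / l * (1 / l * q + A / l * q)"
      using l q A q0 A0 by (intro mult_left_mono add_mono mult_mono) (auto simp: \<eta>_def)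
    also have "\<dots> = (A + 1) / l\<^sup>2 * q" by (simp add: power2_eq_square add_divide_distrib algebra_simps)
    also have "\<dots> \<le> (A + 1) / l\<^sup>2 * (4096 / wt c l y ^ 8)"
      using A0 wz wy wz0 l by (intro mult_left_mono) (auto simp: q_def field_simps)
    finally show ?thesis by (simp add: K_def mult_ac)
  qed
  have "norm (E x - E y) \<le> K * norm (x - y)"
  proof (rule differentiable_bound[of S])
    show "convex S" by (simp add: S_def)
    show "(E has_derivative (\<lambda>h. h *\<^sub>R E' z)) (at z within S)" for z
      using dE[of z] unfolding has_vector_derivative_def by (rule has_derivative_at_withinI)
    show "onorm (\<lambda>h. h *\<^sub>R E' z) \<le> K" if "z \<in> S" for z
      using bE'[OF that] K0 by (intro onorm_bound) (auto simp: mult.commute[of K] intro!: mult_left_mono)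
  qed (auto simp: S_def)
  then show ?thesis by (simp add: E K_def)
qed

section \<open>Geometric summation over dyadic scales\<close>

text \<open>Every element other than the maximum is at most half of it, so by induction the rest
  adds up to no more than the maximum itself.\<close>

lemma sum_geometric_le:
  fixes S :: "real set"
  assumes "finite S" "\<And>a b. a \<in> S \<Longrightarrow> b \<in> S \<Longrightarrow> a < b \<Longrightarrow> 2 * a \<le> b" "\<And>a. a \<in> S \<Longrightarrow> a \<le> r" "0 \<le> r"
  shows "\<Sum>S \<le> 2 * r"
  using assms
proof (induction S arbitrary: r rule: finite_linorder_max_induct)
  case (insert b A)
  show ?case
  proof (cases "A = {}")
    case True
    then show ?thesis using insert.prems(2)[of b] insert.prems(3) by simp
  next
    case False
    then obtain a where a: "a \<in> A" by auto
    show ?thesis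
    proof (cases "0 \<le> b")
      case True
      have "a \<le> b / 2" if "a \<in> A" for a
        using insert.prems(1)[of a b] insert.hyps(2) that by auto
      then have "\<Sum>A \<le> 2 * (b / 2)" using insert.prems(1) True by (intro insert.IH) auto
      then show ?thesis using insert.hyps insert.prems(2)[of b] by (subst sum.insert) auto
    next
      case False
      have "\<Sum>A \<le> 0" using insert.hyps(2) False by (intro sum_nonpos) force
      then show ?thesis using insert.hyps False insert.prems(3) by (subst sum.insert) auto
    qed
  qed
qed auto

text \<open>The factor \<open>min (r / l) (l / r)\<close> peaks at \<open>l = r\<close> and decays
  geometrically on either side; the lengths below \<open>r\<close> and those above \<open>r\<close>
  contribute \<open>2 * m\<close> each.\<close>

lemma sum_over_scales:
  fixes len v :: "'i \<Rightarrow> real"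
  assumes F: "finite F" and ratio: "\<And>i j. i \<in> F \<Longrightarrow> j \<in> F \<Longrightarrow> len i < len j \<Longrightarrow> 2 * len i \<le> len j"
    and pos: "\<And>i. i \<in> F \<Longrightarrow> 0 < len i" and v: "\<And>i. i \<in> F \<Longrightarrow> 0 \<le> v i"
    and level: "\<And>l. (\<Sum>i | i \<in> F \<and> len i = l. v i) \<le> m" and r: "0 < r"
  shows "(\<Sum>i\<in>F. v i * min (r / len i) (len i / r)) \<le> 4 * m"
proof -
  let ?S = "len ` F"
  have m: "0 \<le> m" using level[of "-1"] pos by (rule_tac order_trans[OF sum_nonneg level[of "-1"]]) (use v in auto)
  have "(\<Sum>i\<in>F. v i * min (r / len i) (len i / r)) = (\<Sum>l\<in>?S. \<Sum>i | i \<in> F \<and> len i = l. v i * min (r / len i) (len i / r))"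
    using F by (rule sum.image_gen)
  also have "\<dots> \<le> (\<Sum>l\<in>?S. m * min (r / l) (l / r))"
  proof (rule sum_mono)
    fix l assume "l \<in> ?S"
    then have "0 < l" using pos by auto
    have "(\<Sum>i | i \<in> F \<and> len i = l. v i * min (r / len i) (len i / r)) = (\<Sum>i | i \<in> F \<and> len i = l. v i) * min (r / l) (l / r)"
      by (simp add: sum_distrib_right)
    also have "\<dots> \<le> m * min (r / l) (l / r)" using level[of l] \<open>0 < l\<close> r by (intro mult_right_mono) auto
    finally show "(\<Sum>i | i \<in> F \<and> len i = l. v i * min (r / len i) (len i / r)) \<le> m * min (r / l) (l / r)" .
  qed
  also have "\<dots> = m * (\<Sum>l\<in>?S. min (r / l) (l / r))" by (simp add: sum_distrib_left)
  also have "(\<Sum>l\<in>?S. min (r / l) (l / r)) \<le> (\<Sum>l\<in>?S. (if l \<le> r then l / r else 0) + (if r \<le> l then r / l else 0))"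
    using pos r by (intro sum_mono) auto
  also have "\<dots> = (\<Sum>l\<in>{l\<in>?S. l \<le> r}. l / r) + (\<Sum>l\<in>{l\<in>?S. r \<le> l}. r / l)"
    using F by (simp add: sum.distrib sum.inter_filter)
  also have "(\<Sum>l\<in>{l\<in>?S. l \<le> r}. l / r) = \<Sum>{l\<in>?S. l \<le> r} / r" by (simp add: sum_divide_distrib)
  also have "\<dots> \<le> 2 * r / r"
    using F ratio r by (intro divide_right_mono sum_geometric_le) auto
  also have "2 * r / r = 2" using r by simp
  \<comment> \<open>Above \<open>r\<close> it is the reciprocals that form a set with ratios at
    least two.\<close>
  also have "(\<Sum>l\<in>{l\<in>?S. r \<le> l}. r / l) = \<Sum>((\<lambda>l. r / l) ` {l\<in>?S. r \<le> l})"
    using r pos by (subst sum.reindex) (auto simp: inj_on_def)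
  also have "\<dots> \<le> 2 * 1"
  proof (rule sum_geometric_le)
    fix a b assume "a \<in> (\<lambda>l. r / l) ` {l\<in>?S. r \<le> l}" "b \<in> (\<lambda>l. r / l) ` {l\<in>?S. r \<le> l}" "a < b"
    then obtain i j where ij: "i \<in> F" "j \<in> F" "a = r / len i" "b = r / len j" by auto
    then have p: "0 < len i" "0 < len j" using pos by auto
    have "len j < len i" using \<open>a < b\<close> p r by (simp add: ij divide_less_eq less_divide_eq)
    then have "2 * len j \<le> len i" using ratio ij by auto
    then have "r * (2 * len j) \<le> r * len i" using r by (intro mult_left_mono) auto
    then show "2 * a \<le> b" using p by (simp add: ij field_simps)
  qed (use F r pos in \<open>auto simp: divide_le_eq_1\<close>)
  finally show ?thesis using m by (simp add: mult_left_mono)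
qed

section \<open>Trees\<close>

locale dual_grid_pair =
  fixes D D' :: "real set set" and \<rho> \<rho>' :: real
  assumes grid: "dyadic_grid \<rho> D" and grid': "dyadic_grid \<rho>' D'"
begin

lemma tile_mem:
  assumes "P \<in> all_tiles D D'"
  shows "fst P \<in> D" "snd P \<in> D'" "ltile P * ivl_length (snd P) = 1"
  using assms by (auto simp: all_tiles_def)

lemma tile_proper:
  assumes "P \<in> all_tiles D D'"
  shows "proper_interval (fst P)" "proper_interval (snd P)"
  using tile_mem[OF assms] grid_proper[OF grid] grid_proper[OF grid'] by auto

lemma tile_length_pos: "P \<in> all_tiles D D' \<Longrightarrow> 0 < ltile P"
  using tile_proper proper_interval_length_pos by blast

lemma tile_freq_length: "P \<in> all_tiles D D' \<Longrightarrow> ivl_length (snd P) = 1 / ltile P"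
  using tile_mem(3)[of P] tile_length_pos[of P] by (simp add: field_simps)

text \<open>Length and point leave four choices for the spatial interval, and \<open>m\<close>
  counts the choices for the frequency interval.\<close>

lemma card_tiles_through:
  assumes V: "V \<subseteq> all_tiles D D'" "finite V"
    and m: "card (snd ` {P \<in> V. ltile P = l}) \<le> m"
  shows "card {P \<in> V. ltile P = l \<and> x \<in> fst P} \<le> 4 * m"
proof -
  have "{P \<in> V. ltile P = l \<and> x \<in> fst P} \<subseteq> {I \<in> D. x \<in> I \<and> ivl_length I = l} \<times> snd ` {P \<in> V. ltile P = l}"
  proof
    fix P assume "P \<in> {P \<in> V. ltile P = l \<and> x \<in> fst P}"
    then have P: "P \<in> V" "ltile P = l" "x \<in> fst P" by blast+
    then have "fst P \<in> {I \<in> D. x \<in> I \<and> ivl_length I = l}" using tile_mem(1)[of P] V by blast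
    moreover have "snd P \<in> snd ` {P \<in> V. ltile P = l}" using P by blast
    ultimately show "P \<in> {I \<in> D. x \<in> I \<and> ivl_length I = l} \<times> snd ` {P \<in> V. ltile P = l}"
      by (simp add: mem_Times_iff)
  qed
  then have "card {P \<in> V. ltile P = l \<and> x \<in> fst P} \<le> card ({I \<in> D. x \<in> I \<and> ivl_length I = l} \<times> snd ` {P \<in> V. ltile P = l})"
    using V grid_card_through_point(1)[OF grid] by (intro card_mono finite_cartesian_product) auto
  also have "\<dots> \<le> 4 * m"
    unfolding card_cartesian_product using grid_card_through_point(2)[OF grid] m by (intro mult_mono) auto
  finally show ?thesis .
qed

text \<open>All frequency intervals of one scale have length \<open>1 / l\<close>, are pairwise
  disjoint and lie within \<open>2^\<kappa> / l\<close> of \<xi>, since the ancestor of each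
  contains \<xi>. Comparing total lengths bounds their number.\<close>

lemma lacunary_card_freq:
  assumes V: "V \<subseteq> all_tiles D D'" "finite V" and lac: "disjoint (snd ` V)"
    and \<xi>: "\<And>P. P \<in> V \<Longrightarrow> \<xi> \<in> dyadic_ancestor D' \<kappa> (snd P)" and l: "0 < l"
  shows "card (snd ` {P \<in> V. ltile P = l}) \<le> 2 * 2 ^ \<kappa>"
proof -
  let ?\<Omega> = "snd ` {P \<in> V. ltile P = l}"
  define R where "R = 2 ^ \<kappa> / l"
  have R: "0 < R" using l by (simp add: R_def)
  have "(\<Sum>\<omega>\<in>?\<Omega>. ivl_length \<omega>) \<le> real 1 * ivl_length {\<xi> - R..\<xi> + R}"
  proof (rule sum_length_le_overlap)
    show "proper_interval \<omega>" if "\<omega> \<in> ?\<Omega>" for \<omega> using that V tile_proper by auto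
    show "\<omega> \<subseteq> {\<xi> - R..\<xi> + R}" if w: "\<omega> \<in> ?\<Omega>" for \<omega>
    proof
      fix x assume x: "x \<in> \<omega>"
      obtain P where P: "P \<in> V" "ltile P = l" "\<omega> = snd P" using w by blast
      note anc = grid_ancestor[OF grid' tile_mem(2), of P \<kappa>]
      let ?A = "dyadic_ancestor D' \<kappa> (snd P)"
      have A: "proper_interval ?A" "ivl_length ?A = R" "x \<in> ?A"
        using anc P V x tile_freq_length[of P] grid_proper[OF grid'] by (auto simp: R_def)
      show "x \<in> {\<xi> - R..\<xi> + R}"
        using proper_interval_bounds[OF A(1,3)] proper_interval_bounds[OF A(1) \<xi>[OF P(1)]] A(2)
        unfolding ivl_length_def by auto
    qed
    show "card {\<omega> \<in> ?\<Omega>. x \<in> \<omega>} \<le> 1" for x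
    proof (rule card_le_Suc0_iff_eq[THEN iffD2, unfolded One_nat_def[symmetric]])
      show "finite {\<omega> \<in> ?\<Omega>. x \<in> \<omega>}" using V by auto
      show "\<forall>a\<in>{\<omega> \<in> ?\<Omega>. x \<in> \<omega>}. \<forall>b\<in>{\<omega> \<in> ?\<Omega>. x \<in> \<omega>}. a = b"
        using lac unfolding disjoint_def by auto
    qed
  qed (use V R proper_interval_cball in auto)
  moreover have "(\<Sum>\<omega>\<in>?\<Omega>. ivl_length \<omega>) = (\<Sum>\<omega>\<in>?\<Omega>. 1 / l)"
    using V tile_freq_length by (intro sum.cong) auto
  ultimately have "real (card ?\<Omega>) / l \<le> 2 * 2 ^ \<kappa> / l" using R by (simp add: ivl_length_cball R_def)
  then have "real (card ?\<Omega>) \<le> real (2 * 2 ^ \<kappa>)" using l by (simp add: divide_le_cancel)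
  then show ?thesis by (simp only: of_nat_le_iff)
qed

lemma lacunary_overlap:
  assumes "V \<subseteq> all_tiles D D'" "finite V" "disjoint (snd ` V)"
    and "\<And>P. P \<in> V \<Longrightarrow> \<xi> \<in> dyadic_ancestor D' \<kappa> (snd P)"
  shows "card {P \<in> V. ltile P = l \<and> x \<in> fst P} \<le> 8 * 2 ^ \<kappa>"
proof (cases "0 < l")
  case True
  show ?thesis
    using card_tiles_through[OF assms(1,2) lacunary_card_freq[OF assms True], of x] by simp
next
  case False
  then have "{P \<in> V. ltile P = l \<and> x \<in> fst P} = {}" using tile_length_pos assms(1) by force
  then show ?thesis by (simp only: card.empty)
qed

text \<open>For tiles of a grid this means that the frequency intervals agree up to their end
  points. Such pairs escape Fourier orthogonality even when the intervals are not equal as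
  sets.\<close>

definition same_scale_meet :: "tile \<Rightarrow> tile \<Rightarrow> bool" where
  "same_scale_meet P Q \<longleftrightarrow> ltile P = ltile Q \<and> snd P \<inter> snd Q \<noteq> {}"

lemma gram_sym:
  fixes \<phi> \<psi> :: "real \<Rightarrow> complex"
  shows "cmod (ip \<phi> \<psi>) = cmod (ip \<psi> \<phi>)"
proof -
  have "(ip \<psi> \<phi>) = (\<integral>x. cnj (\<phi> x * cnj (\<psi> x)) \<partial>lborel)" by (simp add: mult.commute)
  also have "\<dots> = cnj (ip \<phi> \<psi>)" by (rule Bochner_Integration.integral_cnj)
  finally show ?thesis by simp
qed

text \<open>At a point at most 16 tiles of the row overlap, 4 shapes in space times 4 in frequency.
  Hence \<open>144 = 2 * (9/2 * 16)\<close>, with the 2 from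
  \<open>packet_inner_bound\<close>.\<close>

lemma same_scale_row:
  assumes F: "F \<subseteq> all_tiles D D'" "finite F" and p: "\<And>P. P \<in> F \<Longrightarrow> packet B 4 P (\<phi> P)" and P: "P \<in> F"
  shows "(\<Sum>Q\<in>F. ltile Q * (if same_scale_meet P Q then cmod (ip (\<phi> P) (\<phi> Q)) else 0)) \<le> 144 * B\<^sup>2"
proof -
  define l where "l = ltile P"
  have l: "0 < l" using F P tile_length_pos[of P] by (auto simp: l_def)
  let ?G = "{Q \<in> F. same_scale_meet P Q}"
  have G: "?G \<subseteq> all_tiles D D'" "finite ?G" using F by auto
  have lG: "ltile Q = l" if "Q \<in> ?G" for Q using that by (simp add: same_scale_meet_def l_def)
  have "snd ` ?G \<subseteq> {\<omega> \<in> D'. ivl_center (snd P) \<in> \<omega> \<and> ivl_length \<omega> = 1 / l}"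
  proof
    fix \<omega> assume "\<omega> \<in> snd ` ?G"
    then obtain Q where Q: "Q \<in> F" "same_scale_meet P Q" "\<omega> = snd Q" by blast
    obtain x where x: "x \<in> snd P" "x \<in> snd Q" using Q by (auto simp: same_scale_meet_def)
    have t: "Q \<in> all_tiles D D'" "P \<in> all_tiles D D'" using F P Q by auto
    have len: "ivl_length (snd Q) = 1 / l" "ivl_length (snd P) = 1 / l"
      using t Q tile_freq_length by (auto simp: same_scale_meet_def l_def)
    have "Inf (snd P) = Inf (snd Q)" "Sup (snd P) = Sup (snd Q)"
      using grid_same_length[OF grid' tile_mem(2)[OF t(2)] tile_mem(2)[OF t(1)] x] len by auto
    then have "ivl_center (snd P) = ivl_center (snd Q)" by (simp add: ivl_center_def)
    then show "\<omega> \<in> {\<omega> \<in> D'. ivl_center (snd P) \<in> \<omega> \<and> ivl_length \<omega> = 1 / l}"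
      using Q t len tile_mem(2)[OF t(1)] ivl_center_mem[OF tile_proper(2)[OF t(1)]] by simp
  qed
  then have "card (snd ` ?G) \<le> 4"
    using le_trans[OF card_mono[OF grid_card_through_point(1)[OF grid']] grid_card_through_point(2)[OF grid']] by blast
  moreover have "{Q \<in> ?G. ltile Q = l} = ?G" using lG by blast
  ultimately have "card (snd ` {Q \<in> ?G. ltile Q = l}) \<le> 4" by simp
  note through = card_tiles_through[OF G this]
  have ov: "card {Q \<in> ?G. x \<in> fst Q} \<le> 16" for x
  proof -
    have "{Q \<in> ?G. x \<in> fst Q} = {Q \<in> ?G. ltile Q = l \<and> x \<in> fst Q}" using lG by blast
    then show ?thesis using through[of x] by simp
  qed
  have "(\<Sum>Q\<in>F. ltile Q * (if same_scale_meet P Q then cmod (ip (\<phi> P) (\<phi> Q)) else 0))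
    = (\<Sum>Q\<in>?G. ltile Q * cmod (ip (\<phi> P) (\<phi> Q)))"
    using F(2) by (simp add: sum.inter_filter if_distrib cong: if_cong)
  also have "\<dots> \<le> (\<Sum>Q\<in>?G. 2 * B\<^sup>2 * (1 / wt (ctile Q) l (ctile P) ^ 2))"
  proof (rule sum_mono)
    fix Q assume Q: "Q \<in> ?G"
    have t: "Q \<in> all_tiles D D'" "P \<in> all_tiles D D'" using F P Q by auto
    have "cmod (ip (\<phi> P) (\<phi> Q)) \<le> 2 * B\<^sup>2 / (ltile P * wtile P (ctile Q) ^ 2)"
      using p[OF P] p[of Q] Q tile_proper(1)[OF t(1)] tile_proper(1)[OF t(2)] lG[OF Q]
      by (intro packet_inner_bound) (auto simp: l_def)
    then have "l * cmod (ip (\<phi> P) (\<phi> Q)) \<le> l * (2 * B\<^sup>2 / (l * wt (ctile P) l (ctile Q) ^ 2))"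
      using l by (intro mult_left_mono) (auto simp: l_def)
    also have "\<dots> = 2 * B\<^sup>2 * (1 / wt (ctile Q) l (ctile P) ^ 2)"
      using l by (simp add: wt_def abs_minus_commute)
    finally show "ltile Q * cmod (ip (\<phi> P) (\<phi> Q)) \<le> 2 * B\<^sup>2 * (1 / wt (ctile Q) l (ctile P) ^ 2)"
      using lG[OF Q] by simp
  qed
  also have "\<dots> = 2 * B\<^sup>2 * (\<Sum>Q\<in>?G. 1 / wt (ctile Q) l (ctile P) ^ 2)" by (simp only: sum_distrib_left)
  also have "(\<Sum>Q\<in>?G. 1 / wt (ctile Q) l (ctile P) ^ 2) \<le> 9/2 * real 16"
    using G tile_proper lG l ov by (intro sum_wt_same_length) auto
  finally show ?thesis by (simp add: mult_left_mono)
qed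

lemma same_scale_gram:
  assumes F: "F \<subseteq> all_tiles D D'" "finite F" and p: "\<And>P. P \<in> F \<Longrightarrow> packet B 4 P (\<phi> P)"
  shows "(\<Sum>P\<in>F. \<Sum>Q\<in>F. ltile P * ltile Q * a P * a Q *
      (if same_scale_meet P Q then cmod (ip (\<phi> P) (\<phi> Q)) else 0)) \<le> 144 * B\<^sup>2 * (\<Sum>P\<in>F. ltile P * (a P)\<^sup>2)"
proof (rule Schur_sum_bound)
  show "(if same_scale_meet P Q then cmod (ip (\<phi> P) (\<phi> Q)) else 0) =
        (if same_scale_meet Q P then cmod (ip (\<phi> Q) (\<phi> P)) else 0)" for P Q
    using gram_sym[of "\<phi> P" "\<phi> Q"] by (auto simp: same_scale_meet_def)
qed (use F tile_length_pos same_scale_row[OF F p] in \<open>auto intro: less_imp_le\<close>)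

text \<open>In a lacunary family distinct frequency intervals are disjoint, so Fourier orthogonality
  leaves only pairs with one common frequency interval, hence of one scale.\<close>

lemma lacunary_gram:
  assumes F: "F \<subseteq> all_tiles D D'" "finite F" and p: "\<And>P. P \<in> F \<Longrightarrow> packet B 4 P (\<phi> P)"
    and lac: "disjoint (snd ` F)"
  shows "(\<Sum>P\<in>F. \<Sum>Q\<in>F. ltile P * ltile Q * a P * a Q * cmod (ip (\<phi> P) (\<phi> Q)))
    \<le> 144 * B\<^sup>2 * (\<Sum>P\<in>F. ltile P * (a P)\<^sup>2)"
proof -
  have "cmod (ip (\<phi> P) (\<phi> Q)) =
     (if same_scale_meet P Q then cmod (ip (\<phi> P) (\<phi> Q)) else 0)" if PQ: "P \<in> F" "Q \<in> F" for P Q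
  proof (cases "snd P = snd Q")
    case True
    have t: "P \<in> all_tiles D D'" "Q \<in> all_tiles D D'" using PQ F by auto
    have "1 / ltile P = 1 / ltile Q" using True tile_freq_length[OF t(1)] tile_freq_length[OF t(2)] by simp
    then have "ltile P = ltile Q" using tile_length_pos[OF t(1)] tile_length_pos[OF t(2)] by (simp add: field_simps)
    moreover have "snd P \<noteq> {}" using proper_interval_bdd(3)[OF tile_proper(2)[OF t(1)]] .
    ultimately show ?thesis using True by (simp add: same_scale_meet_def)
  next
    case False
    then have "snd P \<inter> snd Q = {}" using lac PQ by (auto simp: disjoint_def)
    moreover have "proper_interval (fst P)" "proper_interval (fst Q)" using PQ F tile_proper(1) by blast+
    ultimately show ?thesis using packet_orthogonal[OF p[OF PQ(1)] _ _ p[OF PQ(2)]] by simp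
  qed
  then have "(\<Sum>P\<in>F. \<Sum>Q\<in>F. ltile P * ltile Q * a P * a Q * cmod (ip (\<phi> P) (\<phi> Q)))
    = (\<Sum>P\<in>F. \<Sum>Q\<in>F. ltile P * ltile Q * a P * a Q *
      (if same_scale_meet P Q then cmod (ip (\<phi> P) (\<phi> Q)) else 0))"
    by (intro sum.cong refl arg_cong2[where f = "(*)"]) auto
  then show ?thesis using same_scale_gram[OF F p, of a] by simp
qed

end

section \<open>The local L1 estimate for lacunary trees\<close>

text \<open>The first summand bounds the smoothing error: 256 bounds the coefficients,
  \<open>512 * (2^\<kappa> + 1)\<close> is the Lipschitz constant of a packet,
  \<open>324 * 2^\<kappa>\<close> sums over tiles and 16 integrates \<open>h\<close> against the
  weight of the top interval. In the second, \<open>36864 = 144 * 16^2\<close> is the Gram constant.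
  The outer 2 comes from absorbing half of the left side.\<close>

definition tree_const :: "nat \<Rightarrow> real" where
  "tree_const \<kappa> = 2 * (256 * (512 * (2 ^ \<kappa> + 1)) * (324 * 2 ^ \<kappa>) * 16 + 288 * 36864)"

context dual_grid_pair
begin

lemma tile_length_ratio:
  assumes "P \<in> all_tiles D D'" "Q \<in> all_tiles D D'" "ltile P < ltile Q"
  shows "2 * ltile P \<le> ltile Q"
  using grid_length_ratio[OF grid tile_mem(1) tile_mem(1)] assms by blast

lemma freq_center_dist:
  assumes "P \<in> all_tiles D D'" "\<xi> \<in> dyadic_ancestor D' \<kappa> (snd P)"
  shows "\<bar>ivl_center (snd P) - \<xi>\<bar> \<le> 2 ^ \<kappa> / ltile P"
proof -
  note anc = grid_ancestor[OF grid' tile_mem(2)[OF assms(1)], of \<kappa>]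
  have A: "proper_interval (dyadic_ancestor D' \<kappa> (snd P))" by (rule grid_proper[OF grid' anc(1)])
  have c: "ivl_center (snd P) \<in> dyadic_ancestor D' \<kappa> (snd P)"
    using anc(2) ivl_center_mem[OF tile_proper(2)[OF assms(1)]] by blast
  have "Sup (dyadic_ancestor D' \<kappa> (snd P)) - Inf (dyadic_ancestor D' \<kappa> (snd P)) = 2 ^ \<kappa> / ltile P"
    using anc(3) tile_freq_length[OF assms(1)] by (simp add: ivl_length_def)
  then show ?thesis
    using proper_interval_bounds[OF A c] proper_interval_bounds[OF A assms(2)] by linarith
qed

text \<open>The synthesis \<open>\<Phi>\<close> of the coefficients of \<open>h\<close>, demodulated by the top frequency, is compared
  at \<open>y\<close> with its average at scale \<open>r y\<close>, the distance from \<open>y\<close> to the tree: the error is summable over the tiles,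
  and by Tonelli the average turns \<open>h\<close> into a function bounded by a multiple of \<open>K\<close>, to which the
  \<open>L\<^sup>2\<close> bound of \<open>\<Phi>\<close> applies.\<close>

lemma tree_L1_estimate:
  fixes h :: "real \<Rightarrow> complex"
  assumes V: "V \<subseteq> all_tiles D D'" "finite V" and lac: "disjoint (snd ` V)"
    and I0: "I0 \<in> D" and sub: "\<And>P. P \<in> V \<Longrightarrow> fst P \<subseteq> I0"
    and \<xi>: "\<And>P. P \<in> V \<Longrightarrow> \<xi> \<in> dyadic_ancestor D' \<kappa> (snd P)"
    and \<phi>: "\<And>P. P \<in> V \<Longrightarrow> \<phi> P \<in> Phi M P" and M: "8 \<le> M"
    and hint: "integrable lborel h" and K: "0 < K"
    and H: "\<And>P I. P \<in> V \<Longrightarrow> proper_interval I \<Longrightarrow> fst P \<subseteq> I \<Longrightarrow>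
      (\<integral>\<^sup>+x. ennreal (cmod (h x)) * indicator I x \<partial>lborel) \<le> ennreal (K * ivl_length I)"
  shows "(\<Sum>P\<in>V. ltile P * (cmod (ip h (\<phi> P)))\<^sup>2) \<le> tree_const \<kappa> * K\<^sup>2 * ivl_length I0"
proof (cases "V = {}")
  case True
  then show ?thesis using proper_interval_length_pos[OF grid_proper[OF grid I0]] by (simp add: tree_const_def)
next
  case False
  define A :: real where "A = 2 ^ \<kappa>"
  define L c0 where "L = ivl_length I0" and "c0 = ivl_center I0"
  define \<alpha> where "\<alpha> P = (ip h (\<phi> P))" for P
  define S where "S = (\<Sum>P\<in>V. ltile P * (cmod (\<alpha> P))\<^sup>2)"
  define \<Phi> where "\<Phi> x = (\<Sum>P\<in>V. complex_of_real (ltile P) * \<alpha> P * \<phi> P x)" for x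
  \<comment> \<open>This scale has two virtues. It is 1-Lipschitz, hence comparable at neighbouring
    points, and the interval of radius \<open>r y\<close> around \<open>y\<close> contains the
    spatial interval of some tile of \<open>V\<close>, so that averages of \<open>h\<close> over it
    are bounded by \<open>K\<close>.\<close>
  define r where "r y = Min ((\<lambda>P. ltile P + \<bar>y - ctile P\<bar>) ` V)" for y
  define c2 where "c2 = 256 * K * (512 * (A + 1)) * (324 * A)"
  let ?w = "\<lambda>P. wtile P"
  have A1: "1 \<le> A" by (simp add: A_def)
  have c20: "0 \<le> c2" using K A1 by (simp add: c2_def)
  have pI0: "proper_interval I0" by (rule grid_proper[OF grid I0])
  have L: "0 < L" using proper_interval_length_pos[OF pI0] by (simp add: L_def)
  have t: "P \<in> all_tiles D D'" if "P \<in> V" for P using V that by auto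
  have pI: "proper_interval (fst P)" if "P \<in> V" for P using tile_proper(1)[OF t[OF that]] .
  have lpos: "0 < ltile P" if "P \<in> V" for P using tile_length_pos[OF t[OF that]] .
  have wpos: "0 < ?w P y" "1 \<le> ?w P y" if "P \<in> V" for P y using lpos[OF that] by (auto simp: wt_pos wt_ge_1)
  have lL: "ltile P \<le> L" "\<bar>ctile P - c0\<bar> \<le> L / 2" if "P \<in> V" for P
    using proper_interval_subset[OF pI[OF that] pI0 sub[OF that]] by (auto simp: L_def c0_def)
  have pk: "packet 16 8 P (\<phi> P)" if "P \<in> V" for P by (rule Phi_packet[OF \<phi>[OF that] M pI[OF that]])
  have pk4: "packet 16 4 P (\<phi> P)" if "P \<in> V" for P by (rule packet_mono[OF pk[OF that] _ pI[OF that]]) simp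
  have [measurable]: "h \<in> borel_measurable borel" using hint by auto
  have \<phi>m: "\<phi> P \<in> borel_measurable borel" if "P \<in> V" for P using packet_measurable[OF pk[OF that]] .
  have \<Phi>m [measurable]: "\<Phi> \<in> borel_measurable borel" unfolding \<Phi>_def[abs_def] using \<phi>m by measurable
  have Hc: "(\<integral>\<^sup>+x. ennreal (cmod (h x)) * indicator {c - R..c + R} x \<partial>lborel) \<le> ennreal (K * (2 * R))"
    if "P \<in> V" "fst P \<subseteq> {c - R..c + R}" "0 < R" for P c R
    using H[OF that(1) proper_interval_cball[OF that(3)] that(2)] by (simp add: ivl_length_cball[OF that(3)])
  have HP: "(\<integral>\<^sup>+x. ennreal (cmod (h x)) * ennreal (1 / ?w P x ^ 2) \<partial>lborel) \<le> ennreal (16 * K * ltile P)" if "P \<in> V" for P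
  proof (rule nn_integral_wt_le_average)
    fix R assume R: "ltile P \<le> R"
    show "(\<integral>\<^sup>+x. ennreal (cmod (h x)) * indicator {ctile P - R..ctile P + R} x \<partial>lborel) \<le> ennreal (K * (2 * R))"
      using R lpos[OF that] by (intro Hc[OF that] proper_interval_subset_cball pI[OF that]) auto
  qed (use lpos[OF that] K in auto)
  obtain P0 where P0: "P0 \<in> V" using False by auto
  \<comment> \<open>Intervals that contain \<open>I0\<close> contain a tile of \<open>V\<close>, so
    the averages at the scale of the top interval are controlled as well.\<close>
  have H0: "(\<integral>\<^sup>+x. ennreal (cmod (h x)) * ennreal (1 / wt c0 L x ^ 2) \<partial>lborel) \<le> ennreal (16 * K * L)"
  proof (rule nn_integral_wt_le_average)
    fix R assume R: "L \<le> R"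
    have "I0 \<subseteq> {c0 - R..c0 + R}"
      using R L by (intro proper_interval_subset_cball pI0) (auto simp: c0_def L_def)
    then show "(\<integral>\<^sup>+x. ennreal (cmod (h x)) * indicator {c0 - R..c0 + R} x \<partial>lborel) \<le> ennreal (K * (2 * R))"
      using R L sub[OF P0] by (intro Hc[OF P0]) auto
  qed (use L K in auto)

  have hphi: "integrable lborel (\<lambda>x. h x * cnj (\<phi> P x))" if "P \<in> V" for P
    using packet_le_const[OF pk[OF that] pI[OF that]] \<phi>m[OF that]
    by (intro integrable_mult_bounded[OF hint, where B = "16 / ltile P"]) auto
  have \<alpha>_le: "cmod (\<alpha> P) \<le> 256 * K" if "P \<in> V" for P
  proof -
    have "ennreal (cmod (\<alpha> P)) \<le> (\<integral>\<^sup>+x. ennreal (cmod (h x * cnj (\<phi> P x))) \<partial>lborel)"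
      unfolding \<alpha>_def by (rule integral_norm_bound_ennreal[OF hphi[OF that]])
    also have "\<dots> \<le> (\<integral>\<^sup>+x. ennreal (16 / ltile P) * (ennreal (cmod (h x)) * ennreal (1 / ?w P x ^ 2)) \<partial>lborel)"
    proof (rule nn_integral_mono)
      fix x
      have "cmod (h x * cnj (\<phi> P x)) \<le> cmod (h x) * (16 / ltile P * (1 / ?w P x ^ 2))"
        unfolding norm_mult complex_mod_cnj
        using packet_le_wt2[OF pk[OF that] pI[OF that], of x] by (intro mult_left_mono) auto
      then have "ennreal (cmod (h x * cnj (\<phi> P x))) \<le> ennreal (16 / ltile P * (cmod (h x) * (1 / ?w P x ^ 2)))"
        by (intro ennreal_leI) (simp add: mult_ac)
      then show "ennreal (cmod (h x * cnj (\<phi> P x))) \<le> ennreal (16 / ltile P) * (ennreal (cmod (h x)) * ennreal (1 / ?w P x ^ 2))"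
        using lpos[OF that] wpos[OF that] by (simp add: ennreal_mult[symmetric] less_imp_le)
    qed
    also have "\<dots> = ennreal (16 / ltile P) * (\<integral>\<^sup>+x. ennreal (cmod (h x)) * ennreal (1 / ?w P x ^ 2) \<partial>lborel)"
      by (rule nn_integral_cmult) measurable
    also have "\<dots> \<le> ennreal (16 / ltile P) * ennreal (16 * K * ltile P)" by (intro mult_left_mono HP[OF that]) simp
    also have "\<dots> = ennreal (256 * K)" using lpos[OF that] K by (simp add: ennreal_mult[symmetric])
    finally show ?thesis using K by (simp add: ennreal_le_iff)
  qed

  have r_le: "r y \<le> ltile P + \<bar>y - ctile P\<bar>" if "P \<in> V" for P y
    unfolding r_def using V that by (intro Min_le) auto
  have r_ex: "\<exists>P\<in>V. r y = ltile P + \<bar>y - ctile P\<bar>" for y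
  proof -
    have "r y \<in> (\<lambda>P. ltile P + \<bar>y - ctile P\<bar>) ` V" unfolding r_def using V False by (intro Min_in) auto
    then show ?thesis by blast
  qed
  have r_pos: "0 < r y" for y using r_ex[of y] lpos by force
  have r_wt: "r y \<le> ltile P * ?w P y" if "P \<in> V" for P y
    using r_le[OF that, of y] lpos[OF that] by (simp add: wt_def distrib_left)
  have r_Lip: "r x \<le> r y + \<bar>x - y\<bar>" for x y
  proof -
    obtain P where P: "P \<in> V" "r y = ltile P + \<bar>y - ctile P\<bar>" using r_ex by blast
    then show ?thesis using r_le[OF P(1), of x] by linarith
  qed
  have rm [measurable]: "r \<in> borel_measurable borel"
    unfolding r_def[abs_def] using V by (intro borel_measurable_Min) measurable

  \<comment> \<open>The error committed by moving one demodulated packet over a distance below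
    \<open>r y / 10\<close>, estimated by \<open>r y / 8\<close>; thus
    \<open>512 = 4096 / 8\<close>. Far from \<open>I0\<close> the scale \<open>r y\<close> exceeds
    \<open>L / 2\<close>, and the same expression bounds the packet itself.\<close>
  define e where "e P y = 512 * (A + 1) * r y / ((ltile P)\<^sup>2 * ?w P y ^ 8)" for P y
  have e_near: "cmod (cis (- (\<xi> * y)) * \<phi> P y - cis (- (\<xi> * x)) * \<phi> P x) \<le> e P y"
    if P: "P \<in> V" and xy: "\<bar>x - y\<bar> < r y / 10" for P x y
  proof -
    have "\<bar>x - y\<bar> \<le> ltile P * ?w P y / 2" using xy r_wt[OF P, of y] r_pos[of y] by linarith
    then have "cmod (cis (- (\<xi> * x)) * \<phi> P x - cis (- (\<xi> * y)) * \<phi> P y) \<le> 4096 * (A + 1) / ((ltile P)\<^sup>2 * ?w P y ^ 8) * \<bar>x - y\<bar>"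
      using freq_center_dist[OF t[OF P] \<xi>[OF P]] by (intro Phi_modulated_Lipschitz[OF \<phi>[OF P] M pI[OF P]]) (auto simp: A_def)
    also have "\<dots> \<le> 4096 * (A + 1) / ((ltile P)\<^sup>2 * ?w P y ^ 8) * (r y / 8)"
      using xy r_pos[of y] A1 wpos[OF P, of y] by (intro mult_left_mono) auto
    also have "\<dots> = e P y"
    proof -
      have "4096 * a / X * (b / 8) = 512 * a * b / X" for a b X :: real by simp
      then show ?thesis unfolding e_def by blast
    qed
    finally show ?thesis by (simp add: norm_minus_commute)
  qed
  have e_far: "cmod (\<phi> P y) \<le> e P y" if P: "P \<in> V" and y: "L < \<bar>y - c0\<bar>" for P y
  proof -
    obtain Q where Q: "Q \<in> V" "r y = ltile Q + \<bar>y - ctile Q\<bar>" using r_ex by blast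
    have "L / 2 \<le> r y" using y lL(2)[OF Q(1)] Q(2) lpos[OF Q(1)] by linarith
    then have rl: "ltile P \<le> 2 * r y" using lL(1)[OF P] by linarith
    have "cmod (\<phi> P y) \<le> 16 / (ltile P * ?w P y ^ 8)" using packet_bound[OF pk[OF P]] .
    also have "\<dots> = 16 * ltile P / ((ltile P)\<^sup>2 * ?w P y ^ 8)" using lpos[OF P] by (simp add: power2_eq_square)
    also have "\<dots> \<le> 512 * (A + 1) * r y / ((ltile P)\<^sup>2 * ?w P y ^ 8)"
    proof (rule divide_right_mono)
      have "16 * ltile P \<le> 32 * r y" using rl by simp
      also have "\<dots> \<le> 512 * (A + 1) * r y" using A1 r_pos[of y] by (intro mult_right_mono) auto
      finally show "16 * ltile P \<le> 512 * (A + 1) * r y" .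
    qed (use wpos[OF P, of y] in auto)
    finally show ?thesis by (simp add: e_def)
  qed
  have e_sum: "(\<Sum>P\<in>V. ltile P * cmod (\<alpha> P) * e P y) \<le> c2 / wt c0 L y ^ 2" for y
  proof -
    define v where "v P = 1 / ?w P y ^ 2" for P
    have "(\<Sum>P\<in>V. v P * min (r y / ltile P) (ltile P / r y)) \<le> 4 * (36 * A)"
    proof (rule sum_over_scales)
      fix l
      let ?G = "{P \<in> V. ltile P = l}"
      have pos: "(\<Sum>P\<in>?G. 1 / wt (ctile P) l y ^ 2) \<le> 9/2 * real (8 * 2 ^ \<kappa>)" if "0 < l"
      proof (rule sum_wt_same_length)
        show "card {P \<in> ?G. x \<in> fst P} \<le> 8 * 2 ^ \<kappa>" for x
          using lacunary_overlap[OF V lac \<xi>, of l x] by (simp add: conj_ac)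
      qed (use that V pI in auto)
      have neg: "(\<Sum>P\<in>?G. 1 / wt (ctile P) l y ^ 2) = 0" if "\<not> 0 < l"
      proof -
        have "?G = {}" using that lpos by blast
        then show ?thesis by (simp only: sum.empty)
      qed
      have "(\<Sum>P\<in>?G. 1 / wt (ctile P) l y ^ 2) \<le> 9/2 * real (8 * 2 ^ \<kappa>)"
      proof (cases "0 < l")
        case False
        show ?thesis unfolding neg[OF False] by simp
      qed (rule pos)
      moreover have "(\<Sum>P\<in>?G. v P) = (\<Sum>P\<in>?G. 1 / wt (ctile P) l y ^ 2)"
        by (intro sum.cong refl) (simp add: v_def)
      ultimately show "(\<Sum>P | P \<in> V \<and> ltile P = l. v P) \<le> 36 * A" by (simp add: A_def)
    next
      show "2 * ltile P \<le> ltile Q" if "P \<in> V" "Q \<in> V" "ltile P < ltile Q" for P Q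
        using tile_length_ratio that t by blast
    qed (use V lpos r_pos in \<open>auto simp: v_def\<close>)
    moreover have "ltile P * cmod (\<alpha> P) * e P y \<le> 256 * K * (512 * (A + 1)) * (9/4 / wt c0 L y ^ 2) * (v P * min (r y / ltile P) (ltile P / r y))"
      if P: "P \<in> V" for P
    proof -
      \<comment> \<open>Of the eight powers of the weight in \<open>e\<close>, two give decay away
        from \<open>I0\<close> and two go into \<open>v\<close>, for summing over the tiles of one
        scale. The other four dominate both 1 and \<open>q^2\<close>, which yields the geometric
        factor \<open>min q (1 / q)\<close>.\<close>
      define q where "q = r y / ltile P"
      have q: "0 < q" "q \<le> ?w P y" using r_pos[of y] lpos[OF P] r_wt[OF P, of y] by (auto simp: q_def divide_le_eq mult.commute)
      note w = wpos[OF P, of y]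
      have "q / ?w P y ^ 4 \<le> min q (1 / q)"
      proof (rule min.boundedI)
        have w4: "1 \<le> ?w P y ^ 4" using w by simp
        then show "q / ?w P y ^ 4 \<le> q" using q w4 divide_left_mono[of 1 "?w P y ^ 4" q] by simp
        have "q * q \<le> ?w P y * ?w P y" using q w by (intro mult_mono) auto
        also have "\<dots> \<le> ?w P y ^ 4" using w power_increasing[of 2 4 "?w P y"] by (simp add: power2_eq_square)
        finally show "q / ?w P y ^ 4 \<le> 1 / q" using q w by (simp add: field_simps)
      qed
      moreover have "1 / ?w P y ^ 2 \<le> 9/4 / wt c0 L y ^ 2"
      proof -
        have "wt c0 L y ^ 2 \<le> (3/2 * ?w P y)\<^sup>2"
          using wt_sub_interval[OF lpos[OF P] lL[OF P], of y] wt_pos[OF L, of c0 y] by (intro power_mono) auto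
        then show ?thesis using w wt_pos[OF L, of c0 y] by (simp add: field_simps power2_eq_square)
      qed
      ultimately have "(1 / ?w P y ^ 2) * (v P * (q / ?w P y ^ 4)) \<le> (9/4 / wt c0 L y ^ 2) * (v P * min q (1 / q))"
        using q w by (intro mult_mono) (auto simp: v_def)
      moreover have "ltile P * e P y = 512 * (A + 1) * ((1 / ?w P y ^ 2) * (v P * (q / ?w P y ^ 4)))"
      proof -
        have W8: "W ^ 8 = W\<^sup>2 * (W\<^sup>2 * W ^ 4)" for W :: real by (simp add: power_add[symmetric])
        have "l * (a * b / (l\<^sup>2 * (X * (X * Y)))) = a * ((1 / X) * ((1 / X) * (b / l / Y)))" if "0 < l" for l a b X Y :: real
          using that by (simp add: power2_eq_square)
        from this[OF lpos[OF P]] show ?thesis unfolding e_def v_def q_def W8 by blast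
      qed
      ultimately have le: "ltile P * e P y \<le> 512 * (A + 1) * ((9/4 / wt c0 L y ^ 2) * (v P * min q (1 / q)))"
        using A1 by (simp del: times_divide_eq_left times_divide_eq_right mult_le_cancel_left)
      have "cmod (\<alpha> P) * (ltile P * e P y) \<le> (256 * K) * (512 * (A + 1) * ((9/4 / wt c0 L y ^ 2) * (v P * min q (1 / q))))"
      proof (rule mult_mono[OF \<alpha>_le[OF P] le])
        show "0 \<le> ltile P * e P y"
          using A1 lpos[OF P] w(1) r_pos[of y] unfolding e_def
          by (intro mult_nonneg_nonneg divide_nonneg_nonneg zero_le_power) (auto simp: less_imp_le)
      qed (use K in simp)
      moreover have q': "r y / ltile P = q" "ltile P / r y = 1 / q" by (simp_all add: q_def)
      moreover have "ltile P * cmod (\<alpha> P) * e P y = cmod (\<alpha> P) * (ltile P * e P y)" by (simp only: mult_ac)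
      ultimately show ?thesis unfolding q' by (simp only: mult.assoc)
    qed
    ultimately have "(\<Sum>P\<in>V. ltile P * cmod (\<alpha> P) * e P y) \<le> 256 * K * (512 * (A + 1)) * (9/4 / wt c0 L y ^ 2) * (4 * (36 * A))"
    proof -
      assume tot: "(\<Sum>P\<in>V. v P * min (r y / ltile P) (ltile P / r y)) \<le> 4 * (36 * A)"
        and each: "\<And>P. P \<in> V \<Longrightarrow> ltile P * cmod (\<alpha> P) * e P y \<le> 256 * K * (512 * (A + 1)) * (9/4 / wt c0 L y ^ 2) * (v P * min (r y / ltile P) (ltile P / r y))"
      define q where "q = 256 * K * (512 * (A + 1)) * (9/4 / wt c0 L y ^ 2)"
      have q: "0 \<le> q" using K A1 by (simp add: q_def)
      have "(\<Sum>P\<in>V. ltile P * cmod (\<alpha> P) * e P y) \<le> (\<Sum>P\<in>V. q * (v P * min (r y / ltile P) (ltile P / r y)))"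
        unfolding q_def by (intro sum_mono each)
      also have "\<dots> = q * (\<Sum>P\<in>V. v P * min (r y / ltile P) (ltile P / r y))" by (rule sum_distrib_left[symmetric])
      also have "\<dots> \<le> q * (4 * (36 * A))" by (intro mult_left_mono tot q)
      finally show ?thesis by (simp only: q_def)
    qed
    also have "\<dots> = c2 / wt c0 L y ^ 2" by (simp add: c2_def)
    finally show ?thesis .
  qed

  have \<Phi>_far: "cmod (\<Phi> y) \<le> c2 / wt c0 L y ^ 2" if "L < \<bar>y - c0\<bar>" for y
  proof -
    have "cmod (\<Phi> y) \<le> (\<Sum>P\<in>V. ltile P * cmod (\<alpha> P) * e P y)"
      unfolding \<Phi>_def
    proof (rule sum_norm_le)
      fix P assume P: "P \<in> V"
      show "cmod (complex_of_real (ltile P) * \<alpha> P * \<phi> P y) \<le> ltile P * cmod (\<alpha> P) * e P y"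
        unfolding norm_mult norm_of_real using e_far[OF P that] lpos[OF P] by (intro mult_mono) auto
    qed
    then show ?thesis using e_sum[of y] by linarith
  qed
  have \<Phi>_near: "cmod (\<Phi> y) \<le> c2 / wt c0 L y ^ 2 + cmod (\<Phi> x)" if "\<bar>x - y\<bar> < r y / 10" for x y
  proof -
    have "cis (- (\<xi> * y)) * \<Phi> y - cis (- (\<xi> * x)) * \<Phi> x =
      (\<Sum>P\<in>V. complex_of_real (ltile P) * \<alpha> P * (cis (- (\<xi> * y)) * \<phi> P y - cis (- (\<xi> * x)) * \<phi> P x))"
      unfolding \<Phi>_def sum_distrib_left sum_subtractf[symmetric] by (simp add: algebra_simps)
    also have "cmod \<dots> \<le> (\<Sum>P\<in>V. ltile P * cmod (\<alpha> P) * e P y)"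
    proof (rule sum_norm_le)
      fix P assume P: "P \<in> V"
      show "cmod (complex_of_real (ltile P) * \<alpha> P * (cis (- (\<xi> * y)) * \<phi> P y - cis (- (\<xi> * x)) * \<phi> P x)) \<le> ltile P * cmod (\<alpha> P) * e P y"
        unfolding norm_mult norm_of_real using e_near[OF P that] lpos[OF P] by (intro mult_mono) auto
    qed
    finally have "cmod (cis (- (\<xi> * y)) * \<Phi> y - cis (- (\<xi> * x)) * \<Phi> x) \<le> c2 / wt c0 L y ^ 2"
      using e_sum[of y] by linarith
    moreover have "cmod (cis (- (\<xi> * y)) * \<Phi> y) \<le> cmod (cis (- (\<xi> * y)) * \<Phi> y - cis (- (\<xi> * x)) * \<Phi> x) + cmod (cis (- (\<xi> * x)) * \<Phi> x)"
      by (metis norm_triangle_sub add.commute)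
    ultimately show ?thesis by (simp add: norm_mult)
  qed

  define near where "near = {y. \<bar>y - c0\<bar> \<le> L}"
  have [measurable]: "near \<in> sets borel" unfolding near_def by measurable
  \<comment> \<open>An averaging kernel: \<open>{z. \<bar>z - y\<bar> < r y / 10}\<close> has
    measure \<open>r y / 5\<close>, so it has mass one for \<open>y\<close> in \<open>near\<close>.
    Elsewhere it is zero, because there the error bound alone controls \<Phi>.\<close>
  define k where "k y x = ennreal (5 / r y) * indicator near y * indicator {z. \<bar>z - y\<bar> < r y / 10} x" for y x
  have km: "case_prod k \<in> borel_measurable (borel \<Otimes>\<^sub>M borel)"
  proof -
    have "case_prod k = (\<lambda>p. ennreal (5 / r (fst p)) * indicator near (fst p) * indicator {p. \<bar>snd p - fst p\<bar> < r (fst p) / 10} p)"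
      by (auto simp: k_def fun_eq_iff indicator_def)
    also have "\<dots> \<in> borel_measurable (borel \<Otimes>\<^sub>M borel)" by measurable
    finally show ?thesis .
  qed
  have \<Phi>_pt: "ennreal (cmod (\<Phi> y)) \<le> ennreal (c2 / wt c0 L y ^ 2) + (\<integral>\<^sup>+x. k y x * ennreal (cmod (\<Phi> x)) \<partial>lborel)" for y
  proof (cases "y \<in> near")
    case False
    then have "cmod (\<Phi> y) \<le> c2 / wt c0 L y ^ 2" by (intro \<Phi>_far) (auto simp: near_def)
    then have "ennreal (cmod (\<Phi> y)) \<le> ennreal (c2 / wt c0 L y ^ 2)" by (rule ennreal_leI)
    then show ?thesis by (rule order_trans) simp
  next
    case True
    have bl: "{z. \<bar>z - y\<bar> < r y / 10} = {y - r y / 10 <..< y + r y / 10}"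
      unfolding set_eq_iff mem_Collect_eq greaterThanLessThan_iff abs_less_iff by (intro allI iffI conjI) linarith+
    have one: "(\<integral>\<^sup>+x. k y x \<partial>lborel) = 1"
    proof -
      have "(\<integral>\<^sup>+x. k y x \<partial>lborel) = ennreal (5 / r y) * emeasure lborel {y - r y / 10 <..< y + r y / 10}"
        unfolding k_def bl using True by (subst nn_integral_cmult_indicator) auto
      also have "\<dots> = ennreal (5 / r y) * ennreal (r y / 5)" using r_pos[of y] by simp
      also have "\<dots> = 1" using r_pos[of y] by (simp add: ennreal_mult[symmetric])
      finally show ?thesis .
    qed
    have [measurable]: "k y \<in> borel_measurable borel" unfolding k_def[abs_def] by measurable
    have "ennreal (cmod (\<Phi> y)) = (\<integral>\<^sup>+x. k y x * ennreal (cmod (\<Phi> y)) \<partial>lborel)"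
      by (subst nn_integral_multc) (auto simp: one)
    also have "\<dots> \<le> (\<integral>\<^sup>+x. k y x * ennreal (c2 / wt c0 L y ^ 2) + k y x * ennreal (cmod (\<Phi> x)) \<partial>lborel)"
    proof (rule nn_integral_mono)
      fix x
      show "k y x * ennreal (cmod (\<Phi> y)) \<le> k y x * ennreal (c2 / wt c0 L y ^ 2) + k y x * ennreal (cmod (\<Phi> x))"
      proof (cases "\<bar>x - y\<bar> < r y / 10")
        case True
        have "ennreal (cmod (\<Phi> y)) \<le> ennreal (c2 / wt c0 L y ^ 2) + ennreal (cmod (\<Phi> x))"
        proof -
          have "0 \<le> c2 / wt c0 L y ^ 2" using c20 by simp
          then have "ennreal (c2 / wt c0 L y ^ 2 + cmod (\<Phi> x)) = ennreal (c2 / wt c0 L y ^ 2) + ennreal (cmod (\<Phi> x))"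
            by (intro ennreal_plus) auto
          then show ?thesis using ennreal_leI[OF \<Phi>_near[OF True]] by (simp only:)
        qed
        then show ?thesis by (simp add: distrib_left[symmetric] mult_left_mono)
      qed (simp add: k_def)
    qed
    also have "\<dots> = ennreal (c2 / wt c0 L y ^ 2) + (\<integral>\<^sup>+x. k y x * ennreal (cmod (\<Phi> x)) \<partial>lborel)"
      by (subst nn_integral_add) (auto simp: nn_integral_multc one)
    finally show ?thesis .
  qed
  have k_avg: "(\<integral>\<^sup>+y. ennreal (cmod (h y)) * k y x \<partial>lborel) \<le> ennreal (12 * K) * indicator {c0 - 2 * L..c0 + 2 * L} x" for x
  proof (cases "x \<in> {c0 - 2 * L..c0 + 2 * L}")
    case False
    have "k y x = 0" for y
    proof (rule ccontr)
      assume "k y x \<noteq> 0"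
      then have y: "\<bar>y - c0\<bar> \<le> L" "\<bar>x - y\<bar> < r y / 10" by (auto simp: k_def near_def indicator_def split: if_splits)
      have "r y \<le> L + (L + L / 2)" using r_le[OF P0, of y] lL[OF P0] y(1) by linarith
      then have "c0 - 2 * L \<le> x" "x \<le> c0 + 2 * L" using y L by linarith+
      then show False using False by simp
    qed
    then show ?thesis by simp
  next
    case True
    obtain P where P: "P \<in> V" "r x = ltile P + \<bar>x - ctile P\<bar>" using r_ex by blast
    have "(\<integral>\<^sup>+y. ennreal (cmod (h y)) * k y x \<partial>lborel) \<le>
      (\<integral>\<^sup>+y. ennreal (6 / r x) * (ennreal (cmod (h y)) * indicator {x - r x..x + r x} y) \<partial>lborel)"
    proof (rule nn_integral_mono)
      fix y
      show "ennreal (cmod (h y)) * k y x \<le> ennreal (6 / r x) * (ennreal (cmod (h y)) * indicator {x - r x..x + r x} y)"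
      proof (cases "\<bar>x - y\<bar> < r y / 10")
        case True
        have "r y \<le> r x + \<bar>x - y\<bar>" using r_Lip[of y x] by (simp add: abs_minus_commute)
        then have "x - r x \<le> y" "y \<le> x + r x" using True r_pos[of x] r_pos[of y] by linarith+
        then have mem: "y \<in> {x - r x..x + r x}" by simp
        \<comment> \<open>Since \<open>r\<close> is 1-Lipschitz, \<open>r x <= 11/10 * r y\<close>.
          Replacing 5 by 6 absorbs the change of scale from \<open>y\<close> to \<open>x\<close>, so
          that \<open>h\<close> can be averaged at a scale depending on \<open>x\<close>
          only.\<close>
        have "r x \<le> r y + r y / 10" using r_Lip[of x y] True by linarith
        then have "5 / r y \<le> 6 / r x" using r_pos[of x] r_pos[of y] by (simp add: field_simps)
        then have "k y x \<le> ennreal (6 / r x)" by (auto simp: k_def indicator_def intro: ennreal_leI)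
        then show ?thesis using mem by (simp add: mult.commute[of "ennreal (cmod (h y))"] mult_right_mono)
      qed (simp add: k_def)
    qed
    also have "\<dots> = ennreal (6 / r x) * (\<integral>\<^sup>+y. ennreal (cmod (h y)) * indicator {x - r x..x + r x} y \<partial>lborel)"
      by (rule nn_integral_cmult) measurable
    also have "\<dots> \<le> ennreal (6 / r x) * ennreal (K * (2 * r x))"
      using P lpos[OF P(1)] r_pos[of x]
      by (intro mult_left_mono Hc[OF P(1)] proper_interval_subset_cball pI) (auto simp: abs_minus_commute)
    also have "\<dots> = ennreal (12 * K)" using r_pos[of x] K by (simp add: ennreal_mult[symmetric])
    finally show ?thesis using True by simp
  qed

  \<comment> \<open>The constant of \<open>lacunary_gram\<close> for packets with
    \<open>B = 16\<close>.\<close>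
  define CB :: real where "CB = 36864"
  note syn = synthesis_bounds[where F = V and w = ltile and \<phi> = \<phi> and g = h and \<alpha> = \<alpha> and C = CB, folded \<Phi>_def S_def]
  have gram: "(\<Sum>P\<in>V. \<Sum>Q\<in>V. ltile P * ltile Q * cmod (\<alpha> P) * cmod (\<alpha> Q) * cmod (ip (\<phi> P) (\<phi> Q))) \<le> CB * S"
    using lacunary_gram[OF V pk4 lac, of "\<lambda>P. cmod (\<alpha> P)"] by (simp add: S_def CB_def)
  have ii: "integrable lborel (\<lambda>x. \<phi> P x * cnj (\<phi> Q x))" if "P \<in> V" "Q \<in> V" for P Q
    using packet_mult_integrable[OF pk[OF that(1)] pI[OF that(1)] _ pk[OF that(2)] pI[OF that(2)]] by simp
  have \<Phi>i: "integrable lborel (\<lambda>x. (cmod (\<Phi> x))\<^sup>2)" and \<Phi>2: "(sqnorm \<Phi>) \<le> CB * S"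
    and h\<Phi>i: "integrable lborel (\<lambda>x. h x * cnj (\<Phi> x))" and h\<Phi>: "(ip h \<Phi>) = complex_of_real S"
    using syn(1-4) V(2) lpos ii hphi gram \<alpha>_def by (auto simp: less_imp_le)
  have S0: "0 \<le> S" unfolding S_def using lpos by (intro sum_nonneg) (auto simp: less_imp_le)
  \<comment> \<open>The parameter of the elementary inequality
    \<open>2 * s * b <= s^2 + b^2\<close>, chosen such that the bound \<open>CB * S\<close> for the
    square norm of \<Phi> enters with total factor exactly one half.\<close>
  define s where "s = 12 * K * CB"
  have s: "0 < s" using K by (simp add: s_def CB_def)
  have \<Phi>1: "(\<integral>\<^sup>+x. ennreal (12 * K) * indicator {c0 - 2 * L..c0 + 2 * L} x * ennreal (cmod (\<Phi> x)) \<partial>lborel)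
    \<le> ennreal (288 * CB * K\<^sup>2 * L + S / 2)"
  proof -
    have "(\<integral>\<^sup>+x. ennreal (12 * K) * indicator {c0 - 2 * L..c0 + 2 * L} x * ennreal (cmod (\<Phi> x)) \<partial>lborel)
      \<le> (\<integral>\<^sup>+x. ennreal (12 * K * (s / 2)) * indicator {c0 - 2 * L..c0 + 2 * L} x + ennreal (12 * K / (2 * s) * (cmod (\<Phi> x))\<^sup>2) \<partial>lborel)"
    proof (rule nn_integral_mono)
      fix x
      have "2 * s * cmod (\<Phi> x) \<le> s\<^sup>2 + (cmod (\<Phi> x))\<^sup>2" by (rule sum_squares_bound)
      then have "cmod (\<Phi> x) \<le> s / 2 + (cmod (\<Phi> x))\<^sup>2 / (2 * s)"
        using s by (simp add: field_simps power2_eq_square)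
      then have "12 * K * cmod (\<Phi> x) \<le> 12 * K * (s / 2 + (cmod (\<Phi> x))\<^sup>2 / (2 * s))" using K by (intro mult_left_mono) auto
      then have "ennreal (12 * K * cmod (\<Phi> x)) \<le> ennreal (12 * K * (s / 2)) + ennreal (12 * K / (2 * s) * (cmod (\<Phi> x))\<^sup>2)"
      proof -
        assume le: "12 * K * cmod (\<Phi> x) \<le> 12 * K * (s / 2 + (cmod (\<Phi> x))\<^sup>2 / (2 * s))"
        have "12 * K * (s / 2 + (cmod (\<Phi> x))\<^sup>2 / (2 * s)) = 12 * K * (s / 2) + 12 * K / (2 * s) * (cmod (\<Phi> x))\<^sup>2"
          by (simp add: distrib_left)
        moreover have "ennreal (12 * K * (s / 2) + 12 * K / (2 * s) * (cmod (\<Phi> x))\<^sup>2) = ennreal (12 * K * (s / 2)) + ennreal (12 * K / (2 * s) * (cmod (\<Phi> x))\<^sup>2)"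
          using K s by (intro ennreal_plus) auto
        ultimately show ?thesis using ennreal_leI[OF le] by (simp only:)
      qed
      then show "ennreal (12 * K) * indicator {c0 - 2 * L..c0 + 2 * L} x * ennreal (cmod (\<Phi> x)) \<le>
         ennreal (12 * K * (s / 2)) * indicator {c0 - 2 * L..c0 + 2 * L} x + ennreal (12 * K / (2 * s) * (cmod (\<Phi> x))\<^sup>2)"
        using K by (auto simp: indicator_def ennreal_mult[symmetric])
    qed
    also have "\<dots> = (\<integral>\<^sup>+x. ennreal (12 * K * (s / 2)) * indicator {c0 - 2 * L..c0 + 2 * L} x \<partial>lborel)
        + (\<integral>\<^sup>+x. ennreal (12 * K / (2 * s) * (cmod (\<Phi> x))\<^sup>2) \<partial>lborel)"
      by (rule nn_integral_add) measurable
    also have "(\<integral>\<^sup>+x. ennreal (12 * K * (s / 2)) * indicator {c0 - 2 * L..c0 + 2 * L} x \<partial>lborel) = ennreal (12 * K * (s / 2) * (4 * L))"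
      using L K s by (subst nn_integral_cmult_indicator) (auto simp: ennreal_mult[symmetric])
    also have "(\<integral>\<^sup>+x. ennreal (12 * K / (2 * s) * (cmod (\<Phi> x))\<^sup>2) \<partial>lborel) = ennreal (\<integral>x. 12 * K / (2 * s) * (cmod (\<Phi> x))\<^sup>2 \<partial>lborel)"
      using K s by (intro nn_integral_eq_integral integrable_mult_right \<Phi>i) auto
    also have "(\<integral>x. 12 * K / (2 * s) * (cmod (\<Phi> x))\<^sup>2 \<partial>lborel) = 12 * K / (2 * s) * (sqnorm \<Phi>)"
      by (rule integral_mult_right_zero)
    also have "ennreal (12 * K * (s / 2) * (4 * L)) + ennreal (12 * K / (2 * s) * (sqnorm \<Phi>))
      \<le> ennreal (12 * K * (s / 2) * (4 * L)) + ennreal (12 * K / (2 * s) * (CB * S))"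
      using \<Phi>2 K s by (intro add_left_mono ennreal_leI mult_left_mono) auto
    also have "\<dots> = ennreal (12 * K * (s / 2) * (4 * L) + 12 * K / (2 * s) * (CB * S))"
      using K s L S0 by (intro ennreal_plus[symmetric]) (auto simp: CB_def)
    also have "12 * K * (s / 2) * (4 * L) + 12 * K / (2 * s) * (CB * S) = 288 * CB * K\<^sup>2 * L + S / 2"
      using K by (simp add: s_def CB_def power2_eq_square)
    finally show ?thesis .
  qed
  \<comment> \<open>The square sum is itself a pairing with \<open>h\<close>. It is now bounded by a
    multiple of \<open>K^2 * L\<close> plus \<open>S / 2\<close>, and the last term is
    absorbed.\<close>
  have "ennreal S = ennreal (cmod (ip h \<Phi>))" using h\<Phi> S0 by simp
  also have "\<dots> \<le> (\<integral>\<^sup>+y. ennreal (cmod (h y * cnj (\<Phi> y))) \<partial>lborel)" by (rule integral_norm_bound_ennreal[OF h\<Phi>i])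
  also have "\<dots> \<le> (\<integral>\<^sup>+y. ennreal c2 * (ennreal (cmod (h y)) * ennreal (1 / wt c0 L y ^ 2)) + (\<integral>\<^sup>+x. ennreal (cmod (h y)) * k y x * ennreal (cmod (\<Phi> x)) \<partial>lborel) \<partial>lborel)"
  proof (rule nn_integral_mono)
    fix y
    have [measurable]: "k y \<in> borel_measurable borel" unfolding k_def[abs_def] by measurable
    have "ennreal (cmod (h y * cnj (\<Phi> y))) = ennreal (cmod (h y)) * ennreal (cmod (\<Phi> y))" by (simp add: norm_mult ennreal_mult)
    also have "\<dots> \<le> ennreal (cmod (h y)) * (ennreal (c2 / wt c0 L y ^ 2) + (\<integral>\<^sup>+x. k y x * ennreal (cmod (\<Phi> x)) \<partial>lborel))"
      by (intro mult_left_mono \<Phi>_pt) auto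
    also have "\<dots> = ennreal (cmod (h y)) * ennreal (c2 / wt c0 L y ^ 2) + (\<integral>\<^sup>+x. ennreal (cmod (h y)) * k y x * ennreal (cmod (\<Phi> x)) \<partial>lborel)"
      by (simp add: distrib_left nn_integral_cmult[symmetric] mult.assoc)
    also have "ennreal (c2 / wt c0 L y ^ 2) = ennreal c2 * ennreal (1 / wt c0 L y ^ 2)"
      using c20 by (simp add: ennreal_mult[symmetric])
    finally show "ennreal (cmod (h y * cnj (\<Phi> y))) \<le> ennreal c2 * (ennreal (cmod (h y)) * ennreal (1 / wt c0 L y ^ 2)) + (\<integral>\<^sup>+x. ennreal (cmod (h y)) * k y x * ennreal (cmod (\<Phi> x)) \<partial>lborel)"
      by (simp add: mult_ac)
  qed
  also have "\<dots> = ennreal c2 * (\<integral>\<^sup>+y. ennreal (cmod (h y)) * ennreal (1 / wt c0 L y ^ 2) \<partial>lborel)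
     + (\<integral>\<^sup>+y. (\<integral>\<^sup>+x. ennreal (cmod (h y)) * k y x * ennreal (cmod (\<Phi> x)) \<partial>lborel) \<partial>lborel)"
    using km by (subst nn_integral_add) (auto simp: nn_integral_cmult)
  also have "(\<integral>\<^sup>+y. (\<integral>\<^sup>+x. ennreal (cmod (h y)) * k y x * ennreal (cmod (\<Phi> x)) \<partial>lborel) \<partial>lborel)
     = (\<integral>\<^sup>+x. (\<integral>\<^sup>+y. ennreal (cmod (h y)) * k y x * ennreal (cmod (\<Phi> x)) \<partial>lborel) \<partial>lborel)"
  proof -
    have "(\<lambda>p. k (fst p) (snd p)) \<in> borel_measurable (lborel \<Otimes>\<^sub>M lborel)"
      using km by (simp add: split_beta' cong: measurable_cong_sets)
    moreover have "(\<lambda>p. \<Phi> (snd p)) \<in> borel_measurable (lborel \<Otimes>\<^sub>M lborel)"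
      by (rule measurable_compose[OF measurable_snd]) simp
    moreover have "(\<lambda>p. h (fst p)) \<in> borel_measurable (lborel \<Otimes>\<^sub>M lborel)"
      by (rule measurable_compose[OF measurable_fst]) simp
    ultimately have "(\<lambda>(y, x). ennreal (cmod (h y)) * k y x * ennreal (cmod (\<Phi> x))) \<in> borel_measurable (lborel \<Otimes>\<^sub>M lborel)"
      unfolding split_beta' by measurable
    then show ?thesis by (rule lborel_pair.Fubini'[symmetric])
  qed
  also have "\<dots> = (\<integral>\<^sup>+x. (\<integral>\<^sup>+y. ennreal (cmod (h y)) * k y x \<partial>lborel) * ennreal (cmod (\<Phi> x)) \<partial>lborel)"
  proof (intro nn_integral_cong nn_integral_multc)
    fix x
    have [measurable]: "(\<lambda>y. k y x) \<in> borel_measurable borel"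
      using measurable_compose[OF measurable_Pair2'[of x borel borel] km] by simp
    show "(\<lambda>y. ennreal (cmod (h y)) * k y x) \<in> borel_measurable lborel" by measurable
  qed
  also have "\<dots> \<le> (\<integral>\<^sup>+x. ennreal (12 * K) * indicator {c0 - 2 * L..c0 + 2 * L} x * ennreal (cmod (\<Phi> x)) \<partial>lborel)"
    by (intro nn_integral_mono mult_right_mono k_avg) auto
  also have "\<dots> \<le> ennreal (288 * CB * K\<^sup>2 * L + S / 2)" by (rule \<Phi>1)
  also have "ennreal c2 * (\<integral>\<^sup>+y. ennreal (cmod (h y)) * ennreal (1 / wt c0 L y ^ 2) \<partial>lborel) \<le> ennreal c2 * ennreal (16 * K * L)"
    by (intro mult_left_mono H0) auto
  also have "ennreal c2 * ennreal (16 * K * L) = ennreal (c2 * (16 * K * L))"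
    using K L c20 by (intro ennreal_mult[symmetric]) auto
  finally have "ennreal S \<le> ennreal (c2 * (16 * K * L)) + ennreal (288 * CB * K\<^sup>2 * L + S / 2)"
    by (simp add: add_left_mono add_right_mono)
  also have "\<dots> = ennreal (c2 * (16 * K * L) + (288 * CB * K\<^sup>2 * L + S / 2))"
    using K L c20 S0 by (intro ennreal_plus[symmetric]) (auto simp: CB_def)
  finally have "S \<le> c2 * (16 * K * L) + (288 * CB * K\<^sup>2 * L + S / 2)"
    using K L c20 S0 by (subst (asm) ennreal_le_iff) (auto simp: CB_def)
  then have "S \<le> 2 * (c2 * (16 * K * L) + 288 * CB * K\<^sup>2 * L)" by simp
  also have "\<dots> = tree_const \<kappa> * K\<^sup>2 * L"
    by (simp add: tree_const_def c2_def CB_def A_def power2_eq_square algebra_simps)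
  finally show ?thesis by (simp add: S_def \<alpha>_def L_def)
qed

end

section \<open>Selection of trees and Bessel's inequality across trees\<close>

text \<open>An element of maximal key is chosen, everything it conflicts with is discarded, and the
  procedure is repeated on the rest. Of two chosen elements the earlier one has the larger key and
  does not conflict with the later. The relation \<open>conf\<close> need not be symmetric, which is
  why the conclusion is a disjunction.\<close>

lemma greedy_selection:
  fixes key :: "'u \<Rightarrow> real"
  assumes "finite G"
  shows "\<exists>H\<subseteq>G. (\<forall>U\<in>H. \<forall>V\<in>H. U \<noteq> V \<longrightarrow> (key V \<le> key U \<and> \<not> conf U V) \<or> (key U \<le> key V \<and> \<not> conf V U)) \<and>
    (\<forall>V\<in>G. \<exists>U\<in>H. U = V \<or> conf U V)"
  using assms
proof (induction "card G" arbitrary: G rule: less_induct)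
  case less
  show ?case
  proof (cases "G = {}")
    case False
    then have "Max (key ` G) \<in> key ` G" using less.prems by (intro Max_in) auto
    then obtain U0 where U0: "U0 \<in> G" "Max (key ` G) = key U0" by blast
    have max: "key U \<le> key U0" if "U \<in> G" for U
      using Max_ge[of "key ` G" "key U"] less.prems that U0(2) by auto
    define G' where "G' = {U \<in> G. U \<noteq> U0 \<and> \<not> conf U0 U}"
    have G': "G' \<subset> G" using U0 by (auto simp: G'_def)
    then have "card G' < card G" "finite G'" using less.prems by (auto intro: psubset_card_mono finite_subset)
    then obtain H where H: "H \<subseteq> G'"
      "\<forall>U\<in>H. \<forall>V\<in>H. U \<noteq> V \<longrightarrow> (key V \<le> key U \<and> \<not> conf U V) \<or> (key U \<le> key V \<and> \<not> conf V U)"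
      "\<forall>V\<in>G'. \<exists>U\<in>H. U = V \<or> conf U V"
      using less.hyps[of G'] by blast
    have sub: "V \<in> G \<and> V \<noteq> U0 \<and> \<not> conf U0 V" if "V \<in> H" for V using that H(1) by (auto simp: G'_def)
    show ?thesis
    proof (intro exI[of _ "insert U0 H"] conjI ballI impI)
      show "insert U0 H \<subseteq> G" using U0 sub by blast
      fix U V assume "U \<in> insert U0 H" "V \<in> insert U0 H" "U \<noteq> V"
      then show "(key V \<le> key U \<and> \<not> conf U V) \<or> (key U \<le> key V \<and> \<not> conf V U)"
        using H(2) sub max by blast
    next
      fix V assume V: "V \<in> G"
      show "\<exists>U\<in>insert U0 H. U = V \<or> conf U V"
      proof (cases "V \<in> G'")
        case True then show ?thesis using H(3) by blast
      next
        case False then show ?thesis using V by (auto simp: G'_def)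
      qed
    qed
  qed auto
qed

text \<open>144 is the contribution of pairs of equal scale. The rest is
  \<open>46656 = 2 * 162 * 144\<close>: both orders of a pair, \<open>162 = 2 * 81\<close> from a
  row and 144 from the tails of a tree.\<close>

definition bessel_const :: "real \<Rightarrow> nat \<Rightarrow> real \<Rightarrow> real" where
  "bessel_const B \<kappa> N = B\<^sup>2 * (144 + 46656 * 2 ^ \<kappa> * N)"

context dual_grid_pair
begin

text \<open>Controls the part of the Gram matrix of the selected packets that couples different scales: there a
  tile sees only tiles outside the top interval of its own tree.\<close>

lemma tree_outside_sum:
  assumes V: "V \<subseteq> all_tiles D D'" "finite V" and lac: "disjoint (snd ` V)"
    and I0: "I0 \<in> D" and sub: "\<And>P. P \<in> V \<Longrightarrow> fst P \<subseteq> I0"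
    and \<xi>: "\<And>P. P \<in> V \<Longrightarrow> \<xi> \<in> dyadic_ancestor D' \<kappa> (snd P)"
  shows "(\<Sum>P\<in>V. \<integral>\<^sup>+x. ennreal (1 / wtile P x ^ 4) * indicator (- {Inf I0<..<Sup I0}) x \<partial>lborel)
    \<le> ennreal (144 * 2 ^ \<kappa> * ivl_length I0)"
proof -
  define L a b where "L = ivl_length I0" and "a = Inf I0" and "b = Sup I0"
  have pI0: "proper_interval I0" by (rule grid_proper[OF grid I0])
  have L: "0 < L" using proper_interval_length_pos[OF pI0] by (simp add: L_def)
  have t: "P \<in> all_tiles D D'" if "P \<in> V" for P using V that by auto
  have pI: "proper_interval (fst P)" if "P \<in> V" for P using tile_proper(1)[OF t[OF that]] .
  have lpos: "0 < ltile P" if "P \<in> V" for P using tile_length_pos[OF t[OF that]] .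
  have lL: "ltile P \<le> L" if "P \<in> V" for P
    using proper_interval_subset[OF pI[OF that] pI0 sub[OF that]] by (auto simp: L_def)
  have cP: "a \<le> ctile P" "ctile P \<le> b" if "P \<in> V" for P
    using proper_interval_bounds[OF pI0, of "ctile P"] ivl_center_mem[OF pI[OF that]] sub[OF that] by (auto simp: a_def b_def)
  have ab: "a \<le> b" using proper_interval_Inf_less_Sup[OF pI0] by (simp add: a_def b_def)
  let ?f = "\<lambda>P. \<integral>\<^sup>+x. ennreal (1 / wtile P x ^ 4) * indicator (- {a<..<b}) x \<partial>lborel"
  have level: "(\<Sum>P | P \<in> V \<and> ltile P = l. ?f P) \<le> ennreal (72 * 2 ^ \<kappa> * l)" if l: "l \<in> ltile ` V" for l
  proof -
    have l0: "0 < l" using l lpos by auto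
    let ?G = "{P \<in> V. ltile P = l}"
    \<comment> \<open>One plus the distance to the top interval in units of \<open>l\<close>; it
      lies below the weight of every tile of this scale. Two of the four powers are traded for it,
      the other two make the sum over the tiles bounded.\<close>
    define d where "d x = (if b \<le> x then 1 + (x - b) / l else 1 + (a - x) / l)" for x
    have "(\<Sum>P\<in>?G. ?f P) = (\<integral>\<^sup>+x. (\<Sum>P\<in>?G. ennreal (1 / wtile P x ^ 4) * indicator (- {a<..<b}) x) \<partial>lborel)"
      by (rule nn_integral_sum[symmetric]) measurable
    also have "\<dots> \<le> (\<integral>\<^sup>+x. ennreal (36 * 2 ^ \<kappa>) * (ennreal (1 / d x ^ 2) * indicator (- {a<..<b}) x) \<partial>lborel)"
    proof (rule nn_integral_mono)
      fix x
      show "(\<Sum>P\<in>?G. ennreal (1 / wtile P x ^ 4) * indicator (- {a<..<b}) x)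
        \<le> ennreal (36 * 2 ^ \<kappa>) * (ennreal (1 / d x ^ 2) * indicator (- {a<..<b}) x)"
      proof (cases "x \<in> {a<..<b}")
        case False
        have dpos: "1 \<le> d x"
        proof (cases "b \<le> x")
          case True
          then show ?thesis using l0 by (simp add: d_def)
        next
          case 2: False
          then have "x \<le> a" using False by simp
          then show ?thesis using 2 l0 by (simp add: d_def)
        qed
        have "(\<Sum>P\<in>?G. 1 / wtile P x ^ 4) \<le> (\<Sum>P\<in>?G. 1 / d x ^ 2 * (1 / wt (ctile P) l x ^ 2))"
        proof (rule sum_mono)
          fix P assume P: "P \<in> ?G"
          have w: "0 < wt (ctile P) l x" using l0 by (rule wt_pos)
          have "d x \<le> wt (ctile P) l x"
          proof (cases "b \<le> x")
            case True
            have "x - b \<le> \<bar>x - ctile P\<bar>" using cP[of P] P by auto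
            then have "(x - b) / l \<le> \<bar>x - ctile P\<bar> / l" using l0 by (intro divide_right_mono) auto
            then show ?thesis using True by (simp add: d_def wt_def)
          next
            case False
            have "a - x \<le> \<bar>x - ctile P\<bar>" using cP[of P] P by auto
            then have "(a - x) / l \<le> \<bar>x - ctile P\<bar> / l" using l0 by (intro divide_right_mono) auto
            then show ?thesis using False by (simp add: d_def wt_def)
          qed
          then have "d x ^ 2 \<le> wt (ctile P) l x ^ 2" using dpos by (intro power_mono) auto
          then have "1 / wt (ctile P) l x ^ 2 * (1 / wt (ctile P) l x ^ 2) \<le> 1 / d x ^ 2 * (1 / wt (ctile P) l x ^ 2)"
            using w dpos by (intro mult_right_mono divide_left_mono) auto
          moreover have "1 / W ^ 4 = 1 / W ^ 2 * (1 / W ^ 2)" for W :: real by (simp add: power_add[symmetric])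
          moreover have "ltile P = l" using P by blast
          ultimately show "1 / wtile P x ^ 4 \<le> 1 / d x ^ 2 * (1 / wt (ctile P) l x ^ 2)" by (simp only:)
        qed
        also have "\<dots> = 1 / d x ^ 2 * (\<Sum>P\<in>?G. 1 / wt (ctile P) l x ^ 2)" by (rule sum_distrib_left[symmetric])
        also have "\<dots> \<le> 1 / d x ^ 2 * (9/2 * real (8 * 2 ^ \<kappa>))"
        proof (intro mult_left_mono sum_wt_same_length)
          show "card {P \<in> ?G. x \<in> fst P} \<le> 8 * 2 ^ \<kappa>" for x
            using lacunary_overlap[OF V lac \<xi>, of l x] by (simp add: conj_ac)
        qed (use l0 V pI in auto)
        finally have "(\<Sum>P\<in>?G. 1 / wtile P x ^ 4) \<le> 36 * 2 ^ \<kappa> * (1 / d x ^ 2)" by simp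
        then have "ennreal (\<Sum>P\<in>?G. 1 / wtile P x ^ 4) \<le> ennreal (36 * 2 ^ \<kappa> * (1 / d x ^ 2))" by (rule ennreal_leI)
        moreover have "(\<Sum>P\<in>?G. ennreal (1 / wtile P x ^ 4)) = ennreal (\<Sum>P\<in>?G. 1 / wtile P x ^ 4)"
        proof (rule sum_ennreal)
          fix P assume "P \<in> ?G"
          then have "0 < wtile P x" using lpos[of P] by (intro wt_pos) auto
          then show "0 \<le> 1 / wtile P x ^ 4" by simp
        qed
        moreover have "ennreal (36 * 2 ^ \<kappa> * (1 / d x ^ 2)) = ennreal (36 * 2 ^ \<kappa>) * ennreal (1 / d x ^ 2)"
          by (rule ennreal_mult) auto
        moreover have "indicator (- {a<..<b}) x = (1 :: ennreal)" using False by simp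
        ultimately show ?thesis by (simp only: mult_1_right)
      qed simp
    qed
    also have "\<dots> = ennreal (36 * 2 ^ \<kappa>) * (\<integral>\<^sup>+x. ennreal (1 / d x ^ 2) * indicator (- {a<..<b}) x \<partial>lborel)"
      unfolding d_def by (rule nn_integral_cmult) measurable
    also have "\<dots> \<le> ennreal (36 * 2 ^ \<kappa>) * ennreal (2 * l)"
    proof (rule mult_left_mono[OF nn_integral_wt_outside[OF l0 ab]])
      show "1 / (d x)\<^sup>2 \<le> 1 / (1 + (x - b) / l)\<^sup>2" if "b \<le> x" for x using that by (simp add: d_def)
      show "1 / (d x)\<^sup>2 \<le> 1 / (1 + (a - x) / l)\<^sup>2" if "x \<le> a" for x
        using that ab by (cases "x = b") (auto simp: d_def)
    qed simp
    also have "\<dots> = ennreal (72 * 2 ^ \<kappa> * l)" using l0 by (simp add: ennreal_mult[symmetric])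
    finally show ?thesis .
  qed
  have "(\<Sum>P\<in>V. ?f P) = (\<Sum>l\<in>ltile ` V. \<Sum>P | P \<in> V \<and> ltile P = l. ?f P)" using V by (intro sum.image_gen) auto
  also have "\<dots> \<le> (\<Sum>l\<in>ltile ` V. ennreal (72 * 2 ^ \<kappa> * l))" by (intro sum_mono level)
  also have "\<dots> = ennreal (72 * 2 ^ \<kappa> * \<Sum>(ltile ` V))"
    unfolding sum_distrib_left using lpos by (intro sum_ennreal) (auto simp: less_imp_le)
  also have "\<dots> \<le> ennreal (72 * 2 ^ \<kappa> * (2 * L))"
  proof (intro ennreal_leI mult_left_mono sum_geometric_le)
    show "2 * l \<le> l'" if "l \<in> ltile ` V" "l' \<in> ltile ` V" "l < l'" for l l'
      using that tile_length_ratio t by blast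
  qed (use V lL L in auto)
  also have "72 * 2 ^ \<kappa> * (2 * L) = 144 * 2 ^ \<kappa> * L" by simp
  finally show ?thesis unfolding a_def b_def L_def .
qed

text \<open>The Gram matrix splits into pairs of equal scale, handled by Schur's test, and pairs of
  different scales with meeting frequency intervals. In the second part all coefficients are
  replaced by \<Lambda>, and \<open>sep\<close> leaves only tails outside the top intervals. The
  result is a multiple of \<Lambda>^2 times the total top length, which \<open>big\<close> converts
  back into the square sum \<open>S\<close>. So the Gram form is at most a multiple of
  \<open>S\<close>, and Bessel's inequality applies.\<close>

lemma selected_trees_bessel:
  fixes g :: "real \<Rightarrow> complex"
  assumes fin: "finite H" "\<And>U. U \<in> H \<Longrightarrow> finite (tiles U)"
    and tree: "\<And>U. U \<in> H \<Longrightarrow> is_tree D D' \<kappa> U" and lac: "\<And>U. U \<in> H \<Longrightarrow> lacunary U"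
    and disj: "\<And>U V. U \<in> H \<Longrightarrow> V \<in> H \<Longrightarrow> U \<noteq> V \<Longrightarrow> tiles U \<inter> tiles V = {}"
    and sep: "\<And>U V P Q. U \<in> H \<Longrightarrow> V \<in> H \<Longrightarrow> U \<noteq> V \<Longrightarrow> P \<in> tiles U \<Longrightarrow> Q \<in> tiles V \<Longrightarrow>
        snd P \<inter> snd Q \<noteq> {} \<Longrightarrow> ltile Q < ltile P \<Longrightarrow> fst Q \<inter> top_ivl U = {}"
    and p: "\<And>U P. U \<in> H \<Longrightarrow> P \<in> tiles U \<Longrightarrow> packet B 6 P (\<phi> P)"
    and gint: "integrable lborel g" and g2: "integrable lborel (\<lambda>x. (cmod (g x))\<^sup>2)"
  defines "a \<equiv> \<lambda>P. cmod (ip g (\<phi> P))"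
  assumes \<Lambda>: "\<And>U P. U \<in> H \<Longrightarrow> P \<in> tiles U \<Longrightarrow> a P \<le> \<Lambda>" and N: "0 \<le> N" and B: "0 < B"
    and big: "\<And>U. U \<in> H \<Longrightarrow> \<Lambda>\<^sup>2 * ltop U \<le> N * (\<Sum>P\<in>tiles U. ltile P * (a P)\<^sup>2)"
  shows "\<Lambda>\<^sup>2 * (\<Sum>U\<in>H. ltop U) \<le> N * bessel_const B \<kappa> N * (sqnorm g)"
proof -
  define F where "F = (\<Union>U\<in>H. tiles U)"
  have F: "finite F" using fin by (auto simp: F_def)
  have t: "P \<in> all_tiles D D'" if "U \<in> H" "P \<in> tiles U" for U P using tree[OF that(1)] that(2) by (auto simp: is_tree_def)
  then have FT: "F \<subseteq> all_tiles D D'" unfolding F_def by blast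
  have pF: "packet B 6 P (\<phi> P)" if "P \<in> F" for P using that p unfolding F_def by blast
  have pI: "proper_interval (fst P)" if "P \<in> F" for P using tile_proper(1) FT that by blast
  have p4: "packet B 4 P (\<phi> P)" if "P \<in> F" for P by (rule packet_mono[OF pF[OF that] _ pI[OF that]]) simp
  have lpos: "0 < ltile P" if "P \<in> F" for P using tile_length_pos FT that by blast
  have a0: "0 \<le> a P" for P by (simp add: a_def)
  define S where "S = (\<Sum>P\<in>F. ltile P * (a P)\<^sup>2)"
  have sumF: "(\<Sum>P\<in>F. f P) = (\<Sum>U\<in>H. \<Sum>P\<in>tiles U. f P)" for f :: "tile \<Rightarrow> real"
    unfolding F_def using fin disj by (intro sum.UNION_disjoint) auto
  have bigS: "\<Lambda>\<^sup>2 * (\<Sum>U\<in>H. ltop U) \<le> N * S"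
    unfolding S_def sumF sum_distrib_left[of "\<Lambda>\<^sup>2"] sum_distrib_left[of N] by (intro sum_mono) (simp add: big sum_distrib_left[symmetric])
  define K where "K P Q = cmod (ip (\<phi> P) (\<phi> Q))" for P Q
  have K0: "0 \<le> K P Q" for P Q by (simp add: K_def)
  have Ksym: "K P Q = K Q P" for P Q unfolding K_def by (rule gram_sym)
  \<comment> \<open>Here \<open>Q\<close> is finer in space, hence coarser in frequency: its
    frequency interval contains that of \<open>P\<close>.\<close>
  define finer where "finer P Q \<longleftrightarrow> ltile Q < ltile P \<and> snd P \<inter> snd Q \<noteq> {}" for P Q :: tile
  define off where "off P Q = (if finer P Q then ltile P * ltile Q * a P * a Q * K P Q else 0)" for P Q

  have nested: "snd P \<subseteq> snd Q" if nP: "P \<in> F" "Q \<in> F" "finer P Q" for P Q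
  proof -
    have PQ: "P \<in> all_tiles D D'" "Q \<in> all_tiles D D'" using nP FT by auto
    obtain x where "x \<in> snd P" "x \<in> snd Q" using nP(3) by (auto simp: finer_def)
    moreover have "ivl_length (snd P) < ivl_length (snd Q)"
      using nP(3) tile_length_pos[OF PQ(1)] tile_length_pos[OF PQ(2)]
      by (simp add: finer_def tile_freq_length[OF PQ(1)] tile_freq_length[OF PQ(2)] frac_less2)
    ultimately show ?thesis using grid_subset[OF grid' tile_mem(2)[OF PQ(1)] tile_mem(2)[OF PQ(2)]] by blast
  qed
  have other_tree: "U \<noteq> V" if "U \<in> H" "V \<in> H" "P \<in> tiles U" "Q \<in> tiles V" "finer P Q" for U V P Q
  proof
    assume "U = V"
    then have "snd P = snd Q" using that lac[OF that(1)] unfolding lacunary_def disjoint_def finer_def by blast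
    then have "ltile P = ltile Q"
      using tile_freq_length[OF t[OF that(1,3)]] tile_freq_length[OF t[OF that(2,4)]] t[OF that(1,3)] t[OF that(2,4)] tile_length_pos
      by (metis divide_divide_eq_right div_by_1 mult_1)
    then show False using that(5) by (simp add: finer_def)
  qed
  \<comment> \<open>Each \<open>fst Q\<close> in the row avoids the interior of the top interval of
    the tree of \<open>P\<close>. The sum over \<open>Q\<close> thus becomes an integral of the
    weight of \<open>P\<close> over the complement.\<close>
  have row: "(\<Sum>Q\<in>F. off P Q) \<le> \<Lambda>\<^sup>2 * (162 * B\<^sup>2) * v"
    if UP: "U \<in> H" "P \<in> tiles U" and v: "0 \<le> v"
      "(\<integral>\<^sup>+x. ennreal (1 / wtile P x ^ 4) * indicator (- {Inf (top_ivl U)<..<Sup (top_ivl U)}) x \<partial>lborel) = ennreal v"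
    for U P v
  proof -
    have P: "P \<in> F" using UP unfolding F_def by blast
    have l: "0 < ltile P" by (rule lpos[OF P])
    let ?G = "{Q \<in> F. finer P Q}"
    have G: "finite ?G" using F by auto
    have out: "fst Q \<subseteq> - {Inf (top_ivl U)<..<Sup (top_ivl U)}" if Q: "Q \<in> ?G" for Q
    proof -
      obtain V where V: "V \<in> H" "Q \<in> tiles V" using Q unfolding F_def by blast
      have "fst Q \<inter> top_ivl U = {}"
        using sep[OF UP(1) V(1) other_tree[OF UP(1) V(1) UP(2) V(2)] UP(2) V(2)] Q by (auto simp: finer_def)
      moreover have "proper_interval (top_ivl U)" using tree[OF UP(1)] grid_proper[OF grid] by (auto simp: is_tree_def)
      ultimately show ?thesis using proper_interval_interior by (metis (no_types, lifting) ComplI disjoint_iff greaterThanLessThan_iff subsetI)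
    qed
    \<comment> \<open>Two tiles of the row have meeting frequency intervals, as both contain that of
      \<open>P\<close>. Were one shorter than the other, \<open>sep\<close> would keep it outside
      the top interval of the other's tree, contrary to the common point. So overlapping tiles share
      a scale and at most 16 pass through a point.\<close>
    have eqlen: "ltile Q = ltile Q'" if Q: "Q \<in> ?G" "Q' \<in> ?G" and x: "x \<in> fst Q" "x \<in> fst Q'" for Q Q' x
    proof -
      have *: False if Q: "Q \<in> ?G" "Q' \<in> ?G" and x: "x \<in> fst Q" "x \<in> fst Q'" and less: "ltile Q' < ltile Q" for Q Q'
      proof -
        obtain V V' where V: "V \<in> H" "Q \<in> tiles V" "V' \<in> H" "Q' \<in> tiles V'" using Q unfolding F_def by blast
        have "snd P \<noteq> {}" using proper_interval_bdd(3) tile_proper(2) t[OF UP] by blast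
        then have f: "finer Q Q'" using nested[OF P, of Q] nested[OF P, of Q'] Q less by (auto simp: finer_def)
        have "fst Q' \<inter> top_ivl V = {}"
          using sep[OF V(1,3) other_tree[OF V(1,3,2,4) f] V(2,4)] f by (auto simp: finer_def)
        moreover have "fst Q \<subseteq> top_ivl V" using tree[OF V(1)] V(2) by (auto simp: is_tree_def)
        ultimately show False using x by auto
      qed
      show ?thesis using *[OF Q x] *[OF Q(2,1) x(2,1)] by (meson linorder_neqE_linordered_idom)
    qed
    have ov: "card {Q \<in> ?G. x \<in> fst Q} \<le> 16" for x
    proof (cases "{Q \<in> ?G. x \<in> fst Q} = {}")
      case True
      show ?thesis unfolding True by simp
    next
      case False
      then obtain Q0 where Q0: "Q0 \<in> ?G" "x \<in> fst Q0" by blast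
      define l where "l = ltile Q0"
      have "{Q \<in> ?G. x \<in> fst Q} \<subseteq> {Q \<in> ?G. ltile Q = l \<and> x \<in> fst Q}"
        using eqlen[OF _ Q0(1) _ Q0(2)] by (auto simp: l_def)
      then have "card {Q \<in> ?G. x \<in> fst Q} \<le> card {Q \<in> ?G. ltile Q = l \<and> x \<in> fst Q}" using F by (intro card_mono) auto
      also have "\<dots> \<le> 4 * 4"
      proof (rule card_tiles_through)
        have "snd ` {Q \<in> ?G. ltile Q = l} \<subseteq> {\<omega> \<in> D'. ivl_center (snd P) \<in> \<omega> \<and> ivl_length \<omega> = 1 / l}"
        proof
          fix \<omega> assume "\<omega> \<in> snd ` {Q \<in> ?G. ltile Q = l}"
          then obtain Q where Q: "Q \<in> F" "finer P Q" "ltile Q = l" "\<omega> = snd Q" by blast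
          have Qt: "Q \<in> all_tiles D D'" using Q(1) FT by blast
          have "ivl_center (snd P) \<in> snd Q"
            using nested[OF P Q(1,2)] ivl_center_mem[OF tile_proper(2)[OF t[OF UP]]] by blast
          then show "\<omega> \<in> {\<omega> \<in> D'. ivl_center (snd P) \<in> \<omega> \<and> ivl_length \<omega> = 1 / l}"
            using Q tile_mem(2)[OF Qt] tile_freq_length[OF Qt] by simp
        qed
        then show "card (snd ` {Q \<in> ?G. ltile Q = l}) \<le> 4"
          using le_trans[OF card_mono[OF grid_card_through_point(1)[OF grid']] grid_card_through_point(2)[OF grid']] by blast
      qed (use FT F in auto)
      finally show ?thesis by simp
    qed
    have "(\<Sum>Q\<in>F. off P Q) = (\<Sum>Q\<in>?G. ltile P * ltile Q * a P * a Q * K P Q)"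
      using F by (simp add: off_def sum.inter_filter)
    also have "\<dots> \<le> (\<Sum>Q\<in>?G. \<Lambda>\<^sup>2 * (2 * B\<^sup>2) * (ltile Q / wtile P (ctile Q) ^ 4))"
    proof (rule sum_mono)
      fix Q assume Q: "Q \<in> ?G"
      then have QF: "Q \<in> F" by blast
      have kb: "K P Q \<le> 2 * B\<^sup>2 / (ltile P * wtile P (ctile Q) ^ 4)"
        unfolding K_def using pF[OF P] pF[OF QF] pI[OF P] pI[OF QF] Q by (intro packet_inner_bound) (auto simp: finer_def)
      have ab: "a P * a Q \<le> \<Lambda> * \<Lambda>"
      proof -
        obtain V where V: "V \<in> H" "Q \<in> tiles V" using QF unfolding F_def by blast
        show ?thesis using \<Lambda>[OF UP] \<Lambda>[OF V] a0[of P] a0[of Q] by (intro mult_mono) auto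
      qed
      have "(a P * a Q) * K P Q \<le> (\<Lambda> * \<Lambda>) * (2 * B\<^sup>2 / (ltile P * wtile P (ctile Q) ^ 4))"
        by (rule mult_mono[OF ab kb]) (use K0[of P Q] in auto)
      then have "(ltile P * ltile Q) * ((a P * a Q) * K P Q) \<le> (ltile P * ltile Q) * ((\<Lambda> * \<Lambda>) * (2 * B\<^sup>2 / (ltile P * wtile P (ctile Q) ^ 4)))"
        using lpos[OF P] lpos[OF QF] by (intro mult_left_mono) auto
      also have "\<dots> = \<Lambda>\<^sup>2 * (2 * B\<^sup>2) * (ltile Q / wtile P (ctile Q) ^ 4)"
        using lpos[OF P] by (simp add: power2_eq_square[of \<Lambda>])
      finally show "ltile P * ltile Q * a P * a Q * K P Q \<le> \<Lambda>\<^sup>2 * (2 * B\<^sup>2) * (ltile Q / wtile P (ctile Q) ^ 4)"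
        by (simp only: mult.assoc)
    qed
    also have "\<dots> = \<Lambda>\<^sup>2 * (2 * B\<^sup>2) * (\<Sum>Q\<in>?G. ltile Q / wtile P (ctile Q) ^ 4)"
      by (rule sum_distrib_left[symmetric])
    also have "(\<Sum>Q\<in>?G. ltile Q / wtile P (ctile Q) ^ 4) \<le> 81 * v"
    proof -
      have "ennreal (\<Sum>Q\<in>?G. ltile Q / wtile P (ctile Q) ^ 4) \<le> ennreal ((3/2)^4 * real 16) *
        (\<integral>\<^sup>+x. ennreal (1 / wtile P x ^ 4) * indicator (- {Inf (top_ivl U)<..<Sup (top_ivl U)}) x \<partial>lborel)"
      proof (rule sum_wt_le_nn_integral[OF G _ _ l out])
        show "proper_interval (fst Q)" if "Q \<in> ?G" for Q using pI that by blast
        show "ltile Q \<le> ltile P" if "Q \<in> ?G" for Q using that by (simp add: finer_def)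
      qed (use ov in auto)
      also have "\<dots> = ennreal (81 * v)" unfolding v(2) using v(1) by (subst ennreal_mult[symmetric]) (auto simp: eval_nat_numeral)
      finally show ?thesis using v(1) by (subst (asm) ennreal_le_iff) auto
    qed
    finally show ?thesis by (simp add: mult_left_mono)
  qed
  have tree_sum: "(\<Sum>P\<in>tiles U. \<Sum>Q\<in>F. off P Q) \<le> 23328 * 2 ^ \<kappa> * B\<^sup>2 * (\<Lambda>\<^sup>2 * ltop U)" if U: "U \<in> H" for U
  proof -
    let ?f = "\<lambda>P. \<integral>\<^sup>+x. ennreal (1 / wtile P x ^ 4) * indicator (- {Inf (top_ivl U)<..<Sup (top_ivl U)}) x \<partial>lborel"
    have top: "top_ivl U \<in> D" using tree[OF U] by (simp add: is_tree_def)
    have Lp: "0 < ltop U" by (rule proper_interval_length_pos[OF grid_proper[OF grid top]])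
    have tot: "(\<Sum>P\<in>tiles U. ?f P) \<le> ennreal (144 * 2 ^ \<kappa> * ltop U)"
      using tree[OF U] lac[OF U] fin(2)[OF U]
      by (intro tree_outside_sum[where \<xi> = "top_freq U"]) (auto simp: is_tree_def lacunary_def)
    have vf: "?f P = ennreal (enn2real (?f P))" if "P \<in> tiles U" for P
    proof -
      have "?f P \<le> (\<Sum>P\<in>tiles U. ?f P)" using fin(2)[OF U] that by (intro member_le_sum) auto
      also have "\<dots> < \<infinity>" using tot by (auto intro: le_less_trans)
      finally show ?thesis by simp
    qed
    have "(\<Sum>P\<in>tiles U. \<Sum>Q\<in>F. off P Q) \<le> (\<Sum>P\<in>tiles U. \<Lambda>\<^sup>2 * (162 * B\<^sup>2) * enn2real (?f P))"
      by (intro sum_mono row[OF U] vf) auto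
    also have "\<dots> = \<Lambda>\<^sup>2 * (162 * B\<^sup>2) * (\<Sum>P\<in>tiles U. enn2real (?f P))" by (rule sum_distrib_left[symmetric])
    also have "\<dots> \<le> \<Lambda>\<^sup>2 * (162 * B\<^sup>2) * (144 * 2 ^ \<kappa> * ltop U)"
    proof (rule mult_left_mono)
      have "ennreal (\<Sum>P\<in>tiles U. enn2real (?f P)) = (\<Sum>P\<in>tiles U. ennreal (enn2real (?f P)))" by (rule sum_ennreal[symmetric]) simp
      also have "\<dots> = (\<Sum>P\<in>tiles U. ?f P)" by (intro sum.cong refl vf[symmetric])
      finally have "ennreal (\<Sum>P\<in>tiles U. enn2real (?f P)) \<le> ennreal (144 * 2 ^ \<kappa> * ltop U)" using tot by simp
      then show "(\<Sum>P\<in>tiles U. enn2real (?f P)) \<le> 144 * 2 ^ \<kappa> * ltop U"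
        using Lp by (subst (asm) ennreal_le_iff) auto
    qed simp
    finally show ?thesis by (simp add: mult_ac)
  qed
  have off_sum: "(\<Sum>P\<in>F. \<Sum>Q\<in>F. off P Q) \<le> 23328 * 2 ^ \<kappa> * B\<^sup>2 * (N * S)"
  proof -
    have "(\<Sum>P\<in>F. \<Sum>Q\<in>F. off P Q) \<le> (\<Sum>U\<in>H. 23328 * 2 ^ \<kappa> * B\<^sup>2 * (\<Lambda>\<^sup>2 * ltop U))"
      unfolding sumF[of "\<lambda>P. \<Sum>Q\<in>F. off P Q"] by (intro sum_mono tree_sum)
    also have "\<dots> = 23328 * 2 ^ \<kappa> * B\<^sup>2 * (\<Lambda>\<^sup>2 * (\<Sum>U\<in>H. ltop U))" by (simp only: sum_distrib_left)
    \<comment> \<open>Here the total top length, an upper bound for the cross-scale part, is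
      exchanged for the square sum itself.\<close>
    also have "\<dots> \<le> 23328 * 2 ^ \<kappa> * B\<^sup>2 * (N * S)" using bigS by (intro mult_left_mono) auto
    finally show ?thesis .
  qed
  \<comment> \<open>A pair with disjoint frequency intervals vanishes by orthogonality; any other
    pair has equal scale or is finer in exactly one of the two orders.\<close>
  have "(\<Sum>P\<in>F. \<Sum>Q\<in>F. ltile P * ltile Q * a P * a Q * K P Q) \<le>
     (\<Sum>P\<in>F. \<Sum>Q\<in>F. ltile P * ltile Q * a P * a Q * (if same_scale_meet P Q then K P Q else 0) + (off P Q + off Q P))"
  proof (intro sum_mono)
    fix P Q assume PQ: "P \<in> F" "Q \<in> F"
    have pos: "0 \<le> ltile P * ltile Q * a P * a Q * K P Q"
      using lpos[OF PQ(1)] lpos[OF PQ(2)] a0 K0 by (simp add: less_imp_le)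
    have eq: "ltile Q * ltile P * a Q * a P * K Q P = ltile P * ltile Q * a P * a Q * K P Q" by (simp add: Ksym mult_ac)
    have "snd P \<inter> snd Q = {} \<Longrightarrow> K P Q = 0"
      unfolding K_def using packet_orthogonal[OF pF[OF PQ(1)] pI[OF PQ(1)] _ pF[OF PQ(2)] pI[OF PQ(2)]] by simp
    then show "ltile P * ltile Q * a P * a Q * K P Q \<le> ltile P * ltile Q * a P * a Q * (if same_scale_meet P Q then K P Q else 0) + (off P Q + off Q P)"
      using pos unfolding off_def eq same_scale_meet_def finer_def Int_commute[of "snd Q"]
      by (cases "snd P \<inter> snd Q = {}"; cases "ltile P < ltile Q"; cases "ltile Q < ltile P") auto
  qed
  also have "\<dots> = (\<Sum>P\<in>F. \<Sum>Q\<in>F. ltile P * ltile Q * a P * a Q * (if same_scale_meet P Q then K P Q else 0)) +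
     ((\<Sum>P\<in>F. \<Sum>Q\<in>F. off P Q) + (\<Sum>P\<in>F. \<Sum>Q\<in>F. off Q P))"
    by (simp only: sum.distrib)
  also have "(\<Sum>P\<in>F. \<Sum>Q\<in>F. off Q P) = (\<Sum>P\<in>F. \<Sum>Q\<in>F. off P Q)" by (rule sum.swap)
  also have "(\<Sum>P\<in>F. \<Sum>Q\<in>F. ltile P * ltile Q * a P * a Q * (if same_scale_meet P Q then K P Q else 0)) \<le> 144 * B\<^sup>2 * S"
    unfolding K_def S_def by (rule same_scale_gram[OF FT F p4])
  finally have gram: "(\<Sum>P\<in>F. \<Sum>Q\<in>F. ltile P * ltile Q * a P * a Q * K P Q) \<le> bessel_const B \<kappa> N * S"
    using off_sum by (simp add: bessel_const_def algebra_simps)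
  have Cp: "0 < bessel_const B \<kappa> N" using B N by (simp add: bessel_const_def add_pos_nonneg)
  have "S \<le> bessel_const B \<kappa> N * (sqnorm g)"
    unfolding S_def a_def
  proof (rule synthesis_bounds(5)[OF F])
    show "0 \<le> ltile P" if "P \<in> F" for P using lpos[OF that] by simp
    show "integrable lborel (\<lambda>x. \<phi> P x * cnj (\<phi> Q x))" if "P \<in> F" "Q \<in> F" for P Q
      using packet_mult_integrable[OF pF[OF that(1)] pI[OF that(1)] _ pF[OF that(2)] pI[OF that(2)]] by simp
    show "integrable lborel (\<lambda>x. g x * cnj (\<phi> P x))" if "P \<in> F" for P
      using packet_le_const[OF pF[OF that] pI[OF that]] packet_measurable[OF pF[OF that]]
      by (intro integrable_mult_bounded[OF gint, where B = "B / ltile P"]) auto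
    show "(\<Sum>P\<in>F. \<Sum>Q\<in>F. ltile P * ltile Q * cmod (ip g (\<phi> P)) * cmod (ip g (\<phi> Q)) *
        cmod (ip (\<phi> P) (\<phi> Q))) \<le> bessel_const B \<kappa> N * (\<Sum>P\<in>F. ltile P * (cmod (ip g (\<phi> P)))\<^sup>2)"
      using gram by (simp only: K_def S_def a_def)
  qed (use Cp g2 in auto)
  then have "N * S \<le> N * (bessel_const B \<kappa> N * (sqnorm g))" using N by (intro mult_left_mono) auto
  then show ?thesis using bigS by (simp add: mult.assoc)
qed

end

section \<open>Coverings by trees and the weak outer L2 estimate\<close>

lemma sum_le_sum_cover:
  fixes f :: "'a \<Rightarrow> real"
  assumes "finite W" "finite I" "\<And>x. x \<in> W \<Longrightarrow> 0 \<le> f x" and cov: "\<And>x. x \<in> W \<Longrightarrow> \<exists>i\<in>I. R i x"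
  shows "sum f W \<le> (\<Sum>i\<in>I. \<Sum>x | x \<in> W \<and> R i x. f x)"
proof -
  have "sum f W \<le> (\<Sum>x\<in>W. \<Sum>i\<in>I. if R i x then f x else 0)"
  proof (rule sum_mono)
    fix x assume x: "x \<in> W"
    obtain i where i: "i \<in> I" "R i x" using cov[OF x] by blast
    have "f x = (if R i x then f x else 0)" using i by simp
    also have "\<dots> \<le> (\<Sum>i\<in>I. if R i x then f x else 0)"
      using assms(2,3) i x by (intro member_le_sum[of i I "\<lambda>i. if R i x then f x else 0"]) auto
    finally show "f x \<le> (\<Sum>i\<in>I. if R i x then f x else 0)" .
  qed
  also have "\<dots> = (\<Sum>i\<in>I. \<Sum>x\<in>W. if R i x then f x else 0)" by (rule sum.swap)
  also have "\<dots> = (\<Sum>i\<in>I. \<Sum>x | x \<in> W \<and> R i x. f x)" using assms(1) by (simp add: sum.inter_filter)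
  finally show ?thesis .
qed

text \<open>The first term pays for the tiles with large coefficients, selected with
  \<open>N = 4\<close>. The second pays for \<open>2 * (\<kappa> + 1)\<close> classes of trees, one
  for each side of the top frequency and each residue of the scale, selected with
  \<open>N = 1\<close>.\<close>

definition weak_const :: "real \<Rightarrow> nat \<Rightarrow> real" where
  "weak_const B \<kappa> = 4 * bessel_const B \<kappa> 4 + 2 * real (\<kappa> + 1) * bessel_const B \<kappa> 1"

context dual_grid_pair
begin

text \<open>A finitary substitute for the outer measure, not divided by the length of
  \<open>J\<close>. Equality with the union, rather than inclusion, makes the covered set
  automatically a set of tiles in \<open>J\<close>.\<close>

definition covered :: "real set \<Rightarrow> nat \<Rightarrow> tile set \<Rightarrow> real \<Rightarrow> bool" where
  "covered J \<kappa> A c \<longleftrightarrow> (\<exists>H. finite H \<and> H \<subseteq> trees_in D D' J \<kappa> \<and> A = (\<Union>T\<in>H. tiles T) \<and>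
     (\<Sum>T\<in>H. ltop T) \<le> c)"

lemma tree_top_length_pos:
  assumes "T \<in> trees_in D D' J \<kappa>" shows "0 < ltop T"
proof -
  have "top_ivl T \<in> D" using assms by (simp add: trees_in_def is_tree_def)
  then show ?thesis by (rule proper_interval_length_pos[OF grid_proper[OF grid]])
qed

lemma covered_empty: "0 \<le> c \<Longrightarrow> covered J \<kappa> {} c"
  unfolding covered_def by (intro exI[of _ "{}"]) auto

lemma covered_subset: "covered J \<kappa> A c \<Longrightarrow> A \<subseteq> tiles_in D D' J"
  unfolding covered_def trees_in_def by blast

lemma covered_mono: "covered J \<kappa> A c \<Longrightarrow> c \<le> c' \<Longrightarrow> covered J \<kappa> A c'"
  unfolding covered_def by (elim exE conjE, rule exI, intro conjI) (assumption | erule (1) order_trans)+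

lemma covered_Un:
  assumes "covered J \<kappa> A c" "covered J \<kappa> A' c'"
  shows "covered J \<kappa> (A \<union> A') (c + c')"
proof -
  obtain H where H: "finite H" "H \<subseteq> trees_in D D' J \<kappa>" "A = (\<Union>T\<in>H. tiles T)" "(\<Sum>T\<in>H. ltop T) \<le> c"
    using assms(1) unfolding covered_def by blast
  obtain H' where H': "finite H'" "H' \<subseteq> trees_in D D' J \<kappa>" "A' = (\<Union>T\<in>H'. tiles T)" "(\<Sum>T\<in>H'. ltop T) \<le> c'"
    using assms(2) unfolding covered_def by blast
  have "(\<Sum>T\<in>H \<union> H'. ltop T) \<le> (\<Sum>T\<in>H. ltop T) + (\<Sum>T\<in>H'. ltop T)"
  proof -
    have "0 \<le> (\<Sum>T\<in>H \<inter> H'. ltop T)"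
      using H(2) by (intro sum_nonneg less_imp_le[OF tree_top_length_pos]) blast
    then show ?thesis using sum.union_inter[OF H(1) H'(1), of "\<lambda>T. ltop T"] by linarith
  qed
  then show ?thesis
    unfolding covered_def using H H' by (intro exI[of _ "H \<union> H'"]) auto
qed

lemma covered_UN:
  assumes "finite I" "\<And>i. i \<in> I \<Longrightarrow> covered J \<kappa> (A i) (c i)"
  shows "covered J \<kappa> (\<Union>i\<in>I. A i) (\<Sum>i\<in>I. c i)"
  using assms
proof (induction I rule: finite_induct)
  case (insert i I)
  then show ?case using covered_Un[of J \<kappa> "A i" "c i"] by auto
qed (auto intro: covered_empty)

lemma covered_outer_measure:
  assumes "covered J \<kappa> A c" "proper_interval J"
  shows "outer_measure_tiles D D' J \<kappa> A \<le> ennreal (c / ivl_length J)"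
proof -
  obtain H where H: "finite H" "H \<subseteq> trees_in D D' J \<kappa>" "A = (\<Union>T\<in>H. tiles T)" "(\<Sum>T\<in>H. ltop T) \<le> c"
    using assms(1) unfolding covered_def by blast
  have J: "0 < ivl_length J" by (rule proper_interval_length_pos[OF assms(2)])
  have tp: "0 < ltop T" if "T \<in> H" for T using H(2) that by (intro tree_top_length_pos) blast
  have "outer_measure_tiles D D' J \<kappa> A \<le> (\<Sum>\<^sub>\<infinity>T\<in>H. ennreal (ltop T)) / ennreal (ivl_length J)"
    unfolding outer_measure_tiles_def using H by (intro INF_lower) auto
  also have "(\<Sum>\<^sub>\<infinity>T\<in>H. ennreal (ltop T)) = ennreal (\<Sum>T\<in>H. ltop T)"
    using H(1) tp by (subst infsum_finite) (auto intro!: sum_ennreal intro: less_imp_le)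
  also have "\<dots> / ennreal (ivl_length J) = ennreal ((\<Sum>T\<in>H. ltop T) / ivl_length J)"
    using J tp by (intro divide_ennreal sum_nonneg) (auto intro: less_imp_le)
  also have "\<dots> \<le> ennreal (c / ivl_length J)" using H(4) J by (intro ennreal_leI divide_right_mono) auto
  finally show ?thesis .
qed

text \<open>The largest tree over the top data of \<open>U\<close>. Removing it whenever
  \<open>U\<close> is selected is what turns the absence of a conflict into separation in
  space.\<close>

definition full_tree :: "real set \<Rightarrow> nat \<Rightarrow> tree \<Rightarrow> tree" where
  "full_tree J \<kappa> U = \<lparr>tiles = {P \<in> tiles_in D D' J. fst P \<subseteq> top_ivl U \<and> top_freq U \<in> dyadic_ancestor D' \<kappa> (snd P)},
     top_ivl = top_ivl U, top_freq = top_freq U\<rparr>"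

lemma full_tree_in: "U \<in> trees_in D D' J \<kappa> \<Longrightarrow> full_tree J \<kappa> U \<in> trees_in D D' J \<kappa>"
  unfolding trees_in_def is_tree_def full_tree_def tiles_in_def by auto

lemma tiles_full_tree: "U \<in> trees_in D D' J \<kappa> \<Longrightarrow> tiles U \<subseteq> tiles (full_tree J \<kappa> U)"
  unfolding trees_in_def is_tree_def full_tree_def by auto

text \<open>A tree conflicts with \<open>U\<close> when it meets the full tree of \<open>U\<close>.
  By hypothesis on \<open>key\<close>, a tree with a tile coarser in frequency than a tile of
  \<open>U\<close> that it meets has smaller key, so if both are selected it avoids the full tree of
  \<open>U\<close>. Its tile satisfies the frequency condition of that full tree, so it must fail
  the spatial one.\<close>

lemma tree_selection:
  fixes g :: "real \<Rightarrow> complex" and key :: "tree \<Rightarrow> real"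
  assumes G: "finite G" "G \<subseteq> trees_in D D' J \<kappa>"
    and fin: "\<And>U. U \<in> G \<Longrightarrow> finite (tiles U)" and ne: "\<And>U. U \<in> G \<Longrightarrow> tiles U \<noteq> {}"
    and lac: "\<And>U. U \<in> G \<Longrightarrow> lacunary U"
    and key: "\<And>U V P Q. U \<in> G \<Longrightarrow> V \<in> G \<Longrightarrow> P \<in> tiles U \<Longrightarrow> Q \<in> tiles V \<Longrightarrow>
        snd P \<inter> snd Q \<noteq> {} \<Longrightarrow> ltile Q < ltile P \<Longrightarrow> key V < key U"
    and p: "\<And>U P. U \<in> G \<Longrightarrow> P \<in> tiles U \<Longrightarrow> packet B 6 P (\<phi> P)"
    and gint: "integrable lborel g" and g2: "integrable lborel (\<lambda>x. (cmod (g x))\<^sup>2)"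
  defines "a \<equiv> \<lambda>P. cmod (ip g (\<phi> P))"
  assumes \<Lambda>: "\<And>U P. U \<in> G \<Longrightarrow> P \<in> tiles U \<Longrightarrow> a P \<le> \<Lambda>" "0 < \<Lambda>" and N: "0 \<le> N" and B: "0 < B"
    and big: "\<And>U. U \<in> G \<Longrightarrow> \<Lambda>\<^sup>2 * ltop U \<le> N * (\<Sum>P\<in>tiles U. ltile P * (a P)\<^sup>2)"
  shows "\<exists>A. covered J \<kappa> A (N * bessel_const B \<kappa> N * (sqnorm g) / \<Lambda>\<^sup>2) \<and>
    (\<forall>V\<in>G. tiles V \<inter> A \<noteq> {})"
proof -
  define conf where "conf U V \<longleftrightarrow> tiles V \<inter> tiles (full_tree J \<kappa> U) \<noteq> {}" for U V :: tree
  from greedy_selection[OF G(1), of key conf] obtain H where H: "H \<subseteq> G"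
    and sel': "\<forall>U\<in>H. \<forall>V\<in>H. U \<noteq> V \<longrightarrow> (key V \<le> key U \<and> \<not> conf U V) \<or> (key U \<le> key V \<and> \<not> conf V U)"
    and cov': "\<forall>V\<in>G. \<exists>U\<in>H. U = V \<or> conf U V" by (elim exE conjE)
  have sel: "(key V \<le> key U \<and> \<not> conf U V) \<or> (key U \<le> key V \<and> \<not> conf V U)" if "U \<in> H" "V \<in> H" "U \<noteq> V" for U V
    by (rule sel'[rule_format, OF that])
  have cov: "\<exists>U\<in>H. U = V \<or> conf U V" if "V \<in> G" for V by (rule cov'[rule_format, OF that])
  have HT: "U \<in> trees_in D D' J \<kappa>" if "U \<in> H" for U using that H G by blast
  have isT: "is_tree D D' \<kappa> U" "tiles U \<subseteq> tiles_in D D' J" if "U \<in> H" for U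
    using HT[OF that] by (auto simp: trees_in_def)
  have finH: "finite H" using H G(1) finite_subset by blast
  have main: "\<Lambda>\<^sup>2 * (\<Sum>U\<in>H. ltop U) \<le> N * bessel_const B \<kappa> N * (sqnorm g)"
  proof (rule selected_trees_bessel[OF finH])
    fix U V assume UV: "U \<in> H" "V \<in> H" "U \<noteq> V"
    show "tiles U \<inter> tiles V = {}"
      using sel[OF UV] tiles_full_tree[OF HT[OF UV(1)]] tiles_full_tree[OF HT[OF UV(2)]] unfolding conf_def by blast
  next
    fix U V P Q assume UV: "U \<in> H" "V \<in> H" "U \<noteq> V" and PQ: "P \<in> tiles U" "Q \<in> tiles V"
      and meet: "snd P \<inter> snd Q \<noteq> {}" and len: "ltile Q < ltile P"
    have "key V < key U" using key[OF _ _ PQ meet len] UV H by blast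
    then have "\<not> conf U V" using sel[OF UV] by auto
    then have Qn: "Q \<notin> tiles (full_tree J \<kappa> U)" using PQ unfolding conf_def by blast
    have QJ: "Q \<in> tiles_in D D' J" using isT(2)[OF UV(2)] PQ(2) by blast
    have t: "P \<in> all_tiles D D'" "Q \<in> all_tiles D D'" using isT(1)[OF UV(1)] isT(1)[OF UV(2)] PQ unfolding is_tree_def by blast+
    have PU: "fst P \<subseteq> top_ivl U" "top_freq U \<in> dyadic_ancestor D' \<kappa> (snd P)" "top_ivl U \<in> D"
      using isT(1)[OF UV(1)] PQ(1) unfolding is_tree_def by blast+
    note aP = grid_ancestor[OF grid' tile_mem(2)[OF t(1)], of \<kappa>]
    note aQ = grid_ancestor[OF grid' tile_mem(2)[OF t(2)], of \<kappa>]
    obtain x where x: "x \<in> snd P" "x \<in> snd Q" using meet by blast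
    have "ivl_length (snd P) < ivl_length (snd Q)"
      unfolding tile_freq_length[OF t(1)] tile_freq_length[OF t(2)]
      using len tile_length_pos[OF t(2)] by (intro divide_strict_left_mono) auto
    then have "ivl_length (dyadic_ancestor D' \<kappa> (snd P)) < ivl_length (dyadic_ancestor D' \<kappa> (snd Q))"
      unfolding aP(3) aQ(3) by simp
    moreover have "x \<in> dyadic_ancestor D' \<kappa> (snd P)" "x \<in> dyadic_ancestor D' \<kappa> (snd Q)" using x aP(2) aQ(2) by blast+
    \<comment> \<open>The longer frequency interval has the longer ancestor, and the ancestors meet.
      So the top frequency of \<open>U\<close> also lies in the ancestor for
      \<open>Q\<close>.\<close>
    ultimately have "dyadic_ancestor D' \<kappa> (snd P) \<subseteq> dyadic_ancestor D' \<kappa> (snd Q)"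
      using grid_subset[OF grid' aP(1) aQ(1)] by blast
    then have "top_freq U \<in> dyadic_ancestor D' \<kappa> (snd Q)" using PU(2) by blast
    then have nsub: "\<not> fst Q \<subseteq> top_ivl U" using Qn QJ unfolding full_tree_def by simp
    have "ltile P \<le> ltop U"
      by (rule proper_interval_subset(3)[OF tile_proper(1)[OF t(1)] grid_proper[OF grid PU(3)] PU(1)])
    then have "ltile Q < ltop U" using len by linarith
    then show "fst Q \<inter> top_ivl U = {}" using grid_subset[OF grid tile_mem(1)[OF t(2)] PU(3)] nsub by blast
  next
    fix U assume U: "U \<in> H"
    then have UG: "U \<in> G" using H by blast
    show "finite (tiles U)" "lacunary U" "is_tree D D' \<kappa> U" using fin[OF UG] lac[OF UG] isT(1)[OF U] by blast+
    show "\<Lambda>\<^sup>2 * ltop U \<le> N * (\<Sum>P\<in>tiles U. ltile P * (cmod (ip g (\<phi> P)))\<^sup>2)"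
      using big[OF UG] unfolding a_def .
    fix P assume P: "P \<in> tiles U"
    show "packet B 6 P (\<phi> P)" "cmod (ip g (\<phi> P)) \<le> \<Lambda>"
      using p[OF UG P] \<Lambda>(1)[OF UG P] unfolding a_def by blast+
  qed (use gint g2 N B in auto)
  define A where "A = (\<Union>U\<in>H. tiles (full_tree J \<kappa> U))"
  have "covered J \<kappa> A (\<Sum>U\<in>H. ltop U)"
    unfolding covered_def
  proof (intro exI[of _ "full_tree J \<kappa> ` H"] conjI)
    have top: "top_ivl (full_tree J \<kappa> U) = top_ivl U" for U by (simp add: full_tree_def)
    have "(\<Sum>T\<in>full_tree J \<kappa> ` H. ltop T) \<le> sum ((\<lambda>T. ltop T) \<circ> full_tree J \<kappa>) H"
      using finH by (intro sum_image_le) (auto simp: top intro!: less_imp_le[OF tree_top_length_pos[OF HT]])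
    then show "(\<Sum>T\<in>full_tree J \<kappa> ` H. ltop T) \<le> (\<Sum>U\<in>H. ltop U)"
      by (simp add: top o_def)
  qed (use finH HT full_tree_in in \<open>auto simp: A_def\<close>)
  moreover have "(\<Sum>U\<in>H. ltop U) \<le> N * bessel_const B \<kappa> N * (sqnorm g) / \<Lambda>\<^sup>2"
    using main \<Lambda>(2) by (simp add: pos_le_divide_eq mult.commute)
  ultimately have "covered J \<kappa> A (N * bessel_const B \<kappa> N * (sqnorm g) / \<Lambda>\<^sup>2)" by (rule covered_mono)
  moreover have "tiles V \<inter> A \<noteq> {}" if V: "V \<in> G" for V
  proof -
    obtain U where U: "U \<in> H" "U = V \<or> conf U V" using cov[OF V] by blast
    have "tiles V \<inter> tiles (full_tree J \<kappa> U) \<noteq> {}"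
      using U(2) tiles_full_tree[OF HT[OF U(1)]] ne[OF V] unfolding conf_def by blast
    then show ?thesis using U(1) unfolding A_def by blast
  qed
  ultimately show ?thesis by blast
qed

definition tile_scale :: "tile \<Rightarrow> int" where
  "tile_scale P = (SOME k. ltile P = \<rho> * 2 powi k)"

lemma tile_scale: "P \<in> all_tiles D D' \<Longrightarrow> ltile P = \<rho> * 2 powi tile_scale P"
  unfolding tile_scale_def using grid_length[OF grid tile_mem(1)] by (rule someI_ex)

text \<open>Different exponents in one residue class modulo \<open>\<kappa> + 1\<close> differ by at
  least \<open>\<kappa> + 1\<close>. The resulting ratio exceeds \<open>2^\<kappa>\<close>, the
  ratio of an ancestor to its interval, by one more factor 2.\<close>

lemma tile_scale_separated:
  assumes t: "P \<in> all_tiles D D'" "Q \<in> all_tiles D D'" and len: "ltile Q < ltile P"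
    and res: "tile_scale P mod int (\<kappa> + 1) = tile_scale Q mod int (\<kappa> + 1)"
  shows "2 * 2 ^ \<kappa> * ltile Q \<le> ltile P"
proof -
  have \<rho>: "0 < \<rho>" using grid by (auto simp: dyadic_grid_def)
  have "tile_scale Q < tile_scale P"
  proof (rule ccontr)
    assume "\<not> tile_scale Q < tile_scale P"
    then have "(2::real) powi tile_scale P \<le> 2 powi tile_scale Q" by (intro power_int_increasing) auto
    then show False using len \<rho> tile_scale[OF t(1)] tile_scale[OF t(2)] by (simp add: not_le[symmetric])
  qed
  moreover have "int (\<kappa> + 1) dvd tile_scale P - tile_scale Q" using res by (simp only: mod_eq_dvd_iff)
  ultimately have "int (\<kappa> + 1) \<le> tile_scale P - tile_scale Q" by (intro zdvd_imp_le) auto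
  then have "(2::real) powi (tile_scale Q + int (\<kappa> + 1)) \<le> 2 powi tile_scale P" by (intro power_int_increasing) auto
  then have "\<rho> * 2 powi (tile_scale Q + int (\<kappa> + 1)) \<le> \<rho> * 2 powi tile_scale P" using \<rho> by (intro mult_left_mono) auto
  moreover have "(2::real) powi (tile_scale Q + int (\<kappa> + 1)) = 2 powi tile_scale Q * 2 ^ (\<kappa> + 1)"
    using power_int_add[of "2::real" "tile_scale Q" "int (\<kappa> + 1)"] by (simp only: power_int_of_nat) simp
  ultimately show ?thesis by (simp add: tile_scale[OF t(1)] tile_scale[OF t(2)] mult_ac)
qed

text \<open>Tiles with coefficient between \<open>2^j * \<tau>\<close> and
  \<open>2^(j+1) * \<tau>\<close> are selected as one-tile trees, with the tile length as key. On
  such a level the squares of the coefficients agree up to 4, hence \<open>N = 4\<close>. The costs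
  decrease like \<open>4^-j\<close> and add up. Afterwards every remaining coefficient is at most
  \<tau>, as selecting larger trees requires.\<close>

lemma large_tiles_covered:
  fixes g :: "real \<Rightarrow> complex"
  assumes PP: "finite PP" "PP \<subseteq> tiles_in D D' J" and p: "\<And>P. P \<in> PP \<Longrightarrow> packet B 6 P (\<phi> P)"
    and gint: "integrable lborel g" and g2: "integrable lborel (\<lambda>x. (cmod (g x))\<^sup>2)" and B: "0 < B" and \<tau>: "0 < \<tau>"
  defines "a \<equiv> \<lambda>P. cmod (ip g (\<phi> P))"
  shows "\<exists>A. covered J \<kappa> A (4 * bessel_const B \<kappa> 4 * (sqnorm g) / \<tau>\<^sup>2) \<and> (\<forall>P\<in>PP. \<tau> < a P \<longrightarrow> P \<in> A)"
proof -
  define G2 where "G2 = (sqnorm g)"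
  have G20: "0 \<le> G2" by (simp add: G2_def)
  define single where "single P = \<lparr>tiles = {P}, top_ivl = fst P, top_freq = ivl_center (snd P)\<rparr>" for P :: tile
  have t: "P \<in> all_tiles D D'" if "P \<in> PP" for P using PP(2) that by (auto simp: tiles_in_def)
  have single_in: "single P \<in> trees_in D D' J \<kappa>" if P: "P \<in> PP" for P
  proof -
    have "ivl_center (snd P) \<in> dyadic_ancestor D' \<kappa> (snd P)"
      using grid_ancestor(2)[OF grid' tile_mem(2)[OF t[OF P]]] ivl_center_mem[OF tile_proper(2)[OF t[OF P]]] by blast
    then show ?thesis
      using t[OF P] PP(2) P tile_mem(1)[OF t[OF P]] unfolding single_def trees_in_def is_tree_def by simp blast
  qed
  define level where "level j = {P \<in> PP. 2 ^ j * \<tau> < a P \<and> a P \<le> 2 ^ (j + 1) * \<tau>}" for j :: nat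
  have "\<exists>A. covered J \<kappa> A (4 * bessel_const B \<kappa> 4 * G2 / (2 ^ (j + 1) * \<tau>)\<^sup>2) \<and> (\<forall>V\<in>single ` level j. tiles V \<inter> A \<noteq> {})" for j
    unfolding G2_def
  proof (rule tree_selection[where \<phi> = \<phi> and key = "\<lambda>U. ltop U"])
    show "finite (single ` level j)" using PP(1) by (simp add: level_def)
    show "single ` level j \<subseteq> trees_in D D' J \<kappa>" using single_in by (auto simp: level_def)
    show "cmod (ip g (\<phi> P)) \<le> 2 ^ (j + 1) * \<tau>" if "U \<in> single ` level j" "P \<in> tiles U" for U P
    proof -
      have "P \<in> level j" using that by (auto simp only: single_def image_iff tree.simps)
      then show ?thesis by (simp add: level_def a_def)
    qed
    show "packet B 6 P (\<phi> P)" if "U \<in> single ` level j" "P \<in> tiles U" for U P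
    proof -
      have "P \<in> level j" using that by (auto simp only: single_def image_iff tree.simps)
      then show ?thesis using p by (simp add: level_def)
    qed
    show "ltop V < ltop U"
      if "U \<in> single ` level j" "V \<in> single ` level j" "P \<in> tiles U" "Q \<in> tiles V" "snd P \<inter> snd Q \<noteq> {}" "ltile Q < ltile P" for U V P Q
      using that by (auto simp only: single_def image_iff tree.simps)
    show "(2 ^ (j + 1) * \<tau>)\<^sup>2 * ltop U \<le> 4 * (\<Sum>P\<in>tiles U. ltile P * (cmod (ip g (\<phi> P)))\<^sup>2)"
      if U: "U \<in> single ` level j" for U
    proof -
      obtain P where P: "P \<in> level j" "U = single P" using U by blast
      have "0 < ltile P" using tile_length_pos[OF t] P(1) by (simp add: level_def)
      moreover have "(2 ^ (j + 1) * \<tau>)\<^sup>2 \<le> (2 * a P)\<^sup>2" using P(1) \<tau> by (intro power_mono) (auto simp: level_def)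
      ultimately have "(2 ^ (j + 1) * \<tau>)\<^sup>2 * ltile P \<le> (2 * a P)\<^sup>2 * ltile P" by (intro mult_right_mono) auto
      then show ?thesis unfolding P(2) by (simp add: single_def a_def power_mult_distrib mult_ac)
    qed
  qed (use B \<tau> gint g2 in \<open>auto simp: single_def lacunary_def\<close>)
  then obtain Aj where Aj: "\<And>j. covered J \<kappa> (Aj j) (4 * bessel_const B \<kappa> 4 * G2 / (2 ^ (j + 1) * \<tau>)\<^sup>2)"
    and hit: "\<And>j V. V \<in> single ` level j \<Longrightarrow> tiles V \<inter> Aj j \<noteq> {}" by metis
  obtain M where M: "\<And>P. P \<in> PP \<Longrightarrow> a P \<le> M"
    using PP(1) by (metis Max_ge finite_imageI imageI)
  obtain n where n: "M / \<tau> < 2 ^ n" using real_arch_pow[of 2 "M / \<tau>"] by auto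
  define A where "A = (\<Union>j\<in>{..<n}. Aj j)"
  have geo: "(\<Sum>j<n. (1/4::real) ^ (j + 1)) \<le> 1"
  proof -
    have "(\<Sum>j<n. (1/4::real) ^ (j + 1)) = (1 - (1/4) ^ n) / 3"
    proof (induction n)
      case (Suc n)
      have "(1 - q) / 3 + q * (1/4) = (1 - q * (1/4)) / 3" for q :: real by (simp add: field_simps)
      then show ?case unfolding sum.lessThan_Suc Suc.IH by (simp only: power_Suc2 Suc_eq_plus1[symmetric])
    qed simp
    also have "\<dots> \<le> 1 / 3" by (intro divide_right_mono) auto
    finally show ?thesis by simp
  qed
  have bc: "0 \<le> bessel_const B \<kappa> 4" by (simp add: bessel_const_def)
  have "covered J \<kappa> A (\<Sum>j<n. 4 * bessel_const B \<kappa> 4 * G2 / (2 ^ (j + 1) * \<tau>)\<^sup>2)"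
    unfolding A_def by (intro covered_UN Aj) auto
  moreover have "(\<Sum>j<n. 4 * bessel_const B \<kappa> 4 * G2 / (2 ^ (j + 1) * \<tau>)\<^sup>2) \<le> 4 * bessel_const B \<kappa> 4 * G2 / \<tau>\<^sup>2"
  proof -
    have pw: "((2::real) ^ (j + 1) * \<tau>)\<^sup>2 = 4 ^ (j + 1) * \<tau>\<^sup>2" for j :: nat
    proof -
      have "((2::real) ^ (j + 1))\<^sup>2 = (2\<^sup>2) ^ (j + 1)" by (simp only: power_mult[symmetric] mult.commute)
      then show ?thesis by (simp add: power_mult_distrib)
    qed
    have "(\<Sum>j<n. 4 * bessel_const B \<kappa> 4 * G2 / (2 ^ (j + 1) * \<tau>)\<^sup>2) = (\<Sum>j<n. 4 * bessel_const B \<kappa> 4 * G2 / \<tau>\<^sup>2 * (1/4) ^ (j + 1))"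
      unfolding pw by (intro sum.cong refl) (simp add: power_one_over field_simps)
    also have "\<dots> = 4 * bessel_const B \<kappa> 4 * G2 / \<tau>\<^sup>2 * (\<Sum>j<n. (1/4) ^ (j + 1))" by (rule sum_distrib_left[symmetric])
    also have "\<dots> \<le> 4 * bessel_const B \<kappa> 4 * G2 / \<tau>\<^sup>2 * 1" using geo bc G20 by (intro mult_left_mono) auto
    finally show ?thesis by simp
  qed
  ultimately have "covered J \<kappa> A (4 * bessel_const B \<kappa> 4 * G2 / \<tau>\<^sup>2)" by (rule covered_mono)
  moreover have "P \<in> A" if P: "P \<in> PP" and big: "\<tau> < a P" for P
  proof -
    have up: "a P \<le> 2 ^ n * \<tau>" using M[OF P] n \<tau> by (simp add: divide_less_eq)
    define j where "j = (LEAST j. a P \<le> 2 ^ (j + 1) * \<tau>)"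
    have "n \<noteq> 0" using up big by (cases n) auto
    then have ex: "a P \<le> 2 ^ ((n - 1) + 1) * \<tau>" using up by simp
    have j1: "a P \<le> 2 ^ (j + 1) * \<tau>" unfolding j_def using ex by (rule LeastI)
    have jn: "j < n" using Least_le[of "\<lambda>j. a P \<le> 2 ^ (j + 1) * \<tau>", OF ex] \<open>n \<noteq> 0\<close> by (simp add: j_def)
    have j2: "2 ^ j * \<tau> < a P"
    proof (cases j)
      case 0 then show ?thesis using big by simp
    next
      case (Suc i)
      then have "\<not> a P \<le> 2 ^ (i + 1) * \<tau>" using not_less_Least[of i "\<lambda>j. a P \<le> 2 ^ (j + 1) * \<tau>"] by (simp add: j_def)
      then show ?thesis using Suc by simp
    qed
    have "single P \<in> single ` level j" using P j1 j2 by (simp add: level_def)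
    from hit[OF this] have "P \<in> Aj j" by (simp add: single_def)
    then show ?thesis using jn by (auto simp: A_def)
  qed
  ultimately show ?thesis unfolding G2_def by blast
qed

text \<open>A lacunary tree splits into the tiles whose frequency interval contains the top frequency, and
  into classes of tiles on one fixed side of it with scales in a fixed residue class modulo \<open>\<kappa> + 1\<close>.
  Within a class, two tiles of different scales with meeting frequency intervals are so far apart in scale
  that the \<open>\<kappa>\<close>-th ancestor of the smaller frequency interval lies in the larger one. Hence selecting
  trees in the order of their top frequencies separates them in space.\<close>

lemma weak_L2:
  fixes g :: "real \<Rightarrow> complex"
  assumes PP: "finite PP" "PP \<subseteq> tiles_in D D' J" and p: "\<And>P. P \<in> PP \<Longrightarrow> packet B 6 P (\<phi> P)"
    and gint: "integrable lborel g" and g2: "integrable lborel (\<lambda>x. (cmod (g x))\<^sup>2)" and B: "0 < B" and \<tau>: "0 < \<tau>"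
  defines "a \<equiv> \<lambda>P. cmod (ip g (\<phi> P))"
  shows "\<exists>A. covered J \<kappa> A (weak_const B \<kappa> * (sqnorm g) / \<tau>\<^sup>2) \<and>
    (\<forall>U\<in>trees_in D D' J \<kappa>. lacunary U \<longrightarrow>
      (\<Sum>P\<in>PP \<inter> tiles U - A. ltile P * (a P)\<^sup>2) \<le> (2 * real (\<kappa> + 1) + 4) * \<tau>\<^sup>2 * ltop U)"
proof -
  define G2 where "G2 = (sqnorm g)"
  have G20: "0 \<le> G2" by (simp add: G2_def)
  have t: "P \<in> all_tiles D D'" if "P \<in> PP" for P using PP(2) that by (auto simp: tiles_in_def)
  obtain A1 where A1: "covered J \<kappa> A1 (4 * bessel_const B \<kappa> 4 * G2 / \<tau>\<^sup>2)" "\<And>P. P \<in> PP \<Longrightarrow> \<tau> < a P \<Longrightarrow> P \<in> A1"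
    using large_tiles_covered[OF PP p gint g2 B \<tau>, of \<kappa>] unfolding a_def G2_def by blast
  define PP' where "PP' = PP - A1"
  have PP': "finite PP'" "PP' \<subseteq> PP" "\<And>P. P \<in> PP' \<Longrightarrow> a P \<le> \<tau>"
    using PP A1(2) by (auto simp: PP'_def not_less[symmetric])
  \<comment> \<open>The sign \<open>s\<close> records on which side of \<xi> the frequency interval
    lies, the number \<open>c\<close> the residue of the scale.\<close>
  define cls where "cls s c \<xi> P \<longleftrightarrow> (\<forall>x\<in>snd P. 0 < s * (x - \<xi>)) \<and> tile_scale P mod int (\<kappa> + 1) = c"
    for s \<xi> :: real and c :: int and P :: tile
  define good where "good s c U \<longleftrightarrow> U \<in> trees_in D D' J \<kappa> \<and> lacunary U \<and> (\<forall>P\<in>tiles U. cls s c (top_freq U) P) \<and>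
     \<tau>\<^sup>2 * ltop U < (\<Sum>P\<in>tiles U. ltile P * (a P)\<^sup>2)" for s c U
  define I where "I = {-1, 1 :: real} \<times> {0..<int (\<kappa> + 1)}"
  have I: "finite I" "card I = 2 * (\<kappa> + 1)" by (auto simp: I_def card_cartesian_product)
  have "\<exists>A. covered J \<kappa> A (1 * bessel_const B \<kappa> 1 * G2 / \<tau>\<^sup>2) \<and> (\<forall>V. good s c V \<longrightarrow> tiles V \<subseteq> PP' \<longrightarrow> tiles V \<inter> A \<noteq> {})" for s c
  proof -
    \<comment> \<open>Trees with the same tiles may carry infinitely many different top data. One
      good tree is kept for each set of tiles, so that the selection runs over a finite
      family.\<close>
    define VV where "VV = {V. V \<subseteq> PP' \<and> (\<exists>U. good s c U \<and> tiles U = V)}"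
    define rep where "rep V = (SOME U. good s c U \<and> tiles U = V)" for V
    have rep: "good s c (rep V) \<and> tiles (rep V) = V" if "V \<in> VV" for V
      unfolding rep_def by (rule someI_ex) (use that in \<open>simp add: VV_def\<close>)
    define G where "G = rep ` VV"
    have G: "good s c U" "tiles U \<subseteq> PP'" if U: "U \<in> G" for U
    proof -
      obtain V where "V \<in> VV" "U = rep V" using U by (auto simp: G_def)
      then show "good s c U" "tiles U \<subseteq> PP'" using rep[of V] by (auto simp: VV_def)
    qed
    have "VV \<subseteq> Pow PP'" unfolding VV_def by blast
    then have finG: "finite G" unfolding G_def using PP'(1) finite_subset by (intro finite_imageI) blast
    have "\<exists>A. covered J \<kappa> A (1 * bessel_const B \<kappa> 1 * G2 / \<tau>\<^sup>2) \<and> (\<forall>V\<in>G. tiles V \<inter> A \<noteq> {})"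
      unfolding G2_def
    proof (rule tree_selection[where \<phi> = \<phi> and key = "\<lambda>U. s * top_freq U", OF finG])
      show "G \<subseteq> trees_in D D' J \<kappa>" using G(1) unfolding good_def by blast
      show "finite (tiles U)" if "U \<in> G" for U using G(2)[OF that] PP'(1) finite_subset by blast
      show "lacunary U" if "U \<in> G" for U using G(1)[OF that] unfolding good_def by blast
      show "tiles U \<noteq> {}" if U: "U \<in> G" for U
      proof
        assume "tiles U = {}"
        moreover have "0 < ltop U" using G(1)[OF U] tree_top_length_pos unfolding good_def by blast
        ultimately show False using G(1)[OF U] \<tau> unfolding good_def by (simp add: mult_less_0_iff)
      qed
      show "packet B 6 P (\<phi> P)" if "U \<in> G" "P \<in> tiles U" for U P using G(2)[OF that(1)] that(2) PP'(2) p by blast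
      show "cmod (ip g (\<phi> P)) \<le> \<tau>" if "U \<in> G" "P \<in> tiles U" for U P
        using G(2)[OF that(1)] that(2) PP'(3)[of P] unfolding a_def by blast
      show "\<tau>\<^sup>2 * ltop U \<le> 1 * (\<Sum>P\<in>tiles U. ltile P * (cmod (ip g (\<phi> P)))\<^sup>2)" if "U \<in> G" for U
        using G(1)[OF that] unfolding good_def a_def by simp
      show "s * top_freq V < s * top_freq U"
        if UV: "U \<in> G" "V \<in> G" and PQ: "P \<in> tiles U" "Q \<in> tiles V" and meet: "snd P \<inter> snd Q \<noteq> {}" and len: "ltile Q < ltile P" for U V P Q
      proof -
        have tt: "P \<in> all_tiles D D'" "Q \<in> all_tiles D D'" using G(2) UV PQ PP'(2) t by blast+
        have cU: "cls s c (top_freq U) P" and cV: "cls s c (top_freq V) Q" using G(1) UV PQ unfolding good_def by blast+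
        \<comment> \<open>The separation of scales places the ancestor of \<open>snd P\<close>
          inside \<open>snd Q\<close>. It contains the top frequency of \<open>U\<close>, whereas
          all of \<open>snd Q\<close> lies on the side \<open>s\<close> of the top frequency of
          \<open>V\<close>; this orders the two top frequencies.\<close>
        have sep: "2 * 2 ^ \<kappa> * ltile Q \<le> ltile P"
          using cU cV by (intro tile_scale_separated[OF tt len]) (simp only: cls_def)
        note anc = grid_ancestor[OF grid' tile_mem(2)[OF tt(1)], of \<kappa>]
        have l: "0 < ltile P" "0 < ltile Q" using tt tile_length_pos by blast+
        have "2 ^ \<kappa> * ltile Q < 2 * 2 ^ \<kappa> * ltile Q" using l by simp
        then have "2 ^ \<kappa> * ltile Q < ltile P" using sep by linarith
        then have "ivl_length (dyadic_ancestor D' \<kappa> (snd P)) < ivl_length (snd Q)"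
          unfolding anc(3) tile_freq_length[OF tt(1)] tile_freq_length[OF tt(2)] using l by (simp add: field_simps)
        moreover obtain x where "x \<in> snd P" "x \<in> snd Q" using meet by blast
        ultimately have "dyadic_ancestor D' \<kappa> (snd P) \<subseteq> snd Q"
          using grid_subset[OF grid' anc(1) tile_mem(2)[OF tt(2)]] anc(2) by blast
        moreover have "top_freq U \<in> dyadic_ancestor D' \<kappa> (snd P)"
          using G(1)[OF UV(1)] PQ(1) unfolding good_def trees_in_def is_tree_def by blast
        ultimately have "0 < s * (top_freq U - top_freq V)" using cV unfolding cls_def by blast
        then show ?thesis by (simp add: right_diff_distrib)
      qed
    qed (use B \<tau> gint g2 in auto)
    then obtain A where A: "covered J \<kappa> A (1 * bessel_const B \<kappa> 1 * G2 / \<tau>\<^sup>2)" "\<And>V. V \<in> G \<Longrightarrow> tiles V \<inter> A \<noteq> {}" by blast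
    have "tiles V \<inter> A \<noteq> {}" if V: "good s c V" "tiles V \<subseteq> PP'" for V
    proof -
      have "tiles V \<in> VV" using V unfolding VV_def by blast
      then have "rep (tiles V) \<in> G" "tiles (rep (tiles V)) = tiles V" using rep unfolding G_def by blast+
      then show ?thesis using A(2) by metis
    qed
    then show ?thesis using A(1) by blast
  qed
  then obtain A2 where A2: "\<And>s c. covered J \<kappa> (A2 s c) (1 * bessel_const B \<kappa> 1 * G2 / \<tau>\<^sup>2)"
    and hit: "\<And>s c V. good s c V \<Longrightarrow> tiles V \<subseteq> PP' \<Longrightarrow> tiles V \<inter> A2 s c \<noteq> {}" by metis
  define A where "A = A1 \<union> (\<Union>i\<in>I. A2 (fst i) (snd i))"
  have "covered J \<kappa> A (4 * bessel_const B \<kappa> 4 * G2 / \<tau>\<^sup>2 + (\<Sum>i\<in>I. 1 * bessel_const B \<kappa> 1 * G2 / \<tau>\<^sup>2))"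
    unfolding A_def by (intro covered_Un A1 covered_UN A2 I)
  moreover have "4 * bessel_const B \<kappa> 4 * G2 / \<tau>\<^sup>2 + (\<Sum>i\<in>I. 1 * bessel_const B \<kappa> 1 * G2 / \<tau>\<^sup>2) = weak_const B \<kappa> * G2 / \<tau>\<^sup>2"
    by (simp add: I(2) weak_const_def distrib_right add_divide_distrib)
  ultimately have "covered J \<kappa> A (weak_const B \<kappa> * G2 / \<tau>\<^sup>2)" by simp
  moreover have "(\<Sum>P\<in>PP \<inter> tiles U - A. ltile P * (a P)\<^sup>2) \<le> (2 * real (\<kappa> + 1) + 4) * \<tau>\<^sup>2 * ltop U"
    if U: "U \<in> trees_in D D' J \<kappa>" "lacunary U" for U
  proof -
    define W where "W = PP \<inter> tiles U - A"
    define \<xi> L where "\<xi> = top_freq U" and "L = ltop U"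
    have L: "0 < L" using tree_top_length_pos[OF U(1)] by (simp add: L_def)
    have W: "finite W" "W \<subseteq> PP'" "W \<subseteq> tiles U" "W \<inter> A = {}" using PP(1) by (auto simp: W_def PP'_def A_def)
    have tW: "P \<in> all_tiles D D'" if "P \<in> W" for P using W(2) PP'(2) t that by blast
    have lW: "0 < ltile P" if "P \<in> W" for P using tile_length_pos[OF tW[OF that]] .
    have top: "top_ivl U \<in> D" and sub: "fst P \<subseteq> top_ivl U" if "P \<in> tiles U" for P
      using U(1) that unfolding trees_in_def is_tree_def by blast+
    have topD: "top_ivl U \<in> D" using U(1) unfolding trees_in_def is_tree_def by blast
    let ?f = "\<lambda>P. ltile P * (a P)\<^sup>2"
    \<comment> \<open>\<open>None\<close> stands for the tiles whose frequency interval contains the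
      top frequency, \<open>Some\<close> for the classes by side and residue. The classes need only
      cover \<open>W\<close>, as all terms are nonnegative.\<close>
    define R where "R i P \<longleftrightarrow> (case i of None \<Rightarrow> \<xi> \<in> snd P | Some j \<Rightarrow> cls (fst j) (snd j) \<xi> P)" for i :: "(real \<times> int) option" and P :: tile
    have "sum ?f W \<le> (\<Sum>i\<in>insert None (Some ` I). \<Sum>P | P \<in> W \<and> R i P. ?f P)"
    proof (rule sum_le_sum_cover)
      fix P assume P: "P \<in> W"
      show "0 \<le> ?f P" using lW[OF P] by simp
      show "\<exists>i\<in>insert None (Some ` I). R i P"
      proof (cases "\<xi> \<in> snd P")
        case True then show ?thesis by (auto simp: R_def)
      next
        case False
        define c where "c = tile_scale P mod int (\<kappa> + 1)"
        have c: "c \<in> {0..<int (\<kappa> + 1)}" by (simp add: c_def)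
        have iv: "is_interval (snd P)" using tile_proper(2)[OF tW[OF P]] by (simp add: proper_interval_def)
        have "(\<forall>x\<in>snd P. \<xi> < x) \<or> (\<forall>x\<in>snd P. x < \<xi>)"
        proof (rule ccontr)
          assume "\<not> ?thesis"
          then obtain x y where "x \<in> snd P" "x \<le> \<xi>" "y \<in> snd P" "\<xi> \<le> y" by (auto simp: not_less)
          then show False using False iv unfolding is_interval_1 by blast
        qed
        then have "cls 1 c \<xi> P \<or> cls (-1) c \<xi> P" by (auto simp: cls_def c_def)
        moreover have "(1, c) \<in> I" "(-1, c) \<in> I" using c by (auto simp: I_def)
        moreover have "R (Some (s, c)) P \<longleftrightarrow> cls s c \<xi> P" for s by (simp add: R_def)
        ultimately show ?thesis by blast
      qed
    qed (use W I in auto)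
    also have "\<dots> = (\<Sum>P | P \<in> W \<and> R None P. ?f P) + (\<Sum>i\<in>I. \<Sum>P | P \<in> W \<and> R (Some i) P. ?f P)"
      using I(1) by (subst sum.insert) (auto simp: sum.reindex)
    also have "(\<Sum>P | P \<in> W \<and> R None P. ?f P) \<le> \<tau>\<^sup>2 * (4 * L)"
    \<comment> \<open>By lacunarity these tiles share one frequency interval, hence one length, so
      at most four overlap at a point. With coefficients bounded by \<tau> their sum is at most
      \<open>4 * \<tau>\<^sup>2 * L\<close>.\<close>
    proof -
      let ?W0 = "{P \<in> W. R None P}"
      have "(\<Sum>P\<in>?W0. ?f P) \<le> (\<Sum>P\<in>?W0. \<tau>\<^sup>2 * ltile P)"
      proof (rule sum_mono)
        fix P assume P: "P \<in> ?W0"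
        then have "P \<in> PP'" using W(2) by blast
        then have "(a P)\<^sup>2 \<le> \<tau>\<^sup>2" by (intro power_mono PP'(3)) (simp_all add: a_def)
        then show "?f P \<le> \<tau>\<^sup>2 * ltile P" using lW[of P] P by (simp add: mult.commute)
      qed
      also have "\<dots> = \<tau>\<^sup>2 * (\<Sum>P\<in>?W0. ltile P)" by (rule sum_distrib_left[symmetric])
      also have "(\<Sum>P\<in>?W0. ltile P) \<le> real 4 * L"
        unfolding L_def
      proof (rule sum_length_le_overlap)
        show "proper_interval (top_ivl U)" by (rule grid_proper[OF grid topD])
        show "proper_interval (fst P)" if "P \<in> ?W0" for P using that tile_proper(1) tW by blast
        show "fst P \<subseteq> top_ivl U" if "P \<in> ?W0" for P using that sub W(3) by blast
        show "card {P \<in> ?W0. x \<in> fst P} \<le> 4" for x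
        proof (cases "?W0 = {}")
          case False
          then obtain P0 where P0: "P0 \<in> ?W0" by blast
          have same: "snd P = snd P0" if P: "P \<in> ?W0" for P
          proof (rule ccontr)
            assume "snd P \<noteq> snd P0"
            then have "snd P \<inter> snd P0 = {}" using U(2) W(3) P P0 unfolding lacunary_def disjoint_def by blast
            then show False using P P0 by (auto simp: R_def)
          qed
          have len: "ltile P = ltile P0" if P: "P \<in> ?W0" for P
          proof -
            have "P \<in> all_tiles D D'" "P0 \<in> all_tiles D D'" using P P0 tW by blast+
            then have "1 / ltile P = 1 / ltile P0" "0 < ltile P" "0 < ltile P0"
              using tile_freq_length[of P] tile_freq_length[of P0] same[OF P] tile_length_pos by simp_all
            then show ?thesis by (simp add: field_simps)
          qed
          have "{P \<in> ?W0. x \<in> fst P} = {P \<in> ?W0. ltile P = ltile P0 \<and> x \<in> fst P}" using len by blast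
          also have "card \<dots> \<le> 4 * 1"
          proof (rule card_tiles_through)
            have "snd ` {P \<in> ?W0. ltile P = ltile P0} \<subseteq> {snd P0}" using same by blast
            then show "card (snd ` {P \<in> ?W0. ltile P = ltile P0}) \<le> 1"
              using card_mono[of "{snd P0}"] by fastforce
          qed (use tW W(1) in auto)
          finally show ?thesis by simp
        next
          case True
          show ?thesis unfolding True by simp
        qed
      qed (use W(1) in auto)
      finally show ?thesis by (simp add: mult_left_mono)
    qed
    also have "(\<Sum>i\<in>I. \<Sum>P | P \<in> W \<and> R (Some i) P. ?f P) \<le> (\<Sum>i\<in>I. \<tau>\<^sup>2 * L)"
    proof (rule sum_mono)
      fix i assume i: "i \<in> I"
      \<comment> \<open>The part of \<open>U\<close> in one class, with the top data of
        \<open>U\<close>. If it were too large it would be a good tree and would meet the removed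
        set \<open>A2\<close>, although its tiles lie outside \<open>A\<close>.\<close>
      define V where "V = \<lparr>tiles = {P \<in> W. R (Some i) P}, top_ivl = top_ivl U, top_freq = \<xi>\<rparr>"
      have sel: "tiles V = {P \<in> W. R (Some i) P}" "top_ivl V = top_ivl U" "top_freq V = top_freq U"
        by (simp_all add: V_def \<xi>_def)
      have VU: "tiles V \<subseteq> tiles U" using W(3) sel(1) by blast
      have Vin: "V \<in> trees_in D D' J \<kappa>" using U(1) VU unfolding trees_in_def is_tree_def mem_Collect_eq sel(2,3) by blast
      have Vlac: "lacunary V" using U(2) VU unfolding lacunary_def disjoint_def by blast
      show "(\<Sum>P | P \<in> W \<and> R (Some i) P. ?f P) \<le> \<tau>\<^sup>2 * L"
      proof (rule ccontr)
        assume "\<not> (\<Sum>P | P \<in> W \<and> R (Some i) P. ?f P) \<le> \<tau>\<^sup>2 * L"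
        then have "good (fst i) (snd i) V"
          using Vin Vlac unfolding good_def sel by (auto simp: L_def R_def \<xi>_def)
        moreover have "tiles V \<subseteq> PP'" using W(2) sel(1) by blast
        ultimately have "tiles V \<inter> A2 (fst i) (snd i) \<noteq> {}" by (rule hit)
        moreover have "tiles V \<subseteq> W" using sel(1) by blast
        ultimately show False using W(4) i unfolding A_def by blast
      qed
    qed
    also have "\<tau>\<^sup>2 * (4 * L) + (\<Sum>i\<in>I. \<tau>\<^sup>2 * L) = (2 * real (\<kappa> + 1) + 4) * \<tau>\<^sup>2 * L"
      by (simp add: I(2) algebra_simps)
    finally show ?thesis unfolding W_def L_def by simp
  qed
  ultimately show ?thesis unfolding G2_def by blast
qed

end

section \<open>Truncation and the outer Lorentz norm\<close>

text \<open>The wave packet transform of a Borel representative, with integrals over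
  \<open>lborel\<close> instead of \<open>lebesgue\<close>.\<close>

definition packet_sup :: "nat \<Rightarrow> tile \<Rightarrow> (real \<Rightarrow> complex) \<Rightarrow> real" where
  "packet_sup M P f = (SUP \<phi>\<in>Phi M P. cmod (ip f \<phi>))"

lemma zero_in_Phi: "(\<lambda>x. 0) \<in> Phi M P"
proof -
  have d: "deriv_n k (\<lambda>x. 0) = (\<lambda>x. 0)" for k
    unfolding deriv_n_def by (induction k) auto
  have "(\<lambda>x. 0) \<in> Theta M" unfolding Theta_def C_n_def by (simp add: d)
  then show ?thesis unfolding Phi_def by (auto simp: fourier_def intro!: bexI[of _ "\<lambda>x. 0"])
qed

lemma Phi_inner_bound:
  assumes f: "integrable lborel f" and \<phi>: "\<phi> \<in> Phi M P" and M: "8 \<le> M" and P: "proper_interval (fst P)"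
  shows "integrable lborel (\<lambda>x. f x * cnj (\<phi> x))"
    and "cmod (ip f \<phi>) \<le> (\<integral>x. cmod (f x) * (16 / ltile P) \<partial>lborel)"
proof -
  note pk = Phi_packet[OF \<phi> M P]
  note [measurable] = packet_measurable[OF pk] borel_measurable_integrable[OF f, unfolded measurable_lborel1]
  have b: "cmod (cnj (\<phi> x)) \<le> 16 / ltile P" for x using packet_le_const[OF pk P] by simp
  show "integrable lborel (\<lambda>x. f x * cnj (\<phi> x))"
    by (rule integrable_mult_bounded[OF f _ b]) measurable
  show "cmod (ip f \<phi>) \<le> (\<integral>x. cmod (f x) * (16 / ltile P) \<partial>lborel)"
  proof (rule norm_integral_le_dominated)
    show "cmod (f x * cnj (\<phi> x)) \<le> cmod (f x) * (16 / ltile P)" for x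
      unfolding norm_mult by (rule mult_left_mono[OF b norm_ge_zero])
  qed (use f in auto)
qed

lemma packet_sup_upper:
  assumes "integrable lborel f" "\<phi> \<in> Phi M P" "8 \<le> M" "proper_interval (fst P)"
  shows "cmod (ip f \<phi>) \<le> packet_sup M P f"
  unfolding packet_sup_def using assms Phi_inner_bound(2)
  by (intro cSUP_upper bdd_aboveI2[where M = "\<integral>x. cmod (f x) * (16 / ltile P) \<partial>lborel"]) auto

lemma packet_sup_nonneg:
  assumes "integrable lborel f" "8 \<le> M" "proper_interval (fst P)"
  shows "0 \<le> packet_sup M P f"
  using packet_sup_upper[OF assms(1) zero_in_Phi assms(2,3)] by simp

text \<open>Linearizes the supremum: one packet per tile, possibly depending on \<open>f\<close>, at
  the cost of a factor 2. If the supremum is zero, the zero packet serves.\<close>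

lemma packet_sup_near_max:
  assumes "integrable lborel f" "8 \<le> M" "proper_interval (fst P)"
  shows "\<exists>\<phi>\<in>Phi M P. packet_sup M P f \<le> 2 * cmod (ip f \<phi>)"
proof (cases "packet_sup M P f = 0")
  case True
  then show ?thesis using zero_in_Phi by (intro bexI[of _ "\<lambda>x. 0"]) auto
next
  case False
  then have "packet_sup M P f / 2 < packet_sup M P f" using packet_sup_nonneg[OF assms] by simp
  moreover have "(\<lambda>\<phi>. cmod (ip f \<phi>)) ` Phi M P \<noteq> {}" using zero_in_Phi by blast
  ultimately obtain y where "y \<in> (\<lambda>\<phi>. cmod (ip f \<phi>)) ` Phi M P" "packet_sup M P f / 2 < y"
    unfolding packet_sup_def using less_cSupE by blast
  then show ?thesis by force
qed

lemma packet_sup_add: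
  assumes g: "integrable lborel g" and h: "integrable lborel h" and M: "8 \<le> M" and P: "proper_interval (fst P)"
  shows "packet_sup M P (\<lambda>x. g x + h x) \<le> packet_sup M P g + packet_sup M P h"
  unfolding packet_sup_def[of M P "\<lambda>x. g x + h x"]
proof (rule cSUP_least)
  fix \<phi> assume \<phi>: "\<phi> \<in> Phi M P"
  have "(\<integral>x. (g x + h x) * cnj (\<phi> x) \<partial>lborel) = (ip g \<phi>) + (ip h \<phi>)"
    unfolding distrib_right
    by (rule Bochner_Integration.integral_add[OF Phi_inner_bound(1)[OF g \<phi> M P] Phi_inner_bound(1)[OF h \<phi> M P]])
  then have "cmod (\<integral>x. (g x + h x) * cnj (\<phi> x) \<partial>lborel) \<le> cmod (ip g \<phi>) + cmod (ip h \<phi>)"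
    by (metis norm_triangle_ineq)
  then show "cmod (\<integral>x. (g x + h x) * cnj (\<phi> x) \<partial>lborel) \<le> packet_sup M P g + packet_sup M P h"
    using packet_sup_upper[OF g \<phi> M P] packet_sup_upper[OF h \<phi> M P] by linarith
qed (use zero_in_Phi in blast)

lemma tree_const_pos: "0 < tree_const \<kappa>"
  by (simp add: tree_const_def add_pos_pos)

lemma weak_const_pos: "0 < B \<Longrightarrow> 0 < weak_const B \<kappa>"
  by (auto simp: weak_const_def bessel_const_def intro!: add_pos_nonneg mult_pos_pos)

text \<open>The factor 8 is the cost of squaring \<open>2 * a + 2 * b\<close>, and 32 that of
  localizing to \<open>J\<close>. In the second term 16 also covers the case of outer measure below
  one, where averages are bounded by \<open>2 * K\<close> and \<open>4 * 2^2 = 16\<close>.\<close>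

definition level_const :: "nat \<Rightarrow> real" where
  "level_const \<kappa> = 8 * (2 * real (\<kappa> + 1) + 4) * 32 * weak_const 36 \<kappa> + 16 * tree_const \<kappa>"

lemma truncation_bounds:
  fixes z :: complex
  assumes p: "1 < p" "p \<le> 2" and \<Lambda>: "0 < \<Lambda>"
  shows "\<Lambda> < cmod z \<Longrightarrow> cmod z \<le> \<Lambda> powr (1 - p) * cmod z powr p"
    and "cmod z \<le> \<Lambda> \<Longrightarrow> (cmod z)\<^sup>2 \<le> \<Lambda> powr (2 - p) * cmod z powr p"
proof -
  assume z: "\<Lambda> < cmod z"
  have "cmod z = cmod z powr (1 - p) * cmod z powr p" using z \<Lambda> by (simp add: powr_add[symmetric])
  also have "\<dots> \<le> \<Lambda> powr (1 - p) * cmod z powr p"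
    using z \<Lambda> p by (intro mult_right_mono powr_mono2') auto
  finally show "cmod z \<le> \<Lambda> powr (1 - p) * cmod z powr p" .
next
  assume z: "cmod z \<le> \<Lambda>"
  show "(cmod z)\<^sup>2 \<le> \<Lambda> powr (2 - p) * cmod z powr p"
  proof (cases "z = 0")
    case False
    then have "(cmod z)\<^sup>2 = cmod z powr (2 - p) * cmod z powr p" by (simp add: powr_add[symmetric] powr_numeral)
    also have "\<dots> \<le> \<Lambda> powr (2 - p) * cmod z powr p"
      using z p by (intro mult_right_mono powr_mono2) auto
    finally show ?thesis .
  qed auto
qed

context dual_grid_pair
begin

lemma subtree_L1_estimate:
  fixes h :: "real \<Rightarrow> complex"
  assumes PP: "finite PP" and U: "U \<in> trees_in D D' J \<kappa>" "lacunary U"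
    and \<phi>: "\<And>P. P \<in> PP \<Longrightarrow> \<phi> P \<in> Phi M P" and M: "8 \<le> M" and h: "integrable lborel h" and K: "0 < K"
    and H: "\<And>P I. P \<in> PP \<Longrightarrow> proper_interval I \<Longrightarrow> fst P \<subseteq> I \<Longrightarrow>
      (\<integral>\<^sup>+x. ennreal (cmod (h x)) * indicator I x \<partial>lborel) \<le> ennreal (K * ivl_length I)"
  shows "(\<Sum>P\<in>PP \<inter> tiles U. ltile P * (cmod (ip h (\<phi> P)))\<^sup>2) \<le> tree_const \<kappa> * K\<^sup>2 * ltop U"
proof (rule tree_L1_estimate[where \<xi> = "top_freq U"])
  show "PP \<inter> tiles U \<subseteq> all_tiles D D'" "top_ivl U \<in> D" "\<And>P. P \<in> PP \<inter> tiles U \<Longrightarrow> fst P \<subseteq> top_ivl U"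
    "\<And>P. P \<in> PP \<inter> tiles U \<Longrightarrow> top_freq U \<in> dyadic_ancestor D' \<kappa> (snd P)"
    using U(1) unfolding trees_in_def is_tree_def by blast+
  show "disjoint (snd ` (PP \<inter> tiles U))" using U(2) unfolding lacunary_def disjoint_def by blast
qed (use PP \<phi> M h K H in blast)+

text \<open>\<open>weak_L2\<close> involves the global norm of \<open>g\<close>, which is not
  controlled by local averages. Dividing \<open>g\<close> by the quadratic weight of
  \<open>J\<close> and multiplying the packets by it leaves all coefficients unchanged, while the
  norm becomes an average of \<open>g\<close> at scale \<open>J\<close>. The packets keep six orders
  of decay, with \<open>B = 36 = 9/4 * 16\<close>.\<close>

lemma localized_weak_L2:
  fixes g :: "real \<Rightarrow> complex"
  assumes PP: "finite PP" "PP \<subseteq> tiles_in D D' J" and J: "proper_interval J"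
    and \<phi>: "\<And>P. P \<in> PP \<Longrightarrow> \<phi> P \<in> Phi M P" and M: "8 \<le> M"
    and g: "integrable lborel g" "\<And>x. cmod (g x) \<le> Bd" and K: "0 < K" and u: "0 < u"
    and H: "\<And>P I. P \<in> PP \<Longrightarrow> proper_interval I \<Longrightarrow> fst P \<subseteq> I \<Longrightarrow>
      (\<integral>\<^sup>+x. ennreal ((cmod (g x))\<^sup>2) * indicator I x \<partial>lborel) \<le> ennreal (K * ivl_length I)"
  shows "\<exists>A. A \<subseteq> tiles_in D D' J \<and> outer_measure_tiles D D' J \<kappa> A \<le> ennreal u \<and>
    (\<forall>U\<in>trees_in D D' J \<kappa>. lacunary U \<longrightarrow>
      (\<Sum>P\<in>PP \<inter> tiles U - A. ltile P * (cmod (ip g (\<phi> P)))\<^sup>2) \<le>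
        (2 * real (\<kappa> + 1) + 4) * (32 * weak_const 36 \<kappa> * K / u) * ltop U)"
proof (cases "PP = {}")
  case True
  have "covered J \<kappa> {} 0" by (rule covered_empty) simp
  then have "outer_measure_tiles D D' J \<kappa> {} \<le> ennreal u"
    using covered_outer_measure[OF _ J, of \<kappa> "{}" 0] by simp
  moreover have "0 \<le> (2 * real (\<kappa> + 1) + 4) * (32 * weak_const 36 \<kappa> * K / u) * ltop U" if "U \<in> trees_in D D' J \<kappa>" for U
    using tree_top_length_pos[OF that] weak_const_pos[of 36 \<kappa>] K u by (intro mult_nonneg_nonneg divide_nonneg_nonneg) auto
  ultimately show ?thesis using True by (intro exI[of _ "{}"]) auto
next
  case False
  define wc where "wc = weak_const 36 \<kappa>"
  have wc: "0 < wc" using weak_const_pos[of 36 \<kappa>] by (simp add: wc_def)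
  define L c where "L = ivl_length J" and "c = ivl_center J"
  have L: "0 < L" using proper_interval_length_pos[OF J] by (simp add: L_def)
  \<comment> \<open>Chosen such that the covering from \<open>weak_L2\<close>, with square norm at
    most \<open>32 * K * L\<close>, has outer measure at most \<open>u\<close>.\<close>
  define \<tau> where "\<tau> = sqrt (32 * wc * K / u)"
  have \<tau>2: "\<tau>\<^sup>2 = 32 * wc * K / u" using wc K u by (simp add: \<tau>_def)
  have \<tau>: "0 < \<tau>" using wc K u by (simp add: \<tau>_def)
  define q where "q = quad_weight J"
  note qb = quad_weight_bounds[OF J, folded q_def L_def c_def]
  have q1: "1 \<le> q x" for x by (rule qb(1))
  have [measurable]: "q \<in> borel_measurable borel" unfolding q_def quad_weight_def[abs_def] by measurable
  have [measurable]: "g \<in> borel_measurable borel" using g(1) by auto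
  define g' where "g' x = g x * complex_of_real (1 / q x)" for x
  define \<psi> where "\<psi> P x = complex_of_real (q x) * \<phi> P x" for P x
  have t: "P \<in> all_tiles D D'" "fst P \<subseteq> J" if "P \<in> PP" for P using PP(2) that by (auto simp: tiles_in_def)
  have p: "packet 36 6 P (\<psi> P)" if P: "P \<in> PP" for P
  proof -
    have pI: "proper_interval (fst P)" by (rule tile_proper(1)[OF t(1)[OF P]])
    have "packet 16 (6 + 2) P (\<phi> P)" using Phi_packet[OF \<phi>[OF P] M pI] by simp
    from packet_quad_weight[OF this pI J t(2)[OF P]] show ?thesis by (simp add: \<psi>_def[abs_def] q_def)
  qed
  have g'i: "integrable lborel g'"
    unfolding g'_def
  proof (rule integrable_mult_bounded[OF g(1), where B = 1])
    show "cmod (complex_of_real (1 / q x)) \<le> 1" for x using q1[of x] by (simp only: norm_of_real) simp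
  qed measurable
  have g'le: "cmod (g' x) \<le> Bd" for x
  proof -
    have "cmod (g' x) = cmod (g x) * (1 / q x)" using q1[of x] by (simp add: g'_def norm_divide)
    also have "\<dots> \<le> cmod (g x) * 1" using q1[of x] by (intro mult_left_mono) auto
    finally show ?thesis using g(2)[of x] by simp
  qed
  have g'2: "integrable lborel (\<lambda>x. (cmod (g' x))\<^sup>2)"
  proof -
    have "integrable lborel (\<lambda>x. g' x * cnj (g' x))"
      using g'i g'le by (intro integrable_mult_bounded[where B = Bd]) auto
    then show ?thesis unfolding complex_norm_square[symmetric] by (simp only: complex_of_real_integrable_eq)
  qed
  have inner: "(ip g' (\<psi> P)) = (ip g (\<phi> P))" for P
  proof (intro Bochner_Integration.integral_cong refl)
    fix x
    have "complex_of_real (1 / q x) * complex_of_real (q x) = 1" using q1[of x] by (simp flip: of_real_mult)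
    moreover have "g' x * cnj (\<psi> P x) = g x * cnj (\<phi> P x) * (complex_of_real (1 / q x) * complex_of_real (q x))"
      by (simp only: g'_def \<psi>_def complex_cnj_mult complex_cnj_complex_of_real mult_ac)
    ultimately show "g' x * cnj (\<psi> P x) = g x * cnj (\<phi> P x)" by (simp only: mult_1_right)
  qed
  define G2 where "G2 = (sqnorm g')"
  have G2: "G2 \<le> 32 * K * L"
  proof -
    obtain P where P: "P \<in> PP" using False by blast
    have "(\<integral>\<^sup>+x. ennreal ((cmod (g x))\<^sup>2) * ennreal (1 / wt c L x ^ 2) \<partial>lborel) \<le> ennreal (16 * K * L)"
    proof (rule nn_integral_wt_le_average)
      fix R assume R: "L \<le> R"
      have "J \<subseteq> {c - R..c + R}" using R L by (intro proper_interval_subset_cball[OF J]) (auto simp: L_def c_def)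
      then show "(\<integral>\<^sup>+x. ennreal ((cmod (g x))\<^sup>2) * indicator {c - R..c + R} x \<partial>lborel) \<le> ennreal (K * (2 * R))"
        using H[OF P proper_interval_cball, of R c] t(2)[OF P] R L by (simp add: ivl_length_cball)
    qed (use L K in auto)
    then have "2 * (\<integral>\<^sup>+x. ennreal ((cmod (g x))\<^sup>2) * ennreal (1 / wt c L x ^ 2) \<partial>lborel) \<le> 2 * ennreal (16 * K * L)"
      by (intro mult_left_mono) auto
    moreover have "ennreal G2 \<le> 2 * (\<integral>\<^sup>+x. ennreal ((cmod (g x))\<^sup>2) * ennreal (1 / wt c L x ^ 2) \<partial>lborel)"
    proof -
      have "ennreal G2 = (\<integral>\<^sup>+x. ennreal ((cmod (g' x))\<^sup>2) \<partial>lborel)"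
        unfolding G2_def by (rule nn_integral_eq_integral[symmetric, OF g'2]) simp
      also have "\<dots> \<le> (\<integral>\<^sup>+x. 2 * (ennreal ((cmod (g x))\<^sup>2) * ennreal (1 / wt c L x ^ 2)) \<partial>lborel)"
      proof (rule nn_integral_mono)
        fix x
        have w: "0 < wt c L x" using L by (rule wt_pos)
        \<comment> \<open>As \<open>q >= 1\<close>, its square is at least \<open>q\<close> and
          hence at least half of the squared weight; the factor 2 gives
          \<open>32 = 2 * 16\<close>.\<close>
        have "q x * 1 \<le> q x * q x" using q1[of x] by (intro mult_left_mono) auto
        then have "wt c L x ^ 2 \<le> 2 * (q x)\<^sup>2" using qb(3)[of x] by (simp add: power2_eq_square)
        then have "1 / (q x)\<^sup>2 \<le> 2 * (1 / wt c L x ^ 2)" using w q1[of x] by (simp add: field_simps)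
        then have "(cmod (g x))\<^sup>2 * (1 / (q x)\<^sup>2) \<le> (cmod (g x))\<^sup>2 * (2 * (1 / wt c L x ^ 2))" by (intro mult_left_mono) auto
        moreover have "(cmod (g' x))\<^sup>2 = (cmod (g x))\<^sup>2 * (1 / (q x)\<^sup>2)"
          using q1[of x] by (simp add: g'_def norm_divide power_divide)
        ultimately have "ennreal ((cmod (g' x))\<^sup>2) \<le> ennreal (2 * ((cmod (g x))\<^sup>2 * (1 / wt c L x ^ 2)))" by (intro ennreal_leI) (simp add: mult_ac)
        also have "\<dots> = 2 * (ennreal ((cmod (g x))\<^sup>2) * ennreal (1 / wt c L x ^ 2))"
          by (simp add: ennreal_mult[symmetric] ennreal_mult'' flip: ennreal_numeral)
        finally show "ennreal ((cmod (g' x))\<^sup>2) \<le> 2 * (ennreal ((cmod (g x))\<^sup>2) * ennreal (1 / wt c L x ^ 2))" .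
      qed
      also have "\<dots> = 2 * (\<integral>\<^sup>+x. ennreal ((cmod (g x))\<^sup>2) * ennreal (1 / wt c L x ^ 2) \<partial>lborel)"
        by (rule nn_integral_cmult) measurable
      finally show ?thesis .
    qed
    moreover have "2 * ennreal (16 * K * L) = ennreal (32 * K * L)"
    proof -
      have "2 * ennreal (16 * K * L) = ennreal 2 * ennreal (16 * K * L)" by simp
      also have "\<dots> = ennreal (2 * (16 * K * L))" using K L by (intro ennreal_mult[symmetric]) auto
      finally show ?thesis by (simp only: mult.assoc[symmetric]) simp
    qed
    ultimately have "ennreal G2 \<le> ennreal (32 * K * L)" by order
    then show ?thesis using K L by (subst (asm) ennreal_le_iff) auto
  qed
  obtain A where A: "covered J \<kappa> A (weak_const 36 \<kappa> * G2 / \<tau>\<^sup>2)"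
    and size: "\<And>U. U \<in> trees_in D D' J \<kappa> \<Longrightarrow> lacunary U \<Longrightarrow>
      (\<Sum>P\<in>PP \<inter> tiles U - A. ltile P * (cmod (ip g' (\<psi> P)))\<^sup>2) \<le> (2 * real (\<kappa> + 1) + 4) * \<tau>\<^sup>2 * ltop U"
    using weak_L2[OF PP p g'i g'2 _ \<tau>, of \<kappa>] unfolding G2_def by auto
  have "wc * G2 / \<tau>\<^sup>2 / L \<le> wc * (32 * K * L) / \<tau>\<^sup>2 / L"
    using G2 wc L by (intro divide_right_mono mult_left_mono) auto
  also have "\<dots> = u" using wc K L u by (simp add: \<tau>2)
  finally have "ennreal (wc * G2 / \<tau>\<^sup>2 / L) \<le> ennreal u" by (rule ennreal_leI)
  then have "outer_measure_tiles D D' J \<kappa> A \<le> ennreal u"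
    using covered_outer_measure[OF A J] unfolding wc_def L_def by (rule order_trans[rotated])
  then show ?thesis
    using covered_subset[OF A] size unfolding inner \<tau>2 wc_def by blast
qed

text \<open>The heart of the interpolation: outside a set of measure at most \<open>u\<close> all
  lacunary sizes are bounded. The exceptional set is produced by \<open>g\<close> alone; the
  contribution of \<open>h\<close> is bounded on every tree without removing anything.\<close>

lemma level_estimate:
  fixes f :: "real \<Rightarrow> complex"
  assumes f: "integrable lborel f" "\<And>x. cmod (f x) \<le> Bd" and p: "1 < p" "p \<le> 2" and K: "0 < K"
    and PP: "finite PP" "PP \<subseteq> tiles_in D D' J" and J: "proper_interval J" and M: "8 \<le> M"
    and H: "\<And>P I. P \<in> PP \<Longrightarrow> proper_interval I \<Longrightarrow> fst P \<subseteq> I \<Longrightarrow>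
      (\<integral>\<^sup>+x. ennreal (cmod (f x) powr p) * indicator I x \<partial>lborel) \<le> ennreal (K powr p * ivl_length I)"
    and u: "0 < u" "u \<le> m" and r: "0 < r" "1 / r \<le> 1 - 1 / p"
  shows "\<exists>A. A \<subseteq> tiles_in D D' J \<and> outer_measure_tiles D D' J \<kappa> A \<le> ennreal u \<and>
    (\<forall>U\<in>trees_in D D' J \<kappa>. lacunary U \<longrightarrow>
      (\<Sum>P\<in>PP \<inter> tiles U - A. ltile P * (packet_sup M P f)\<^sup>2) \<le>
        level_const \<kappa> * K\<^sup>2 * (m powr (1 - 2 / r) / u) * ltop U)"
proof -
  \<comment> \<open>The maximum with 1 keeps the height at \<open>K\<close> when
    \<open>m < 1\<close>; then the averages of \<open>f\<close> itself are at most
    \<open>2 * K\<close>.\<close>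
  define \<Lambda> where "\<Lambda> = K * max 1 m powr (1 / p)"
  have \<Lambda>: "0 < \<Lambda>" using K by (simp add: \<Lambda>_def)
  have m: "0 < m" using u by linarith
  define h g where "h x = (if cmod (f x) \<le> \<Lambda> then 0 else f x)" and "g x = (if cmod (f x) \<le> \<Lambda> then f x else 0)" for x
  have [measurable]: "f \<in> borel_measurable borel" using f(1) by auto
  have hi: "integrable lborel h" by (rule Bochner_Integration.integrable_bound[OF f(1)]) (auto simp: h_def[abs_def])
  have gi: "integrable lborel g" by (rule Bochner_Integration.integrable_bound[OF f(1)]) (auto simp: g_def[abs_def])
  have gb: "cmod (g x) \<le> \<Lambda>" for x using \<Lambda> by (simp add: g_def)
  have t: "P \<in> all_tiles D D'" if "P \<in> PP" for P using PP(2) that by (auto simp: tiles_in_def)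
  have pI: "proper_interval (fst P)" if "P \<in> PP" for P using tile_proper(1)[OF t[OF that]] .
  have lpos: "0 < ltile P" if "P \<in> PP" for P using tile_length_pos[OF t[OF that]] .
  have scaled: "(\<integral>\<^sup>+x. ennreal (s x) * indicator I x \<partial>lborel) \<le> ennreal (k * K powr p * ivl_length I)"
    if P: "P \<in> PP" "proper_interval I" "fst P \<subseteq> I" and s: "\<And>x. s x \<le> k * cmod (f x) powr p" and k: "0 \<le> k" for s k P I
  proof -
    have [measurable]: "I \<in> sets borel" by (rule proper_interval_borel[OF P(2)])
    have "(\<integral>\<^sup>+x. ennreal (s x) * indicator I x \<partial>lborel) \<le> (\<integral>\<^sup>+x. ennreal k * (ennreal (cmod (f x) powr p) * indicator I x) \<partial>lborel)"
    proof (rule nn_integral_mono)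
      fix x
      have "ennreal (s x) \<le> ennreal k * ennreal (cmod (f x) powr p)"
        using ennreal_leI[OF s[of x]] k by (simp add: ennreal_mult)
      then show "ennreal (s x) * indicator I x \<le> ennreal k * (ennreal (cmod (f x) powr p) * indicator I x)"
        by (simp add: mult_right_mono flip: mult.assoc)
    qed
    also have "\<dots> = ennreal k * (\<integral>\<^sup>+x. ennreal (cmod (f x) powr p) * indicator I x \<partial>lborel)"
      by (rule nn_integral_cmult) measurable
    also have "\<dots> \<le> ennreal k * ennreal (K powr p * ivl_length I)" by (intro mult_left_mono H[OF P]) auto
    also have "\<dots> = ennreal (k * K powr p * ivl_length I)"
      using k proper_interval_length_pos[OF P(2)] by (simp add: ennreal_mult[symmetric] mult.assoc)
    finally show ?thesis .
  qed
  \<comment> \<open>Near-maximizing packets are chosen separately for \<open>h\<close> and for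
    \<open>g\<close>; sublinearity of the supremum permits this, and neither estimate depends on
    which packets are used.\<close>
  have "\<exists>\<phi>. \<forall>P\<in>PP. \<phi> P \<in> Phi M P \<and> packet_sup M P h \<le> 2 * cmod (ip h (\<phi> P))"
    using packet_sup_near_max[OF hi M pI] by (intro bchoice) blast
  then obtain \<phi> where \<phi>: "\<And>P. P \<in> PP \<Longrightarrow> \<phi> P \<in> Phi M P"
    "\<And>P. P \<in> PP \<Longrightarrow> packet_sup M P h \<le> 2 * cmod (ip h (\<phi> P))" by blast
  define b where "b P = cmod (ip h (\<phi> P))" for P
  define Kh where "Kh = \<Lambda> powr (1 - p) * K powr p"
  have Kh: "0 < Kh" using \<Lambda> K by (simp add: Kh_def)
  have Kh_eq: "Kh = K * max 1 m powr (1 / p - 1)"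
  proof -
    have "\<Lambda> powr (1 - p) = K powr (1 - p) * max 1 m powr (1 / p - 1)"
      using K p by (simp add: \<Lambda>_def powr_mult powr_powr right_diff_distrib)
    moreover have "K powr (1 - p) * K powr p = K" using K by (simp add: powr_add[symmetric])
    moreover have "K powr (1 - p) * x * K powr p = (K powr (1 - p) * K powr p) * x" for x by (simp only: mult_ac)
    ultimately show ?thesis by (simp only: Kh_def)
  qed
  have b_sum: "(\<Sum>P\<in>PP \<inter> tiles U. ltile P * (b P)\<^sup>2) \<le> tree_const \<kappa> * Kh\<^sup>2 * ltop U"
    if U: "U \<in> trees_in D D' J \<kappa>" "lacunary U" for U
    unfolding b_def
  proof (rule subtree_L1_estimate[OF PP(1) U \<phi>(1) M hi Kh])
    show "(\<integral>\<^sup>+x. ennreal (cmod (h x)) * indicator I x \<partial>lborel) \<le> ennreal (Kh * ivl_length I)"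
      if P: "P \<in> PP" "proper_interval I" "fst P \<subseteq> I" for P I
      unfolding Kh_def
      by (rule scaled[OF P]) (use truncation_bounds(1)[OF p \<Lambda>] in \<open>auto simp: h_def not_le\<close>)
  qed
  show ?thesis
  proof (cases "m < 1")
    case True
    then have LK: "\<Lambda> = K" and KhK: "Kh = K" by (auto simp: \<Lambda>_def Kh_eq)
    have "\<exists>\<phi>. \<forall>P\<in>PP. \<phi> P \<in> Phi M P \<and> packet_sup M P f \<le> 2 * cmod (ip f (\<phi> P))"
      using packet_sup_near_max[OF f(1) M pI] by (intro bchoice) blast
    then obtain \<zeta> where \<zeta>: "\<And>P. P \<in> PP \<Longrightarrow> \<zeta> P \<in> Phi M P"
      "\<And>P. P \<in> PP \<Longrightarrow> packet_sup M P f \<le> 2 * cmod (ip f (\<zeta> P))" by blast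
    define a where "a P = cmod (ip f (\<zeta> P))" for P
    have f1: "(\<integral>\<^sup>+x. ennreal (cmod (f x)) * indicator I x \<partial>lborel) \<le> ennreal (2 * K * ivl_length I)"
      if P: "P \<in> PP" "proper_interval I" "fst P \<subseteq> I" for P I
    proof -
      have [measurable]: "I \<in> sets borel" "h \<in> borel_measurable borel" using proper_interval_borel[OF P(2)] hi by auto
      have Ip: "0 < ivl_length I" by (rule proper_interval_length_pos[OF P(2)])
      have "(\<integral>\<^sup>+x. ennreal (cmod (f x)) * indicator I x \<partial>lborel) \<le>
         (\<integral>\<^sup>+x. ennreal K * indicator I x + ennreal (cmod (h x)) * indicator I x \<partial>lborel)"
        using K by (intro nn_integral_mono) (auto simp: h_def LK indicator_def intro: ennreal_leI)
      also have "\<dots> = (\<integral>\<^sup>+x. ennreal K * indicator I x \<partial>lborel) + (\<integral>\<^sup>+x. ennreal (cmod (h x)) * indicator I x \<partial>lborel)"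
        by (rule nn_integral_add) measurable
      also have "(\<integral>\<^sup>+x. ennreal K * indicator I x \<partial>lborel) = ennreal (K * ivl_length I)"
        using K Ip by (subst nn_integral_cmult_indicator) (auto simp: emeasure_proper_interval[OF P(2)] ennreal_mult)
      also have "ennreal (K * ivl_length I) + (\<integral>\<^sup>+x. ennreal (cmod (h x)) * indicator I x \<partial>lborel) \<le> ennreal (K * ivl_length I) + ennreal (Kh * ivl_length I)"
        unfolding Kh_def
        by (intro add_left_mono scaled[OF P]) (use truncation_bounds(1)[OF p \<Lambda>] in \<open>auto simp: h_def not_le\<close>)
      also have "\<dots> = ennreal (K * ivl_length I + Kh * ivl_length I)"
        using K Kh Ip by (intro ennreal_plus[symmetric]) auto
      also have "K * ivl_length I + Kh * ivl_length I = 2 * K * ivl_length I" by (simp add: KhK)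
      finally show ?thesis .
    qed
    have "covered J \<kappa> {} 0" by (rule covered_empty) simp
    then have om: "outer_measure_tiles D D' J \<kappa> {} \<le> ennreal u"
      using covered_outer_measure[OF _ J, of \<kappa> "{}" 0] by simp
    \<comment> \<open>For \<open>m < 1\<close> the required bound is weaker than the uniform tree
      estimate, since \<open>u <= m\<close> and \<open>m powr (- 2 / r)\<close> is at least one.
      Nothing needs to be removed.\<close>
    have one: "1 \<le> m powr (1 - 2 / r) / u"
    proof -
      have "1 \<le> m powr (- 2 / r)" using m True r powr_mono'[of "- 2 / r" 0 m] by simp
      also have "\<dots> = m powr (1 - 2 / r) / m" using m by (simp add: powr_diff powr_minus_divide)
      also have "\<dots> \<le> m powr (1 - 2 / r) / u" using u m by (intro divide_left_mono) auto
      finally show ?thesis .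
    qed
    have "(\<Sum>P\<in>PP \<inter> tiles U - {}. ltile P * (packet_sup M P f)\<^sup>2) \<le> level_const \<kappa> * K\<^sup>2 * (m powr (1 - 2 / r) / u) * ltop U"
      if U: "U \<in> trees_in D D' J \<kappa>" "lacunary U" for U
    proof -
      have L: "0 < ltop U" by (rule tree_top_length_pos[OF U(1)])
      have "(\<Sum>P\<in>PP \<inter> tiles U - {}. ltile P * (packet_sup M P f)\<^sup>2) \<le> (\<Sum>P\<in>PP \<inter> tiles U. 4 * (ltile P * (a P)\<^sup>2))"
        unfolding Diff_empty
      proof (rule sum_mono)
        fix P assume "P \<in> PP \<inter> tiles U"
        then have P: "P \<in> PP" by blast
        have "(packet_sup M P f)\<^sup>2 \<le> (2 * a P)\<^sup>2"
          using \<zeta>(2)[OF P] packet_sup_nonneg[OF f(1) M pI[OF P]] by (intro power_mono) (auto simp: a_def)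
        then have "ltile P * (packet_sup M P f)\<^sup>2 \<le> ltile P * (2 * a P)\<^sup>2" using lpos[OF P] by (intro mult_left_mono) auto
        then show "ltile P * (packet_sup M P f)\<^sup>2 \<le> 4 * (ltile P * (a P)\<^sup>2)" by (simp add: power_mult_distrib)
      qed
      also have "\<dots> = 4 * (\<Sum>P\<in>PP \<inter> tiles U. ltile P * (a P)\<^sup>2)" by (rule sum_distrib_left[symmetric])
      also have "\<dots> \<le> 4 * (tree_const \<kappa> * (2 * K)\<^sup>2 * ltop U)"
        unfolding a_def using K
        by (intro mult_left_mono subtree_L1_estimate[OF PP(1) U \<zeta>(1) M f(1)] f1) auto
      also have "\<dots> = 16 * tree_const \<kappa> * K\<^sup>2 * 1 * ltop U" by (simp add: power_mult_distrib)
      also have "\<dots> \<le> level_const \<kappa> * K\<^sup>2 * (m powr (1 - 2 / r) / u) * ltop U"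
        using one L tree_const_pos[of \<kappa>] weak_const_pos[of 36 \<kappa>]
        by (intro mult_right_mono mult_mono) (auto simp: level_const_def)
      finally show ?thesis .
    qed
    then show ?thesis using om by (intro exI[of _ "{}"]) auto
  next
    case False
    then have mx: "max 1 m = m" "1 \<le> m" by auto
    define Kg where "Kg = \<Lambda> powr (2 - p) * K powr p"
    have Kg: "0 < Kg" using \<Lambda> K by (simp add: Kg_def)
    \<comment> \<open>The condition on \<open>r\<close> rewritten as a comparison of powers of
      \<open>m\<close>; it may be applied to \<open>m\<close> because \<open>m >= 1\<close> in this
      case.\<close>
    have exps: "2 / p - 1 \<le> 1 - 2 / r" using r(2) by (simp add: field_simps)
    have Kg_eq: "Kg = K\<^sup>2 * m powr (2 / p - 1)"
    proof -
      have "\<Lambda> powr (2 - p) = K powr (2 - p) * m powr ((1 / p) * (2 - p))"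
        using K p m mx by (simp add: \<Lambda>_def powr_mult powr_powr)
      moreover have "(1 / p) * (2 - p) = 2 / p - 1" using p by (simp add: field_simps)
      moreover have "K powr (2 - p) * K powr p = K\<^sup>2" using K by (simp add: powr_add[symmetric] powr_numeral)
      moreover have "K powr (2 - p) * x * K powr p = (K powr (2 - p) * K powr p) * x" for x by (simp only: mult_ac)
      ultimately show ?thesis by (simp only: Kg_def)
    qed
    have Kg_le: "Kg \<le> K\<^sup>2 * m powr (1 - 2 / r)"
      unfolding Kg_eq using exps mx by (intro mult_left_mono powr_mono) auto
    have Kh_le: "Kh\<^sup>2 \<le> K\<^sup>2 * (m powr (1 - 2 / r) / u)"
    proof -
      have "(m powr (1 / p - 1))\<^sup>2 = m powr (2 / p - 1) / m"
        using m by (simp add: power2_eq_square powr_add[symmetric] powr_diff)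
      also have "\<dots> \<le> m powr (1 - 2 / r) / u"
        using exps mx u by (intro frac_le powr_mono) auto
      finally show ?thesis unfolding Kh_eq mx power_mult_distrib by (intro mult_left_mono) auto
    qed
    have "\<exists>\<phi>. \<forall>P\<in>PP. \<phi> P \<in> Phi M P \<and> packet_sup M P g \<le> 2 * cmod (ip g (\<phi> P))"
      using packet_sup_near_max[OF gi M pI] by (intro bchoice) blast
    then obtain \<eta> where \<eta>: "\<And>P. P \<in> PP \<Longrightarrow> \<eta> P \<in> Phi M P"
      "\<And>P. P \<in> PP \<Longrightarrow> packet_sup M P g \<le> 2 * cmod (ip g (\<eta> P))" by blast
    define a where "a P = cmod (ip g (\<eta> P))" for P
    have "(\<integral>\<^sup>+x. ennreal ((cmod (g x))\<^sup>2) * indicator I x \<partial>lborel) \<le> ennreal (Kg * ivl_length I)"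
      if P: "P \<in> PP" "proper_interval I" "fst P \<subseteq> I" for P I
      unfolding Kg_def
      by (rule scaled[OF P]) (use truncation_bounds(2)[OF p \<Lambda>] in \<open>auto simp: g_def\<close>)
    then obtain A where A: "A \<subseteq> tiles_in D D' J" "outer_measure_tiles D D' J \<kappa> A \<le> ennreal u"
      and a_sum: "\<And>U. U \<in> trees_in D D' J \<kappa> \<Longrightarrow> lacunary U \<Longrightarrow> (\<Sum>P\<in>PP \<inter> tiles U - A. ltile P * (a P)\<^sup>2) \<le>
        (2 * real (\<kappa> + 1) + 4) * (32 * weak_const 36 \<kappa> * Kg / u) * ltop U"
      using localized_weak_L2[OF PP J \<eta>(1) M gi gb Kg u(1), of \<kappa>] unfolding a_def by blast
    have "(\<Sum>P\<in>PP \<inter> tiles U - A. ltile P * (packet_sup M P f)\<^sup>2) \<le> level_const \<kappa> * K\<^sup>2 * (m powr (1 - 2 / r) / u) * ltop U"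
      if U: "U \<in> trees_in D D' J \<kappa>" "lacunary U" for U
    proof -
      define L X where "L = ltop U" and "X = K\<^sup>2 * (m powr (1 - 2 / r) / u)"
      have L: "0 < L" unfolding L_def by (rule tree_top_length_pos[OF U(1)])
      have X: "0 \<le> X" using u by (simp add: X_def)
      have wc: "0 < weak_const 36 \<kappa>" by (rule weak_const_pos) simp
      have "(\<Sum>P\<in>PP \<inter> tiles U - A. ltile P * (packet_sup M P f)\<^sup>2) \<le> (\<Sum>P\<in>PP \<inter> tiles U - A. 8 * (ltile P * (a P)\<^sup>2) + 8 * (ltile P * (b P)\<^sup>2))"
      proof (rule sum_mono)
        fix P assume "P \<in> PP \<inter> tiles U - A"
        then have P: "P \<in> PP" by blast
        have "(\<lambda>x. g x + h x) = f" by (auto simp: g_def h_def)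
        then have "packet_sup M P f \<le> packet_sup M P g + packet_sup M P h"
          using packet_sup_add[OF gi hi M pI[OF P]] by simp
        then have "packet_sup M P f \<le> 2 * a P + 2 * b P" using \<eta>(2)[OF P] \<phi>(2)[OF P] by (simp add: a_def b_def)
        then have "(packet_sup M P f)\<^sup>2 \<le> (2 * a P + 2 * b P)\<^sup>2"
          using packet_sup_nonneg[OF f(1) M pI[OF P]] by (intro power_mono)
        also have "\<dots> \<le> 8 * (a P)\<^sup>2 + 8 * (b P)\<^sup>2"
          using sum_squares_bound[of "a P" "b P"] by (simp add: power2_eq_square algebra_simps)
        finally have "ltile P * (packet_sup M P f)\<^sup>2 \<le> ltile P * (8 * (a P)\<^sup>2 + 8 * (b P)\<^sup>2)"
          using lpos[OF P] by (intro mult_left_mono) auto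
        then show "ltile P * (packet_sup M P f)\<^sup>2 \<le> 8 * (ltile P * (a P)\<^sup>2) + 8 * (ltile P * (b P)\<^sup>2)"
          by (simp add: algebra_simps)
      qed
      also have "\<dots> = 8 * (\<Sum>P\<in>PP \<inter> tiles U - A. ltile P * (a P)\<^sup>2) + 8 * (\<Sum>P\<in>PP \<inter> tiles U - A. ltile P * (b P)\<^sup>2)"
        by (simp only: sum.distrib sum_distrib_left)
      also have "\<dots> \<le> 8 * ((2 * real (\<kappa> + 1) + 4) * (32 * weak_const 36 \<kappa> * X) * L) + 8 * (tree_const \<kappa> * X * L)"
      proof (intro add_mono mult_left_mono)
        have "(\<Sum>P\<in>PP \<inter> tiles U - A. ltile P * (a P)\<^sup>2) \<le> (2 * real (\<kappa> + 1) + 4) * (32 * weak_const 36 \<kappa> * Kg / u) * L"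
          unfolding L_def by (rule a_sum[OF U])
        also have "\<dots> = (2 * real (\<kappa> + 1) + 4) * (32 * weak_const 36 \<kappa> * (Kg / u)) * L" by simp
        also have "\<dots> \<le> (2 * real (\<kappa> + 1) + 4) * (32 * weak_const 36 \<kappa> * X) * L"
          using Kg_le u L wc by (intro mult_right_mono mult_left_mono) (auto simp: X_def divide_right_mono)
        finally show "(\<Sum>P\<in>PP \<inter> tiles U - A. ltile P * (a P)\<^sup>2) \<le> (2 * real (\<kappa> + 1) + 4) * (32 * weak_const 36 \<kappa> * X) * L" .
        have "(\<Sum>P\<in>PP \<inter> tiles U - A. ltile P * (b P)\<^sup>2) \<le> (\<Sum>P\<in>PP \<inter> tiles U. ltile P * (b P)\<^sup>2)"
        proof (rule sum_mono2)
          fix P assume "P \<in> PP \<inter> tiles U - (PP \<inter> tiles U - A)"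
          then have "0 < ltile P" using lpos by blast
          then show "0 \<le> ltile P * (b P)\<^sup>2" by simp
        qed (use PP(1) in auto)
        also have "\<dots> \<le> tree_const \<kappa> * Kh\<^sup>2 * L" unfolding L_def by (rule b_sum[OF U])
        also have "\<dots> \<le> tree_const \<kappa> * X * L"
          using Kh_le L tree_const_pos[of \<kappa>] by (intro mult_right_mono mult_left_mono) (auto simp: X_def)
        finally show "(\<Sum>P\<in>PP \<inter> tiles U - A. ltile P * (b P)\<^sup>2) \<le> tree_const \<kappa> * X * L" .
      qed auto
      also have "\<dots> = (8 * (2 * real (\<kappa> + 1) + 4) * 32 * weak_const 36 \<kappa> + 8 * tree_const \<kappa>) * (X * L)"
        by (simp add: algebra_simps)
      also have "\<dots> \<le> level_const \<kappa> * (X * L)"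
        using X L tree_const_pos[of \<kappa>] by (intro mult_right_mono) (auto simp: level_const_def)
      finally show ?thesis by (simp add: X_def L_def mult.assoc)
    qed
    then show ?thesis using A by blast
  qed
qed

end

section \<open>From functions on the line to outer Lorentz norms\<close>

lemma borel_representative:
  assumes "bounded_compactly_supported f"
  shows "\<exists>f' Bd. f' \<in> borel_measurable borel \<and> (AE x in lborel. f x = f' x) \<and> integrable lborel f' \<and> (\<forall>x. cmod (f' x) \<le> Bd)"
proof -
  have fm: "f \<in> borel_measurable (completion lborel)" and fb: "bounded (range f)" and fc: "compact (closure {x. f x \<noteq> 0})"
    using assms by (auto simp: bounded_compactly_supported_def)
  obtain Bd where Bd: "\<And>x. cmod (f x) \<le> Bd" using fb by (auto simp: bounded_iff)
  have "bounded {x. f x \<noteq> 0}" using fc compact_imp_bounded bounded_subset closure_subset by blast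
  then obtain R where R: "\<And>x. f x \<noteq> 0 \<Longrightarrow> \<bar>x\<bar> \<le> R" by (auto simp: bounded_iff)
  have "(\<lambda>x. Re (f x)) \<in> borel_measurable (completion lborel)" "(\<lambda>x. Im (f x)) \<in> borel_measurable (completion lborel)"
    using fm by measurable
  then obtain a b where ab: "a \<in> borel_measurable lborel" "AE x in lborel. Re (f x) = a x"
    "b \<in> borel_measurable lborel" "AE x in lborel. Im (f x) = b x"
    using completion_ex_borel_measurable_real by metis
  have [measurable]: "a \<in> borel_measurable borel" "b \<in> borel_measurable borel" using ab by auto
  define F where "F x = complex_of_real (a x) + \<i> * complex_of_real (b x)" for x
  \<comment> \<open>Changing a function on a null set could destroy its bound and support; cutting
    off restores both and alters nothing where the representative agrees with
    \<open>f\<close>.\<close>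
  define f' where "f' x = (if \<bar>x\<bar> \<le> R \<and> cmod (F x) \<le> Bd then F x else 0)" for x
  have [measurable]: "F \<in> borel_measurable borel" unfolding F_def[abs_def] by measurable
  have f'm: "f' \<in> borel_measurable borel" unfolding f'_def[abs_def] by measurable
  have ae: "AE x in lborel. f x = f' x"
    using ab(2,4)
  proof eventually_elim
    case (elim x)
    have "f x = F x" by (rule complex_eqI) (auto simp: F_def elim)
    then show "f x = f' x" using Bd[of x] R[of x] by (auto simp: f'_def)
  qed
  have Bd0: "0 \<le> Bd" using Bd[of 0] norm_ge_zero order_trans by blast
  have b': "cmod (f' x) \<le> Bd" for x using Bd0 by (auto simp: f'_def)
  have "integrable lborel f'"
  proof (rule Bochner_Integration.integrable_bound)
    show "integrable lborel (\<lambda>x. Bd * indicator {-R..R} x)"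
      by (cases "-R \<le> R") auto
    show "f' \<in> borel_measurable lborel" using f'm by simp
    show "AE x in lborel. cmod (f' x) \<le> norm (Bd * indicator {-R..R} x)"
      using Bd0 by (intro AE_I2) (auto simp: f'_def indicator_def abs_le_iff)
  qed
  then show ?thesis using f'm ae b' by blast
qed

lemma wave_packet_transform_eq_packet_sup:
  assumes f: "f \<in> borel_measurable lebesgue" and f': "f' \<in> borel_measurable borel" "AE x in lborel. f x = f' x"
    and M: "8 \<le> M" and P: "proper_interval (fst P)"
  shows "wave_packet_transform M f P = packet_sup M P f'"
  unfolding wave_packet_transform_def packet_sup_def
proof (rule SUP_cong[OF refl])
  fix \<phi> assume "\<phi> \<in> Phi M P"
  then have [measurable]: "\<phi> \<in> borel_measurable borel" using packet_measurable Phi_packet M P by blast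
  note f'(1)[measurable]
  have "inner_L2 f \<phi> = (LINT x|lebesgue. f' x * cnj (\<phi> x))"
    unfolding inner_L2_def
  proof (rule integral_cong_AE)
    show "(\<lambda>x. f x * cnj (\<phi> x)) \<in> borel_measurable lebesgue"
      by (intro borel_measurable_times f measurable_completion) measurable
    show "(\<lambda>x. f' x * cnj (\<phi> x)) \<in> borel_measurable lebesgue" by (intro measurable_completion) measurable
    show "AE x in lebesgue. f x * cnj (\<phi> x) = f' x * cnj (\<phi> x)"
      using AE_completion[OF f'(2)] by eventually_elim simp
  qed
  also have "\<dots> = (ip f' \<phi>)" by (rule integral_completion) measurable
  finally show "cmod (inner_L2 f \<phi>) = cmod (ip f' \<phi>)" by simp
qed

text \<open>An interval containing \<open>fst P\<close> contains each point of it, so its average is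
  below the maximal function at all these points. The strict inequality provides a point of
  \<open>fst P\<close> where the maximal function is below \<open>K\<close>.\<close>

lemma local_norm_average:
  assumes f': "f' \<in> borel_measurable borel" "AE x in lborel. f x = f' x"
    and p: "1 < p" and K: "0 < K" "local_norm p PP f < ennreal K"
    and P: "P \<in> PP" and I: "proper_interval I" "fst P \<subseteq> I"
  shows "(\<integral>\<^sup>+x. ennreal (cmod (f' x) powr p) * indicator I x \<partial>lborel) \<le> ennreal (K powr p * ivl_length I)"
proof -
  note f'(1)[measurable]
  have [measurable]: "I \<in> sets borel" by (rule proper_interval_borel[OF I(1)])
  have l: "0 < ivl_length I" by (rule proper_interval_length_pos[OF I(1)])
  have "(INF x\<in>fst P. maximal_fun p f x) \<le> local_norm p PP f" unfolding local_norm_def by (rule SUP_upper[OF P])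
  then have "(INF x\<in>fst P. maximal_fun p f x) < ennreal K" using K(2) by order
  then obtain x where x: "x \<in> fst P" "maximal_fun p f x < ennreal K" unfolding INF_less_iff by blast
  define X where "X = (\<integral>\<^sup>+y\<in>I. ennreal (cmod (f y) powr p) \<partial>lebesgue)"
  have X: "X = (\<integral>\<^sup>+x. ennreal (cmod (f' x) powr p) * indicator I x \<partial>lborel)"
  proof -
    have "X = (\<integral>\<^sup>+x. ennreal (cmod (f' x) powr p) * indicator I x \<partial>lebesgue)"
      unfolding X_def
    proof (rule nn_integral_cong_AE)
      show "AE x in lebesgue. ennreal (cmod (f x) powr p) * indicator I x = ennreal (cmod (f' x) powr p) * indicator I x"
        using AE_completion[OF f'(2)] by eventually_elim simp
    qed
    then show ?thesis by (simp add: nn_integral_completion)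
  qed
  have "ennreal (ivl_length I powr (-1/p)) * epowr X (1/p) \<le> maximal_fun p f x"
    unfolding maximal_fun_def X_def using I x(1) by (intro SUP_upper) blast
  then have lt: "ennreal (ivl_length I powr (-1/p)) * epowr X (1/p) < ennreal K" using x(2) by order
  have "X \<noteq> \<infinity>"
  proof
    assume "X = \<infinity>"
    then have "ennreal (ivl_length I powr (-1/p)) * epowr X (1/p) = \<infinity>"
      using l by (simp add: epowr_def ennreal_mult_top)
    then show False using lt by simp
  qed
  then obtain y where y: "X = ennreal y" "0 \<le> y" by (cases X) auto
  have "ennreal (ivl_length I powr (-1/p) * y powr (1/p)) \<le> ennreal K"
    using lt y by (simp add: epowr_def ennreal_mult)
  then have "ivl_length I powr (-1/p) * y powr (1/p) \<le> K" using K(1) by (subst (asm) ennreal_le_iff) auto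
  then have "(ivl_length I powr (-1/p) * y powr (1/p)) powr p \<le> K powr p" using p by (intro powr_mono2) auto
  moreover have "(ivl_length I powr (-1/p) * y powr (1/p)) powr p = y / ivl_length I"
    using p y(2) l by (simp add: powr_mult powr_divide powr_powr powr_minus_divide)
  ultimately have "y \<le> K powr p * ivl_length I" using l by (simp add: divide_le_eq)
  then show ?thesis unfolding X[symmetric] y(1) by (rule ennreal_leI)
qed

lemma antimono_borel_measurable:
  fixes f :: "real \<Rightarrow> ennreal"
  assumes "\<And>x y. x \<le> y \<Longrightarrow> f y \<le> f x"
  shows "f \<in> borel_measurable borel"
proof (rule borel_measurableI_greater)
  fix c
  have "is_interval {x. c < f x}"
    unfolding is_interval_1 using assms by (auto intro: less_le_trans)
  then show "{x \<in> space borel. c < f x} \<in> sets borel" using real_interval_borel_measurable by simp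
qed

lemma rearrangement_measurable: "rearrangement D D' J \<kappa> s F \<in> borel_measurable borel"
proof (rule antimono_borel_measurable)
  fix x y :: real assume "x \<le> y"
  then show "rearrangement D D' J \<kappa> s F y \<le> rearrangement D D' J \<kappa> s F x"
    unfolding rearrangement_def by (intro Inf_superset_mono) (auto intro: order_trans ennreal_leI)
qed

text \<open>Some tree of any covering contains \<open>P\<close>, and its top interval is at least as
  long as \<open>fst P\<close>. This keeps the denominators in \<open>X_norm\<close> away from
  zero.\<close>

lemma outer_measure_tiles_pos:
  assumes "P \<in> A" "A \<subseteq> tiles_in D D' J" "dyadic_grid \<rho> D" "proper_interval J"
  shows "0 < outer_measure_tiles D D' J \<kappa> A"
proof -
  have PI: "fst P \<in> D" using assms(1,2) by (auto simp: tiles_in_def all_tiles_def)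
  have l: "0 < ltile P" by (rule proper_interval_length_pos[OF grid_proper[OF assms(3) PI]])
  have J: "0 < ivl_length J" by (rule proper_interval_length_pos[OF assms(4)])
  have "0 < ennreal (ltile P) / ennreal (ivl_length J)" using l J by (simp add: divide_ennreal)
  also have "\<dots> \<le> outer_measure_tiles D D' J \<kappa> A"
    unfolding outer_measure_tiles_def
  proof (rule INF_greatest)
    fix \<T> assume "\<T> \<in> {\<T>. \<T> \<subseteq> trees_in D D' J \<kappa> \<and> A \<subseteq> (\<Union>T\<in>\<T>. tiles T)}"
    then obtain T where T: "T \<in> \<T>" "T \<in> trees_in D D' J \<kappa>" "P \<in> tiles T" using assms(1) by blast
    then have "top_ivl T \<in> D" "fst P \<subseteq> top_ivl T" unfolding trees_in_def is_tree_def by blast+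
    then have "ennreal (ltile P) \<le> ennreal (ltop T)"
      using proper_interval_subset(3) grid_proper[OF assms(3)] PI by (intro ennreal_leI) blast
    also have "\<dots> = (\<Sum>T\<in>{T}. ennreal (ltop T))" by simp
    also have "\<dots> \<le> (\<Sum>\<^sub>\<infinity>T\<in>\<T>. ennreal (ltop T))"
    proof -
      have "(\<Sum>\<^sub>\<infinity>T\<in>\<T>. ennreal (ltop T)) =
        (SUP F\<in>{F. finite F \<and> F \<subseteq> \<T>}. \<Sum>T\<in>F. ennreal (ltop T))"
        by (rule nonneg_infsum_complete) simp
      then show ?thesis by (simp only:) (rule SUP_upper, use T(1) in simp)
    qed
    finally show "ennreal (ltile P) / ennreal (ivl_length J) \<le> (\<Sum>\<^sub>\<infinity>T\<in>\<T>. ennreal (ltop T)) / ennreal (ivl_length J)"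
      by (rule divide_right_mono_ennreal)
  qed
  finally show ?thesis .
qed

context dual_grid_pair
begin

lemma rearrangement_le:
  fixes w :: "tile \<Rightarrow> real"
  assumes PP: "finite PP" and A: "A \<subseteq> tiles_in D D' J" "outer_measure_tiles D D' J \<kappa> A \<le> ennreal u" and \<tau>: "0 \<le> \<tau>"
    and size: "\<And>U. U \<in> trees_in D D' J \<kappa> \<Longrightarrow> lacunary U \<Longrightarrow>
      (\<Sum>P\<in>PP \<inter> tiles U - A. ltile P * (w P)\<^sup>2) \<le> \<tau>\<^sup>2 * ltop U"
  shows "rearrangement D D' J \<kappa> (size2_star D D' J \<kappa>) (restrict_to PP (\<lambda>P. complex_of_real (w P))) u \<le> ennreal \<tau>"
proof -
  let ?G = "restrict_to PP (\<lambda>P. complex_of_real (w P))"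
  let ?F = "restrict_to (tiles_in D D' J - A) ?G"
  have "size2 ?F U \<le> ennreal \<tau>" if U: "U \<in> trees_in D D' J \<kappa>" "lacunary U" for U
  proof -
    have L: "0 < ltop U" by (rule tree_top_length_pos[OF U(1)])
    have UJ: "tiles U \<subseteq> tiles_in D D' J" "tiles U \<subseteq> all_tiles D D'" using U(1) unfolding trees_in_def is_tree_def by blast+
    let ?S = "\<Sum>P\<in>PP \<inter> tiles U - A. ltile P * (w P)\<^sup>2"
    have nn: "0 \<le> ltile P * (w P)\<^sup>2" if "P \<in> PP \<inter> tiles U - A" for P
      using tile_length_pos[of P] UJ(2) that by auto
    have "(\<Sum>\<^sub>\<infinity>P\<in>tiles U. ennreal (ltile P * (cmod (?F P))\<^sup>2)) = (\<Sum>\<^sub>\<infinity>P\<in>PP \<inter> tiles U - A. ennreal (ltile P * (w P)\<^sup>2))"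
    proof (rule infsum_cong_neutral)
      show "ennreal (ltile P * (w P)\<^sup>2) = 0" if "P \<in> PP \<inter> tiles U - A - tiles U" for P using that by blast
      show "ennreal (ltile P * (cmod (?F P))\<^sup>2) = 0" if "P \<in> tiles U - (PP \<inter> tiles U - A)" for P
      proof -
        have "P \<notin> PP \<or> P \<in> A" using that by blast
        then show ?thesis by (auto simp only: restrict_to_def) auto
      qed
      show "ennreal (ltile P * (cmod (?F P))\<^sup>2) = ennreal (ltile P * (w P)\<^sup>2)" if "P \<in> tiles U \<inter> (PP \<inter> tiles U - A)" for P
      proof -
        have "P \<in> tiles_in D D' J - A" "P \<in> PP" using that UJ(1) by blast+
        then show ?thesis by (simp add: restrict_to_def)
      qed
    qed
    also have "\<dots> = ennreal ?S" using PP nn by (subst infsum_finite) (auto intro!: sum_ennreal simp del: sum_ennreal)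
    finally have "size2 ?F U = epowr (ennreal ?S / ennreal (ltop U)) (1/2)" by (simp only: size2_def)
    also have "ennreal ?S / ennreal (ltop U) = ennreal (?S / ltop U)"
      using L nn by (intro divide_ennreal sum_nonneg) auto
    also have "epowr \<dots> (1/2) = ennreal (sqrt (?S / ltop U))"
    proof -
      have "0 \<le> ?S / ltop U" using L nn by (intro divide_nonneg_pos sum_nonneg)
      then show ?thesis by (simp only: epowr_def enn2real_ennreal powr_half_sqrt infinity_ennreal_def ennreal_neq_top if_False)
    qed
    also have "\<dots> \<le> ennreal \<tau>"
      using size[OF U] L \<tau> by (intro ennreal_leI real_le_lsqrt) (auto simp: divide_le_eq)
    finally show ?thesis .
  qed
  then have "outer_Linf D D' J \<kappa> (size2_star D D' J \<kappa>) ?F \<le> ennreal \<tau>"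
    unfolding outer_Linf_def size2_star_def by (intro SUP_least) blast
  then have "super_level D D' J \<kappa> (size2_star D D' J \<kappa>) ?G (ennreal \<tau>) \<le> outer_measure_tiles D D' J \<kappa> A"
    unfolding super_level_def using A(1) by (intro INF_lower) blast
  then have "super_level D D' J \<kappa> (size2_star D D' J \<kappa>) ?G (ennreal \<tau>) \<le> ennreal u" using A(2) by order
  then show ?thesis unfolding rearrangement_def by (intro Inf_lower) blast
qed

text \<open>For exponent \<infinity> the Lorentz norm is a pointwise supremum in \<open>u\<close>,
  and \<open>level\<close> bounds it on \<open>u < m\<close>. The power of \<open>m\<close> there is
  that in the denominator of the X norm.\<close>

lemma X_norm_le:
  fixes w :: "tile \<Rightarrow> real" and r C :: real
  assumes C: "0 \<le> C"
    and level: "\<And>A u m. A \<subseteq> tiles_in D D' J \<Longrightarrow> outer_measure_tiles D D' J \<kappa> A = ennreal m \<Longrightarrow> 0 < u \<Longrightarrow> u < m \<Longrightarrow>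
      rearrangement D D' J \<kappa> (size2_star D D' J \<kappa>) (restrict_to A (restrict_to PP (\<lambda>P. complex_of_real (w P)))) u
        \<le> ennreal (C * (m powr (1/2 - 1/r) / u powr (1/2)))"
    and PP: "finite PP" and J: "proper_interval J"
  shows "X_norm D D' J \<kappa> (size2_star D D' J \<kappa>) 2 r \<infinity> (restrict_to PP (\<lambda>P. complex_of_real (w P))) \<le> ennreal C"
  unfolding X_norm_def
proof (rule SUP_least)
  let ?s = "size2_star D D' J \<kappa>"
  fix A assume "A \<in> {A. A \<noteq> {} \<and> A \<subseteq> tiles_in D D' J \<and> outer_measure_tiles D D' J \<kappa> A < \<infinity>}"
  then have A: "A \<noteq> {}" "A \<subseteq> tiles_in D D' J" "outer_measure_tiles D D' J \<kappa> A < \<infinity>" by blast+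
  obtain m where m: "outer_measure_tiles D D' J \<kappa> A = ennreal m" "0 \<le> m" using A(3) by (cases "outer_measure_tiles D D' J \<kappa> A") auto
  obtain P where "P \<in> A" using A(1) by blast
  then have "0 < ennreal m" using outer_measure_tiles_pos[OF _ A(2) grid J, of P \<kappa>] m(1) by simp
  then have m0: "0 < m" using m(2) by (simp add: ennreal_less_zero_iff)
  let ?G = "restrict_to A (restrict_to PP (\<lambda>P. complex_of_real (w P)))"
  let ?c = "C * m powr (1/2 - 1/r)"
  have pt: "ennreal (u powr (1/2)) * rearrangement D D' J \<kappa> ?s ?G u \<le> ennreal ?c" if u: "0 < u" for u
  proof (cases "u < m")
    case True
    have "ennreal (u powr (1/2)) * rearrangement D D' J \<kappa> ?s ?G u \<le> ennreal (u powr (1/2)) * ennreal (C * (m powr (1/2 - 1/r) / u powr (1/2)))"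
      by (intro mult_left_mono level[OF A(2) m(1) u True]) auto
    also have "\<dots> = ennreal ?c" using u C by (simp add: ennreal_mult[symmetric])
    finally show ?thesis .
  next
    case False
    have G: "?G = restrict_to (PP \<inter> A) (\<lambda>P. complex_of_real (w P))" by (auto simp: restrict_to_def fun_eq_iff)
    \<comment> \<open>For \<open>u >= m\<close> the set \<open>A\<close> itself is an admissible
      exceptional set, so the rearrangement vanishes.\<close>
    have "rearrangement D D' J \<kappa> ?s ?G u \<le> ennreal 0"
      unfolding G
    proof (rule rearrangement_le[OF _ A(2)])
      show "outer_measure_tiles D D' J \<kappa> A \<le> ennreal u" using m(1) False by (simp add: ennreal_leI)
      show "(\<Sum>P\<in>PP \<inter> A \<inter> tiles U - A. ltile P * (w P)\<^sup>2) \<le> 0\<^sup>2 * ltop U" for U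
      proof -
        have "PP \<inter> A \<inter> tiles U - A = {}" by blast
        then show ?thesis by (simp only: sum.empty) simp
      qed
    qed (use PP in auto)
    then show ?thesis by simp
  qed
  have "outer_Lorentz D D' J \<kappa> ?s 2 \<infinity> ?G \<le> ennreal ?c"
    unfolding outer_Lorentz_def Lq_norm_def
  proof (simp only: if_True refl, rule esssup_I)
    have [measurable]: "rearrangement D D' J \<kappa> ?s ?G \<in> borel_measurable borel" by (rule rearrangement_measurable)
    have "(\<lambda>u. ennreal (u powr (1 / 2)) * rearrangement D D' J \<kappa> ?s ?G u) \<in> borel_measurable borel" by measurable
    then show "(\<lambda>u. ennreal (u powr (1 / 2)) * rearrangement D D' J \<kappa> ?s ?G u) \<in> borel_measurable haar_pos"
      unfolding haar_pos_def by (subst measurable_cong_sets[OF sets_density refl]) (rule measurable_restrict_space1, simp)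
    show "AE u in haar_pos. ennreal (u powr (1 / 2)) * rearrangement D D' J \<kappa> ?s ?G u \<le> ennreal ?c"
      using pt by (intro AE_I2) (auto simp: haar_pos_def space_restrict_space)
  qed
  also have "ennreal ?c = ennreal (m powr (1/2 - 1/r)) * ennreal C" using C by (simp add: ennreal_mult[symmetric] mult.commute)
  also have "ennreal (m powr (1/2 - 1/r)) = epowr (outer_measure_tiles D D' J \<kappa> A) (1/2 - 1/r)" using m by (simp add: epowr_def)
  finally have le: "outer_Lorentz D D' J \<kappa> ?s 2 \<infinity> ?G \<le> epowr (outer_measure_tiles D D' J \<kappa> A) (1/2 - 1/r) * ennreal C" .
  have "0 < epowr (outer_measure_tiles D D' J \<kappa> A) (1/2 - 1/r)" using m m0 by (simp add: epowr_def ennreal_less_zero_iff)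
  then show "outer_Lorentz D D' J \<kappa> ?s 2 \<infinity> ?G / epowr (outer_measure_tiles D D' J \<kappa> A) (1/2 - 1/r) \<le> ennreal C"
    using le by (rule divide_le_posI_ennreal)
qed

lemma X_norm_wave_packet_transform_le:
  assumes f: "bounded_compactly_supported f" and p: "1 < p" "p \<le> 2" and J: "proper_interval J"
    and PP: "finite PP" "PP \<subseteq> all_tiles D D'" and M: "8 \<le> M" and r: "0 < r" "1 / r \<le> 1 - 1 / p"
    and K: "0 < K" "local_norm p PP f < ennreal K"
  shows "X_norm D D' J \<kappa> (size2_star D D' J \<kappa>) 2 r \<infinity> (restrict_to PP (\<lambda>P. complex_of_real (wave_packet_transform M f P)))
    \<le> ennreal (sqrt (level_const \<kappa>) * K)"
proof -
  obtain f' Bd where f': "f' \<in> borel_measurable borel" "AE x in lborel. f x = f' x" and f'i: "integrable lborel f'" and Bd: "\<And>x. cmod (f' x) \<le> Bd"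
    using borel_representative[OF f] by blast
  have fm: "f \<in> borel_measurable lebesgue" using f by (simp add: bounded_compactly_supported_def)
  let ?w = "\<lambda>P. packet_sup M P f'"
  have lc: "0 \<le> level_const \<kappa>"
    using tree_const_pos[of \<kappa>] weak_const_pos[of 36 \<kappa>] by (simp add: level_const_def)
  have "restrict_to PP (\<lambda>P. complex_of_real (wave_packet_transform M f P)) = restrict_to PP (\<lambda>P. complex_of_real (?w P))"
  proof
    fix P
    show "restrict_to PP (\<lambda>P. complex_of_real (wave_packet_transform M f P)) P = restrict_to PP (\<lambda>P. complex_of_real (?w P)) P"
    proof (cases "P \<in> PP")
      case True
      then have "P \<in> all_tiles D D'" using PP(2) by blast
      then show ?thesis using True wave_packet_transform_eq_packet_sup[OF fm f' M tile_proper(1)] by (simp add: restrict_to_def)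
    qed (simp add: restrict_to_def)
  qed
  moreover have "X_norm D D' J \<kappa> (size2_star D D' J \<kappa>) 2 r \<infinity> (restrict_to PP (\<lambda>P. complex_of_real (?w P))) \<le> ennreal (sqrt (level_const \<kappa>) * K)"
  proof (rule X_norm_le[OF _ _ PP(1) J])
    show "0 \<le> sqrt (level_const \<kappa>) * K" using lc K(1) by simp
    fix A u m assume A: "A \<subseteq> tiles_in D D' J" and m: "outer_measure_tiles D D' J \<kappa> A = ennreal m" and u: "0 < u" "u < m"
    have G: "restrict_to A (restrict_to PP (\<lambda>P. complex_of_real (?w P))) = restrict_to (PP \<inter> A) (\<lambda>P. complex_of_real (?w P))"
      by (auto simp: restrict_to_def fun_eq_iff)
    \<comment> \<open>The square root of the bound in \<open>level_estimate\<close>, since sizes are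
      square roots of averages.\<close>
    define \<tau> where "\<tau> = sqrt (level_const \<kappa>) * K * (m powr (1/2 - 1/r) / u powr (1/2))"
    have \<tau>0: "0 \<le> \<tau>" using lc K(1) by (simp add: \<tau>_def)
    have \<tau>2: "\<tau>\<^sup>2 = level_const \<kappa> * K\<^sup>2 * (m powr (1 - 2 / r) / u)"
    proof -
      have "(m powr (1/2 - 1/r))\<^sup>2 = m powr (1 - 2 / r)" using u by (simp add: power2_eq_square powr_add[symmetric])
      moreover have "(u powr (1/2))\<^sup>2 = u" using u by (simp add: power2_eq_square powr_add[symmetric])
      ultimately show ?thesis using lc by (simp add: \<tau>_def power_mult_distrib power_divide)
    qed
    have fin: "finite (PP \<inter> A)" "PP \<inter> A \<subseteq> tiles_in D D' J" using PP(1) A by auto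
    obtain B where B: "B \<subseteq> tiles_in D D' J" "outer_measure_tiles D D' J \<kappa> B \<le> ennreal u"
      and size: "\<And>U. U \<in> trees_in D D' J \<kappa> \<Longrightarrow> lacunary U \<Longrightarrow>
        (\<Sum>P\<in>PP \<inter> A \<inter> tiles U - B. ltile P * (packet_sup M P f')\<^sup>2) \<le> level_const \<kappa> * K\<^sup>2 * (m powr (1 - 2 / r) / u) * ltop U"
      using level_estimate[OF f'i Bd p K(1) fin J M _ u(1) _ r, of m \<kappa>] local_norm_average[OF f' p(1) K] u(2) by fastforce
    have "rearrangement D D' J \<kappa> (size2_star D D' J \<kappa>) (restrict_to (PP \<inter> A) (\<lambda>P. complex_of_real (?w P))) u \<le> ennreal \<tau>"
      by (rule rearrangement_le[OF fin(1) B \<tau>0]) (use size in \<open>simp only: \<tau>2\<close>)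
    then show "rearrangement D D' J \<kappa> (size2_star D D' J \<kappa>) (restrict_to A (restrict_to PP (\<lambda>P. complex_of_real (?w P)))) u
        \<le> ennreal (sqrt (level_const \<kappa>) * K * (m powr (1/2 - 1/r) / u powr (1/2)))"
      unfolding G \<tau>_def .
  qed
  ultimately show ?thesis by simp
qed

end

theorem theorem4:
  fixes t :: real and \<kappa> :: nat
  assumes "t > 1"
  shows "\<exists>C::real. C > 1 \<and>
    (\<forall>D D' (p::real) J (f :: real \<Rightarrow> complex) PP (M::nat).
       dual_grids D D' \<longrightarrow> 1 < p \<longrightarrow> p \<le> 2 \<longrightarrow> proper_interval J \<longrightarrow>
       bounded_compactly_supported f \<longrightarrow> finite PP \<longrightarrow> PP \<subseteq> all_tiles D D' \<longrightarrow>
       int M \<ge> 10 * \<lceil>2 ^ 8 * (t / (t - 1))\<rceil> \<longrightarrow>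
       X_norm D D' J \<kappa> (size2_star D D' J \<kappa>) 2 (t * (p / (p - 1))) \<infinity>
         (restrict_to PP (\<lambda>P. complex_of_real (wave_packet_transform M f P)))
       \<le> ennreal C * local_norm p PP f)"
proof (intro exI conjI allI impI)
  define c where "c = sqrt (level_const \<kappa>)"
  have c: "0 \<le> c" using tree_const_pos[of \<kappa>] weak_const_pos[of 36 \<kappa>] by (simp add: c_def level_const_def)
  \<comment> \<open>Adding 2 makes the constant exceed one and keeps it positive, so that the right
    side is infinite when the local norm is.\<close>
  then show "sqrt (level_const \<kappa>) + 2 > 1" unfolding c_def by linarith
  fix D D' :: "real set set" and p :: real and J :: "real set" and f :: "real \<Rightarrow> complex" and PP :: "tile set" and M :: nat
  assume dual: "dual_grids D D'" and p: "1 < p" "p \<le> 2" and J: "proper_interval J"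
    and f: "bounded_compactly_supported f" and PP: "finite PP" "PP \<subseteq> all_tiles D D'"
    and M: "int M \<ge> 10 * \<lceil>2 ^ 8 * (t / (t - 1))\<rceil>"
  obtain \<rho> \<rho>' where "dyadic_grid \<rho> D" "dyadic_grid \<rho>' D'" using dual by (auto simp: dual_grids_def)
  then interpret dual_grid_pair D D' \<rho> \<rho>' by unfold_locales
  have M8: "8 \<le> M"
  proof -
    have "1 \<le> t / (t - 1)" using assms by simp
    then have "1 \<le> \<lceil>2 ^ 8 * (t / (t - 1))\<rceil>" by (simp add: one_le_ceiling)
    then show ?thesis using M by linarith
  qed
  define r where "r = t * (p / (p - 1))"
  have r: "0 < r" "1 / r \<le> 1 - 1 / p"
  proof -
    show "0 < r" using assms p by (simp add: r_def)
    have "1 / r = (1 / t) * (1 - 1 / p)" using assms p by (simp add: r_def field_simps)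
    also have "\<dots> \<le> 1 * (1 - 1 / p)" using assms p by (intro mult_right_mono) auto
    finally show "1 / r \<le> 1 - 1 / p" by simp
  qed
  let ?X = "X_norm D D' J \<kappa> (size2_star D D' J \<kappa>) 2 (t * (p / (p - 1))) \<infinity>
         (restrict_to PP (\<lambda>P. complex_of_real (wave_packet_transform M f P)))"
  have main: "?X \<le> ennreal (c * K)" if "0 < K" "local_norm p PP f < ennreal K" for K
    using X_norm_wave_packet_transform_le[OF f p J PP M8 r that, of \<kappa>] by (simp add: r_def c_def)
  show "?X \<le> ennreal (sqrt (level_const \<kappa>) + 2) * local_norm p PP f"
  proof (cases "local_norm p PP f")
    case top
    then show ?thesis using c by (simp add: c_def ennreal_mult_top add_nonneg_pos)
  next
    case (real k)
    have "?X \<le> ennreal (c * k)"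
    proof (rule ennreal_le_epsilon)
      fix e :: real assume e: "0 < e"
      \<comment> \<open>The main estimate needs a positive \<open>K\<close> strictly above the local
        norm, which may be zero; this choice exceeds it by an amount costing at most
        \<open>e\<close>.\<close>
      have "?X \<le> ennreal (c * (k + e / (c + 1)))"
        using real e c by (intro main) (auto simp: ennreal_less_iff add_nonneg_pos)
      also have "c * (k + e / (c + 1)) \<le> c * k + e"
        using c e by (simp add: field_simps)
      finally show "?X \<le> ennreal (c * k) + ennreal e"
        using c e real by (simp add: ennreal_plus[symmetric] del: ennreal_plus) (meson ennreal_leI order_trans)
    qed
    also have "\<dots> \<le> ennreal ((c + 2) * k)" using real c by (intro ennreal_leI) (simp add: algebra_simps)
    also have "\<dots> = ennreal (sqrt (level_const \<kappa>) + 2) * local_norm p PP f"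
      using real c by (simp add: c_def ennreal_mult)
    finally show ?thesis .
  qed
qed

end
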